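(* Let $A \in \mathbb{C}^{n\times p}$, $B \in \mathbb{C}^{m\times q}$, $C \in \mathbb{C}^{n\times q}$, $D \in \mathbb{C}^{n}_{\mathrm{H}}$ and $M \in \mathbb{C}^{q}_{\mathrm{H}}$ be given, and define $\phi(X) = (AXB + C)M(AXB + C)^{*} + D$ for $X \in \mathbb{C}^{p\times m}$. Define $$N_1 = \begin{bmatrix} D + CMC^{*} & A \\ A^{*} & 0\end{bmatrix},\quad N_2 = \begin{bmatrix} D + CMC^{*} & CMB^{*} & A \\ A^{*} & 0 & 0\end{bmatrix},$$ $$N_3 = \begin{bmatrix} D + CMC^{*} & CMB^{*} \\ BMC^{*} & BMB^{*}\end{bmatrix},\quad N_4 = \begin{bmatrix} D + CMC^{*} & CMB^{*} & A \\ BMC^{*} & BMB^{*} & 0\end{bmatrix},$$ and $s_1 = r(N_1) - 2r(N_2)$, $s_2 = r(N_3) - 2r(N_4)$, $s_3 = i_{+}(N_1) + i_{-}(N_3) - r(N_2) - r(N_4)$, $s_4 = i_{-}(N_1) + i_{+}(N_3) - r(N_2) - r(N_4)$. Then \begin{align*} \max_{X\in \mathbb{C}^{p\times m}} r[\phi(X)] &= \min\{ r[\,D + CMC^{*},\, CMB^{*},\, A\,],\ r(N_1),\ r(N_3)\},\\ \min_{X\in \mathbb{C}^{p\times m}} r[\phi(X)] &= 2r[\,D + CMC^{*},\, CMB^{*},\, A\,] + \max\{s_1, s_2, s_3, s_4\},\\ \max_{X\in \mathbb{C}^{p\times m}} i_{\pm}[\phi(X)] &= \min\{ i_{\pm}(N_1),\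 i_{\pm}(N_3)\},\\ \min_{X\in \mathbb{C}^{p\times m}} i_{\pm}[\phi(X)] &= r[\,D + CMC^{*},\, CMB^{*},\, A\,] + \max\{ i_{\pm}(N_1) - r(N_2),\ i_{\pm}(N_3) - r(N_4)\}. \end{align*}
   Context: $\mathbb{C}^{k}_{\mathrm{H}}$ denotes the set of $k\times k$ complex Hermitian matrices; $A^{*}$ is the conjugate transpose, $r(\cdot)$ the rank; for a Hermitian matrix $H$, $i_{+}(H)$ and $i_{-}(H)$ denote the numbers of positive and negative eigenvalues of $H$ counted with multiplicities. $[\,U, V, W\,]$ denotes the row block matrix formed from $U$, $V$, $W$. *)

theory Defs
  imports "Jordan_Normal_Form.Schur_Decomposition" "Jordan_Normal_Form.DL_Rank"
begin

definition mrank :: "complex mat \<Rightarrow> nat" where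
  "mrank A = vec_space.rank (dim_row A) A"

definition ipos :: "complex mat \<Rightarrow> nat" where
  "ipos H = (\<Sum>c \<in> {c. eigenvalue H c \<and> c \<in> \<real> \<and> Re c > 0}. order c (char_poly H))"

definition ineg :: "complex mat \<Rightarrow> nat" where
  "ineg H = (\<Sum>c \<in> {c. eigenvalue H c \<and> c \<in> \<real> \<and> Re c < 0}. order c (char_poly H))"

definition hermitian :: "complex mat \<Rightarrow> bool" where
  "hermitian H \<longleftrightarrow> dim_row H = dim_col H \<and> mat_adjoint H = H"

definition hcat :: "complex mat \<Rightarrow> complex mat \<Rightarrow> complex mat" where
  "hcat U V = mat (dim_row U) (dim_col U + dim_col V)
     (\<lambda>(i,j). if j < dim_col U then U $$ (i,j) else V $$ (i, j - dim_col U))"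

end

theory Submission
  imports Defs "HOL-Library.Function_Algebras"
begin

text \<open>
  Let \<open>h\<close> be the Hermitian form of the block matrix \<open>N3\<close> on \<open>E = C^(n+m)\<close>. Since
  \<open>\<phi> X = [I, AX] N3 [I, AX]*\<close>, the matrix \<open>\<phi> X\<close> represents the restriction of \<open>h\<close> to the graph of
  \<open>X*A*\<close>. As \<open>X\<close> varies, these graphs are exactly the complements \<open>W\<close> of \<open>F = 0 \<oplus> C^m\<close> in \<open>E\<close> that contain
  \<open>K = ker A*\<close>, so the theorem is about the inertia of a Hermitian form restricted to such complements. The
  ranks and inertias of the \<open>N_i\<close> are invariants of the form on \<open>K\<close>, \<open>G = K + F\<close> and \<open>E\<close>: with
  \<open>a = r(A)\<close>, \<open>i(N1) = i(K) + a\<close>, \<open>i(N3) = i(E)\<close>, \<open>R = n - dim (K \<inter> E\<^sup>\<bottom>)\<close>,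
  \<open>r(N2) = n + a - dim (K \<inter> G\<^sup>\<bottom>)\<close>, \<open>r(N4) = n + m - dim (G \<inter> E\<^sup>\<bottom>)\<close>.

  All bounds, and the complements attaining them, come from enlarging \<open>K\<close> by one vector \<open>e \<notin> G\<close> at a time.
  If the radical of \<open>K\<close> does not annihilate \<open>e\<close>, both indices of inertia grow by one; otherwise \<open>e\<close> may be taken
  orthogonal to \<open>K\<close> and only the sign of \<open>h(e,e)\<close> matters. The two minimal indices are attained by the same
  complement, which is why the minimal rank is their sum, i.e. the maximum of the four sums \<open>s_1, \<dots>, s_4\<close>.
\<close>

section \<open>Hermitian forms on finite-dimensional subspaces\<close>

text \<open>The restrictions of \<open>h\<close> to the subspaces met on the way are usually
  degenerate, and no basis is adapted to \<open>K\<close>, \<open>F\<close> and \<open>h\<close>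
  together. The index is therefore the largest dimension of a positive definite subspace, and the
  negative index is the index of \<open>neg h\<close>, so one argument serves both signs. The
  difficulty lies in attaining the bounds: a new vector affects not only the indices but also how
  \<open>K\<close> and \<open>G K\<close> meet the radical of \<open>E\<close>, on which later steps
  depend. Each bound is hence stated for the current \<open>K\<close>, with correction terms such as
  \<open>dim (K \<inter> orth h E)\<close>, and kept as an invariant of the enlargement. At the end
  \<open>G W = E\<close>, the corrections cancel and the invariant is the claimed bound on
  \<open>W\<close>. Complements containing \<open>K\<close> are the right objects because a
  complement of \<open>F\<close> is the graph of a linear map from C^n to C^m, and such a map
  factors through the adjoint of \<open>A\<close> exactly when it vanishes on the kernel of that
  adjoint.\<close>

locale complex_space = vector_space scale
  for scale :: "complex \<Rightarrow> 'v::ab_group_add \<Rightarrow> 'v" (infixr \<open>*s\<close> 75)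
begin

abbreviation ext :: "'v \<Rightarrow> 'v set \<Rightarrow> 'v set" where
  "ext e S \<equiv> span (insert e S)"

text \<open>The ambient space is infinite-dimensional once sequences represent vectors of all
  lengths, so finiteness is attached to subspaces. Being a subspace is part of the notion.\<close>

definition findim :: "'v set \<Rightarrow> bool" where
  "findim S \<longleftrightarrow> subspace S \<and> (\<exists>B. finite B \<and> S \<subseteq> span B)"

definition orth :: "('v \<Rightarrow> 'v \<Rightarrow> complex) \<Rightarrow> 'v set \<Rightarrow> 'v set" where
  "orth h S = {x. \<forall>y\<in>S. h x y = 0}"

definition hform :: "('v \<Rightarrow> 'v \<Rightarrow> complex) \<Rightarrow> bool" where
  "hform h \<longleftrightarrow> (\<forall>x y z. h (x + y) z = h x z + h y z) \<and>
     (\<forall>c x y. h (c *s x) y = c * h x y) \<and> (\<forall>x y. h y x = cnj (h x y))"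

definition posdef :: "('v \<Rightarrow> 'v \<Rightarrow> complex) \<Rightarrow> 'v set \<Rightarrow> bool" where
  "posdef h P \<longleftrightarrow> (\<forall>x\<in>P. x \<noteq> 0 \<longrightarrow> Re (h x x) > 0)"

text \<open>Sylvester's positive index of inertia in a form that makes sense for a degenerate
  restriction. For finite-dimensional \<open>K\<close> the set of dimensions contains 0 and is
  bounded by \<open>dim K\<close>, so \<open>Max\<close> is meaningful.\<close>

definition pindex :: "('v \<Rightarrow> 'v \<Rightarrow> complex) \<Rightarrow> 'v set \<Rightarrow> nat" where
  "pindex h K = Max {dim P | P. subspace P \<and> P \<subseteq> K \<and> posdef h P}"

definition neg :: "('v \<Rightarrow> 'v \<Rightarrow> complex) \<Rightarrow> 'v \<Rightarrow> 'v \<Rightarrow> complex" where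
  "neg h x y = - h x y"

declare dim_span [simp del]

section \<open>Dimensions of finite-dimensional subspaces\<close>

lemma findim_subspace: "findim S \<Longrightarrow> subspace S"
  by (simp add: findim_def)

lemma findim_subset: "findim T \<Longrightarrow> subspace S \<Longrightarrow> S \<subseteq> T \<Longrightarrow> findim S"
  by (auto simp: findim_def)

lemma findim_zero: "findim {0}"
  unfolding findim_def by (auto intro: exI[of _ "{}"])

lemma findim_basis:
  assumes "findim S" obtains B where "finite B" "independent B" "span B = S" "card B = dim S" "B \<subseteq> S"
proof -
  obtain B where B: "B \<subseteq> S" "independent B" "S \<subseteq> span B" "card B = dim S"
    using basis_exists by blast
  obtain T where "finite T" "S \<subseteq> span T" using assms findim_def by auto
  with B have "finite B" using independent_span_bound by blast
  moreover have "span B = S" using B assms by (simp add: findim_subspace span_subspace)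
  ultimately show ?thesis using B that by blast
qed

lemma ext_iff: "subspace S \<Longrightarrow> x \<in> ext e S \<longleftrightarrow> (\<exists>c s. s \<in> S \<and> x = s + c *s e)"
  by (metis add_diff_cancel_right' diff_add_cancel span_breakdown_eq span_eq_iff)

lemma ext_mem: "e \<in> ext e S" by (simp add: span_base)

lemma ext_sup: "S \<subseteq> ext e S" by (meson insert_subset span_superset)

lemma ext_least: "subspace T \<Longrightarrow> S \<subseteq> T \<Longrightarrow> e \<in> T \<Longrightarrow> ext e S \<subseteq> T"
  by (simp add: span_minimal)

lemma findim_ext: "findim S \<Longrightarrow> findim (ext e S)"
proof -
  assume "findim S"
  then obtain B where "finite B" "S \<subseteq> span B" by (auto simp: findim_def)
  then have "ext e S \<subseteq> span (insert e B)"
    using ext_least[OF subspace_span, of S "insert e B" e] ext_mem span_mono[of B "insert e B"] by auto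
  with \<open>finite B\<close> show ?thesis unfolding findim_def by (meson finite_insert subspace_span)
qed

text \<open>The freedom used whenever the new vector is made orthogonal to \<open>K\<close> before
  its effect on the index is computed.\<close>

lemma ext_shift:
  assumes "subspace K" "k \<in> K" shows "ext (e - k) K = ext e K"
proof
  show "ext (e - k) K \<subseteq> ext e K"
    using assms(2) ext_sup[of K e] by (intro ext_least span_diff ext_mem) auto
  have "e \<in> ext (e - k) K"
    using span_add[OF ext_mem[of "e - k" K], of k] assms(2) ext_sup[of K "e - k"] by auto
  then show "ext e K \<subseteq> ext (e - k) K" by (intro ext_least ext_sup) auto
qed

lemma dim_ext: assumes "findim S" "e \<notin> S" shows "dim (ext e S) = Suc (dim S)"
proof -
  obtain B where B: "finite B" "independent B" "span B = S" "card B = dim S" "B \<subseteq> S"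
    using findim_basis assms by blast
  have "independent (insert e B)" using B assms by (simp add: independent_insertI)
  moreover have "span (insert e B) = ext e S"
    using B by (auto simp: span_insert span_span)
  moreover have "card (insert e B) = Suc (dim S)"
    using B assms(2) by (metis card_insert_disjoint subsetD)
  ultimately show ?thesis using dim_span_eq_card_independent by metis
qed

lemma dim_zero: "dim {0} = 0"
  by (metis card.empty dim_span_eq_card_independent independent_empty span_empty)

lemma dim_mono:
  assumes "findim T" "subspace S" "S \<subseteq> T" shows "dim S \<le> dim T"
proof -
  obtain B where "finite B" "span B = T" "card B = dim T" using findim_basis assms by metis
  then show ?thesis using dim_le_card assms by metis
qed

lemma dim_psub:
  assumes "findim T" "subspace S" "S \<subset> T" shows "dim S < dim T"
proof -
  obtain e where e: "e \<in> T" "e \<notin> S" using assms by auto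
  have "ext e S \<subseteq> T" using e assms by (simp add: ext_least findim_subspace)
  then have "dim (ext e S) \<le> dim T" using assms dim_mono by blast
  then show ?thesis using dim_ext e assms findim_subset by fastforce
qed

text \<open>Climbs a flag from \<open>K\<close> to \<open>L\<close> one vector at a time, while the
  codimension in \<open>L\<close> decreases. Most statements on indices below are one-step estimates
  summed along such a flag.\<close>

lemma findim_induct [consumes 3, case_names base step]:
  assumes "findim L" "subspace K" "K \<subseteq> L" and "P K"
    and step: "\<And>U e. subspace U \<Longrightarrow> findim U \<Longrightarrow> K \<subseteq> U \<Longrightarrow> U \<subseteq> L \<Longrightarrow> e \<in> L \<Longrightarrow> e \<notin> U \<Longrightarrow> P U \<Longrightarrow> P (ext e U)"
  shows "P L"
proof -
  have "subspace U \<Longrightarrow> K \<subseteq> U \<Longrightarrow> U \<subseteq> L \<Longrightarrow> P U \<Longrightarrow> P L" for U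
  proof (induction "dim L - dim U" arbitrary: U rule: less_induct)
    case less
    show ?case
    proof (cases "U = L")
      case True then show ?thesis using less by simp
    next
      case False
      then obtain e where e: "e \<in> L" "e \<notin> U" using less by auto
      have fU: "findim U" using assms less findim_subset by blast
      have "ext e U \<subseteq> L" using e less assms by (simp add: ext_least findim_subspace)
      moreover have "dim L - dim (ext e U) < dim L - dim U"
        using dim_ext[OF fU e(2)] dim_mono[OF assms(1) _ calculation] by simp
      moreover have "P (ext e U)" using step fU less e by blast
      ultimately show ?thesis using less.hyps[of "ext e U"] less.prems ext_sup[of U e] by blast
    qed
  qed
  then show ?thesis using assms by blast
qed

lemma dim_ext_le: assumes "findim S" shows "dim (ext e S) \<le> Suc (dim S)"
  by (metis assms dim_ext findim_subspace insert_absorb le_Suc_eq order_refl span_eq_iff)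

text \<open>Two vectors of \<open>P\<close> can be combined so that their
  \<open>e\<close>-components cancel, so one vector \<open>p\<close> outside \<open>K\<close>
  together with \<open>P \<inter> K\<close> already spans \<open>P\<close>.\<close>

lemma dim_Int_ext:
  assumes "findim P" "subspace K" "P \<subseteq> ext e K" shows "dim P \<le> Suc (dim (P \<inter> K))"
proof (cases "P \<subseteq> K")
  case True then show ?thesis by (simp add: inf.absorb1)
next
  case False
  then obtain p where p: "p \<in> P" "p \<notin> K" by auto
  have sPK: "subspace (P \<inter> K)" using assms findim_subspace subspace_inter by blast
  obtain k c where kc: "k \<in> K" "p = k + c *s e" using p assms ext_iff by blast
  then have c: "c \<noteq> 0" using p by auto
  have "P \<subseteq> ext p (P \<inter> K)"
  proof
    fix x assume x: "x \<in> P"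
    obtain k' c' where k': "k' \<in> K" "x = k' + c' *s e" using x assms ext_iff by blast
    define s where "s = x - (c'/c) *s p"
    have "s = k' - (c'/c) *s k" unfolding s_def k'(2) kc(2) using c
      by (simp add: scale_right_distrib algebra_simps)
    then have "s \<in> K" using kc k' assms by (simp add: subspace_diff subspace_scale)
    moreover have "s \<in> P" unfolding s_def using x p assms
      by (simp add: findim_subspace subspace_diff subspace_scale)
    ultimately show "x \<in> ext p (P \<inter> K)" unfolding ext_iff[OF sPK] s_def
      by (metis IntI diff_add_cancel)
  qed
  moreover have f: "findim (P \<inter> K)" using assms(1) sPK findim_subset by blast
  ultimately have "dim P \<le> dim (ext p (P \<inter> K))"
    using dim_mono[OF findim_ext[OF f] findim_subspace[OF assms(1)]] by blast
  then show ?thesis using dim_ext_le[OF f, of p] by linarith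
qed

text \<open>Along a flag from the kernel to \<open>S\<close> every new vector has a new image:
  otherwise it would differ from an earlier vector by an element of the kernel, which lies in the
  flag already.\<close>

lemma rank_nullity:
  assumes "findim S" and add: "\<And>x y. f (x + y) = f x + f y" and sc: "\<And>c x. f (c *s x) = c *s f x"
  shows "findim (f ` S) \<and> dim S = dim (f ` S) + dim {x \<in> S. f x = 0}"
proof -
  have lin: "Vector_Spaces.linear (*s) (*s) f"
    unfolding Vector_Spaces.linear_iff using add sc vector_space_axioms by auto
  interpret f: Vector_Spaces.linear "(*s)" "(*s)" f by (fact lin)
  define K where "K = {x \<in> S. f x = 0}"
  have K: "subspace K"
  proof -
    have "K = S \<inter> {x. f x = 0}" unfolding K_def by auto
    then show ?thesis
      using subspace_inter[OF findim_subspace[OF assms(1)] f.subspace_kernel] by simp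
  qed
  have K0: "f ` K = {0}" using subspace_0[OF K] unfolding K_def by auto
  have sub: "K \<subseteq> S" unfolding K_def by auto
  have "findim (f ` S) \<and> dim S = dim (f ` S) + dim K"
    using assms(1) K sub
  proof (induction rule: findim_induct)
    case base
    show ?case using K0 by (simp add: findim_zero dim_zero)
  next
    case (step U e)
    have eq: "f ` ext e U = ext (f e) (f ` U)" using f.span_image[of "insert e U"] by simp
    have "f e \<notin> f ` U"
    proof
      assume "f e \<in> f ` U"
      then obtain u where u: "u \<in> U" "f e = f u" by auto
      then have "e - u \<in> K" using step findim_subspace[OF assms(1)]
        by (auto simp: f.diff K_def intro!: subspace_diff)
      then have "e - u \<in> U" using step by blast
      then have "e \<in> U" using u step subspace_add[of U "e - u" u] by simp
      then show False using step by simp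
    qed
    then show ?case using step eq dim_ext[of U e] dim_ext[of "f ` U" "f e"] findim_ext by simp
  qed
  then show ?thesis unfolding K_def .
qed

section \<open>Hermitian forms, orthogonality and representable functionals\<close>

lemma hformI:
  assumes "\<And>x y z. h (x + y) z = h x z + h y z" "\<And>c x y. h (c *s x) y = c * h x y"
    "\<And>x y. h y x = cnj (h x y)"
  shows "hform h"
  unfolding hform_def by (intro conjI allI) (fact assms)+

lemma hform_neg:
  assumes "hform h" shows "hform (neg h)"
proof (rule hformI)
  show "neg h y x = cnj (neg h x y)" for x y
    using assms unfolding hform_def neg_def by (metis complex_cnj_minus)
  show "neg h (x + y) z = neg h x z + neg h y z" for x y z
    using assms unfolding hform_def neg_def by (metis add_uminus_conv_diff minus_add_distrib)
  show "neg h (c *s x) y = c * neg h x y" for c x y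
    using assms unfolding hform_def neg_def by (metis mult_minus_right)
qed

lemma neg_neg [simp]: "neg (neg h) = h"
  by (auto simp: neg_def fun_eq_iff)

lemma orth_neg [simp]: "orth (neg h) S = orth h S"
  by (simp add: orth_def neg_def)

context
  fixes h :: "'v \<Rightarrow> 'v \<Rightarrow> complex"
  assumes h: "hform h"
begin

lemma h_add1: "h (x + y) z = h x z + h y z"
  using h unfolding hform_def by blast

lemma h_scale1: "h (c *s x) y = c * h x y"
  using h unfolding hform_def by blast

lemma h_sym: "h y x = cnj (h x y)"
  using h unfolding hform_def by blast

lemma h_sym0: "h y x = 0 \<longleftrightarrow> h x y = 0"
  using h_sym[of y x] by simp

lemma h_add2: "h z (x + y) = h z x + h z y"
  by (metis complex_cnj_add h_add1 h_sym)

lemma h_scale2: "h y (c *s x) = cnj c * h y x"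
  by (metis complex_cnj_mult h_scale1 h_sym)

lemma h_zero1: "h 0 y = 0"
  using h_scale1[of 0 0 y] by simp

lemma h_zero2: "h y 0 = 0"
  using h_scale2[of y 0 0] by simp

lemma h_diff1: "h (x - y) z = h x z - h y z"
  using h_add1[of "x - y" y z] by simp

lemma h_diff2: "h z (x - y) = h z x - h z y"
  using h_add2[of z "x - y" y] by simp

lemmas h_simps = h_add1 h_add2 h_scale1 h_scale2 h_zero1 h_zero2 h_diff1 h_diff2

lemma h_self_real: "Im (h x x) = 0"
  by (metis complex_cnj_cancel_iff complex_In_mult_cnj_zero h_sym complex_cnj cnj.simps(2) neg_equal_zero)

lemma h_self_0: "h x x = 0 \<longleftrightarrow> Re (h x x) = 0"
  by (simp add: complex_eq_iff h_self_real)

lemma quad_expand: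
  "Re (h (x + c *s y) (x + c *s y))
    = Re (h x x) + 2 * Re (cnj c * h x y) + (cmod c)\<^sup>2 * Re (h y y)"
proof -
  have "h (x + c *s y) (x + c *s y) = h x x + cnj c * h x y + c * h y x + (c * cnj c) * h y y"
    by (simp add: h_simps algebra_simps)
  moreover have "c * h y x = cnj (cnj c * h x y)" using h_sym[of y x] by simp
  moreover have "Re (c * cnj c * h y y) = (cmod c)\<^sup>2 * Re (h y y)"
    unfolding complex_norm_square[symmetric] by simp
  ultimately show ?thesis by simp
qed

lemma subspace_ker: "subspace {x. h x y = 0}"
  by (rule subspaceI) (auto simp: h_simps)

lemma subspace_orth: "subspace (orth h S)"
  unfolding orth_def by (rule subspaceI) (auto simp: h_simps)

lemma subspace_perp: "subspace {y. \<forall>x\<in>S. h x y = 0}"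
  by (rule subspaceI) (auto simp: h_simps)

lemma orth_span: "orth h (span S) = orth h S"
proof -
  have "S \<subseteq> {y. h x y = 0} \<Longrightarrow> span S \<subseteq> {y. h x y = 0}" for x
    using subspace_perp[of "{x}"] by (intro span_minimal) auto
  then show ?thesis unfolding orth_def using span_superset[of S] by blast
qed

lemma orth_anti: "S \<subseteq> T \<Longrightarrow> orth h T \<subseteq> orth h S"
  by (auto simp: orth_def)

lemma orth_ext: "orth h (ext e S) = orth h S \<inter> {x. h x e = 0}"
  unfolding orth_span by (auto simp: orth_def)

text \<open>Induction on \<open>T\<close>: on the kernel \<open>K1\<close> of
  \<open>\<lambda>x. h x a\<close> the remaining vectors of \<open>T\<close> suffice, and a multiple
  of \<open>a\<close> repairs the value at a single vector \<open>z\<close> outside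
  \<open>K1\<close>, which fixes it on all of \<open>K\<close>.\<close>

lemma representer_finite:
  assumes "finite T" "subspace K"
    and "\<And>x y. x \<in> K \<Longrightarrow> y \<in> K \<Longrightarrow> f (x + y) = f x + f y"
    and "\<And>c x. x \<in> K \<Longrightarrow> f (c *s x) = c * f x"
    and "\<And>x. x \<in> K \<Longrightarrow> x \<in> orth h T \<Longrightarrow> f x = 0"
  shows "\<exists>t\<in>span T. \<forall>x\<in>K. f x = h x t"
  using assms
proof (induction T arbitrary: K rule: finite_induct)
  case empty
  then show ?case by (auto simp: orth_def h_simps)
next
  case (insert a T)
  define K1 where "K1 = K \<inter> {x. h x a = 0}"
  have sK1: "subspace K1" unfolding K1_def
    by (rule subspace_inter[OF insert.prems(1) subspace_ker])
  have "\<exists>t\<in>span T. \<forall>x\<in>K1. f x = h x t"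
  proof (rule insert.IH[OF sK1])
    show "f (x + y) = f x + f y" if "x \<in> K1" "y \<in> K1" for x y
      using insert.prems(2)[of x y] that by (simp add: K1_def)
    show "f (c *s x) = c * f x" if "x \<in> K1" for c x
      using insert.prems(3)[of x c] that by (simp add: K1_def)
    show "f x = 0" if "x \<in> K1" "x \<in> orth h T" for x
      using insert.prems(4)[of x] that by (simp add: K1_def orth_def)
  qed
  then obtain t where t: "t \<in> span T" "\<forall>x\<in>K1. f x = h x t" by auto
  have tin: "t \<in> span (insert a T)" using t span_mono[of T "insert a T"] by auto
  show ?case
  proof (cases "K1 = K")
    case True then show ?thesis using t tin by auto
  next
    case False
    then obtain z where z: "z \<in> K" "h z a \<noteq> 0" unfolding K1_def by auto
    \<comment> \<open>\<open>c\<close> makes both functionals agree at \<open>z\<close>; it enters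
      \<open>t'\<close> conjugated because \<open>h\<close> is antilinear in its second
      argument.\<close>
    define c where "c = (f z - h z t) / h z a"
    define t' where "t' = t + cnj c *s a"
    have "f x = h x t'" if x: "x \<in> K" for x
    proof -
      define d where "d = h x a / h z a"
      define y where "y = x + (- d) *s z"
      have "y \<in> K1" unfolding K1_def y_def d_def using x z insert.prems(1)
        by (simp add: h_simps subspace_diff subspace_scale)
      then have "f y = h y t" using t by auto
      moreover have "f y = f x + (- d) * f z"
        unfolding y_def using insert.prems(1-3) x z by (metis subspace_scale)
      moreover have "h y t = h x t + (- d) * h z t"
        unfolding y_def by (simp only: h_simps)
      ultimately have "f x = h x t + d * (f z - h z t)" by (simp add: algebra_simps)
      then show ?thesis unfolding t'_def c_def d_def using z by (simp add: h_simps)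
    qed
    moreover have "t' \<in> span (insert a T)" unfolding t'_def
      by (intro span_add tin span_scale span_base) auto
    ultimately show ?thesis by auto
  qed
qed

lemma representer:
  assumes "findim T" "subspace K"
    and "\<And>x y. x \<in> K \<Longrightarrow> y \<in> K \<Longrightarrow> f (x + y) = f x + f y"
    and "\<And>c x. x \<in> K \<Longrightarrow> f (c *s x) = c * f x"
    and "\<And>x. x \<in> K \<Longrightarrow> x \<in> orth h T \<Longrightarrow> f x = 0"
  shows "\<exists>t\<in>T. \<forall>x\<in>K. f x = h x t"
proof -
  obtain B where "finite B" "span B = T" using assms findim_basis by metis
  then show ?thesis using representer_finite[of B K f] assms orth_span[of B] by auto
qed

text \<open>The functional \<open>\<lambda>x. h x e\<close> is represented by some \<open>t\<close>
  in \<open>T\<close> as soon as it vanishes on the vectors of \<open>K\<close> orthogonal to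
  \<open>T\<close>. This replaces an orthogonal projection, which a degenerate form does not
  provide.\<close>

lemma project:
  assumes "findim T" "subspace K" and "\<And>x. x \<in> K \<Longrightarrow> x \<in> orth h T \<Longrightarrow> h x e = 0"
  shows "\<exists>t\<in>T. \<forall>x\<in>K. h x (e - t) = 0"
  using representer[of T K "\<lambda>x. h x e"] assms by (auto simp: h_simps)

text \<open>\<open>project\<close> with \<open>T = K\<close>: the only obstruction to making
  \<open>e\<close> orthogonal to \<open>K\<close> is a radical vector of \<open>K\<close> that pairs
  with \<open>e\<close>. The one-step computations of indices split along this dichotomy.\<close>

lemma radical_cases:
  assumes "findim K"
  obtains (rad) x where "x \<in> K" "x \<in> orth h K" "h x e \<noteq> 0"
    | (perp) k where "k \<in> K" "\<And>x. x \<in> K \<Longrightarrow> h x (e - k) = 0"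
  using project[of K K e] assms findim_subspace by blast

lemma dim_ker:
  assumes "findim S" "x \<in> S" "h x e \<noteq> 0"
  shows "dim S = Suc (dim (S \<inter> {x. h x e = 0}))"
proof -
  let ?K = "S \<inter> {x. h x e = 0}"
  have sS: "subspace S" using assms findim_subspace by blast
  have sK: "subspace ?K" using sS subspace_inter subspace_ker by blast
  have "ext x ?K = S"
  proof
    show "ext x ?K \<subseteq> S" using assms sS by (intro ext_least) auto
    show "S \<subseteq> ext x ?K"
    proof
      fix y assume y: "y \<in> S"
      let ?d = "h y e / h x e"
      have "y - ?d *s x \<in> ?K" using assms y sS by (simp add: h_simps subspace_diff subspace_scale)
      moreover have "y = (y - ?d *s x) + ?d *s x" by simp
      ultimately show "y \<in> ext x ?K" unfolding ext_iff[OF sK] by blast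
    qed
  qed
  moreover have "findim ?K" using findim_subset[OF assms(1) sK] by auto
  ultimately show ?thesis using dim_ext[of ?K x] assms by auto
qed

lemma dim_ker_le: assumes "findim S" shows "dim S \<le> Suc (dim (S \<inter> {x. h x e = 0}))"
proof (cases "\<exists>x\<in>S. h x e \<noteq> 0")
  case True then show ?thesis using dim_ker assms by auto
next
  case False then have "S \<inter> {x. h x e = 0} = S" by auto
  then show ?thesis by simp
qed

lemma posdef_ext:
  assumes P: "subspace P" "posdef h P" and v: "\<And>x. x \<in> P \<Longrightarrow> h x v = 0" "Re (h v v) > 0"
  shows "posdef h (ext v P)" "v \<notin> P"
proof -
  show "v \<notin> P" using v by force
  show "posdef h (ext v P)" unfolding posdef_def
  proof (intro ballI impI)
    fix x assume "x \<in> ext v P" "x \<noteq> 0"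
    then obtain p c where p: "p \<in> P" "x = p + c *s v" using ext_iff[OF P(1)] by blast
    have q: "Re (h x x) = Re (h p p) + (cmod c)\<^sup>2 * Re (h v v)"
      unfolding p(2) quad_expand using v(1)[OF p(1)] by simp
    have "Re (h p p) \<ge> 0" using P(2) p unfolding posdef_def by (cases "p = 0") (auto simp: h_simps less_imp_le)
    show "Re (h x x) > 0"
    proof (cases "c = 0")
      case True then show ?thesis using q p P \<open>x \<noteq> 0\<close> unfolding posdef_def by simp
    next
      case False
      then have "(cmod c)\<^sup>2 * Re (h v v) > 0" using v by simp
      then show ?thesis using q \<open>Re (h p p) \<ge> 0\<close> by linarith
    qed
  qed
qed

end

section \<open>The index under one-vector extensions\<close>

lemma pindex_set_finite:
  assumes "findim K" shows "finite {dim P | P. subspace P \<and> P \<subseteq> K \<and> posdef h P}"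
  by (rule finite_subset[of _ "{..dim K}"]) (use dim_mono assms in auto)

lemma pindex_attained:
  assumes "findim K" obtains P where "subspace P" "P \<subseteq> K" "posdef h P" "dim P = pindex h K"
proof -
  have "dim {0} \<in> {dim P | P. subspace P \<and> P \<subseteq> K \<and> posdef h P}"
    using findim_subspace[OF assms] subspace_0 by (auto intro!: exI[of _ "{0}"] simp: posdef_def)
  then have "pindex h K \<in> {dim P | P. subspace P \<and> P \<subseteq> K \<and> posdef h P}"
    unfolding pindex_def by (intro Max_in pindex_set_finite assms) auto
  then show ?thesis using that by auto
qed

lemma pindex_ge: "findim K \<Longrightarrow> subspace P \<Longrightarrow> P \<subseteq> K \<Longrightarrow> posdef h P \<Longrightarrow> dim P \<le> pindex h K"
  unfolding pindex_def by (intro Max_ge pindex_set_finite) auto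

lemma pindex_mono: "findim L \<Longrightarrow> subspace K \<Longrightarrow> K \<subseteq> L \<Longrightarrow> pindex h K \<le> pindex h L"
  by (metis findim_subset pindex_attained pindex_ge subset_trans)

lemma pindex_zero: "pindex h {0} = 0"
proof -
  obtain P where P: "subspace P" "P \<subseteq> {0}" "dim P = pindex h {0}" using pindex_attained[OF findim_zero] by metis
  then have "P = {0}" using subspace_0 by auto
  then show ?thesis using P dim_zero by simp
qed

lemma posdef_subset: "posdef h P \<Longrightarrow> Q \<subseteq> P \<Longrightarrow> posdef h Q"
  by (auto simp: posdef_def)

text \<open>A positive definite subspace of \<open>ext e K\<close> loses at most one dimension when
  it is cut down to \<open>K\<close>.\<close>

lemma pindex_ext_le:
  assumes K: "findim K" shows "pindex h (ext e K) \<le> Suc (pindex h K)"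
proof -
  obtain P where P: "subspace P" "P \<subseteq> ext e K" "posdef h P" "dim P = pindex h (ext e K)"
    using pindex_attained[OF findim_ext[OF K]] by metis
  have "findim P" using P findim_subset findim_ext[OF K] by blast
  then have "dim P \<le> Suc (dim (P \<inter> K))" using dim_Int_ext findim_subspace[OF K] P by blast
  moreover have "dim (P \<inter> K) \<le> pindex h K"
    using P K by (intro pindex_ge) (auto intro: subspace_inter findim_subspace posdef_subset)
  ultimately show ?thesis using P by simp
qed

lemma pindex_le_codim:
  assumes "findim L" "subspace K" "K \<subseteq> L" shows "pindex h L + dim K \<le> pindex h K + dim L"
  using assms
proof (induction rule: findim_induct)
  case (step U e)
  then show ?case using dim_ext[of U e] pindex_ext_le[of U h e] by simp
qed simp

context
  fixes h :: "'v \<Rightarrow> 'v \<Rightarrow> complex"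
  assumes h: "hform h"
begin

text \<open>A definite subspace has no radical, so the obstruction in \<open>project\<close>
  disappears.\<close>

lemma posdef_project:
  assumes P: "findim P" "posdef h P" obtains p where "p \<in> P" "\<And>x. x \<in> P \<Longrightarrow> h x (e - p) = 0"
proof -
  have "h x e = 0" if "x \<in> P" "x \<in> orth h P" for x
    using that P h_zero1[OF h] by (force simp: posdef_def orth_def)
  then show ?thesis using project[OF h, of P P e] P findim_subspace that by blast
qed

lemma pindex_ext_ge:
  assumes "findim K" "P \<subseteq> K" "subspace P" "posdef h P" "dim P = pindex h K" "v \<in> ext e K"
    "\<And>x. x \<in> P \<Longrightarrow> h x v = 0" "Re (h v v) > 0"
  shows "pindex h (ext e K) = Suc (pindex h K)"
proof -
  have "subspace (ext v P)" "posdef h (ext v P)" "v \<notin> P" using posdef_ext[OF h] assms by auto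
  moreover have "ext v P \<subseteq> ext e K" using assms ext_sup[of K e] by (intro ext_least) auto
  moreover have "dim (ext v P) = Suc (pindex h K)"
    using dim_ext[of P v] assms \<open>v \<notin> P\<close> findim_subset by metis
  ultimately have "Suc (pindex h K) \<le> pindex h (ext e K)" using pindex_ge findim_ext assms(1) by metis
  then show ?thesis using pindex_ext_le[OF assms(1), of h e] by simp
qed

text \<open>The radical vector \<open>x\<close> is isotropic and orthogonal to a maximal positive
  \<open>P\<close>. Once \<open>e\<close> is made orthogonal to \<open>P\<close> as well, adding
  \<open>c *s x\<close> changes its value by a term linear in \<open>c\<close>, which can be given
  either sign. Hence the same \<open>x\<close>, used with \<open>neg h\<close>, raises the negative
  index too.\<close>

lemma pindex_ext_rad:
  assumes K: "findim K" and x: "x \<in> K" "x \<in> orth h K" "h x e \<noteq> 0"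
  shows "pindex h (ext e K) = Suc (pindex h K)"
proof -
  obtain P where P: "subspace P" "P \<subseteq> K" "posdef h P" "dim P = pindex h K" using pindex_attained[OF K] by metis
  have "findim P" using P K findim_subset by blast
  then obtain p where p: "p \<in> P" "\<And>y. y \<in> P \<Longrightarrow> h y (e - p) = 0" using P posdef_project by metis
  define z where "z = h (e - p) x"
  have "h x p = 0" using x p P by (auto simp: orth_def)
  then have z: "z \<noteq> 0" unfolding z_def using x h_sym0[OF h] by (simp add: h_simps[OF h])
  \<comment> \<open>The factor makes the cross term equal to one plus the absolute value of
    \<open>h (e - p) (e - p)\<close>, which leaves a value of at least 1.\<close>
  define t where "t = (1 + \<bar>Re (h (e - p) (e - p))\<bar>) / (2 * (cmod z)\<^sup>2)"
  define c where "c = of_real t * z"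
  define v where "v = (e - p) + c *s x"
  have "h x x = 0" using x by (auto simp: orth_def)
  then have "Re (h v v) = Re (h (e - p) (e - p)) + 2 * Re (cnj c * z)"
    unfolding v_def quad_expand[OF h] z_def by simp
  also have "cnj c * z = of_real (t * (cmod z)\<^sup>2)"
    unfolding c_def of_real_mult complex_norm_square by simp
  also have "2 * Re (of_real (t * (cmod z)\<^sup>2)) = 1 + \<bar>Re (h (e - p) (e - p))\<bar>"
    unfolding t_def using z by simp
  finally have "Re (h v v) > 0" by linarith
  moreover have "h y v = 0" if "y \<in> P" for y
  proof -
    have "h y x = 0" using x P that h_sym0[OF h] by (auto simp: orth_def)
    then show ?thesis unfolding v_def using p that by (simp add: h_add2[OF h] h_scale2[OF h])
  qed
  moreover have "v \<in> ext e K" unfolding v_def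
    using x p P ext_sup[of K e] by (intro span_add span_diff span_scale ext_mem) auto
  ultimately show ?thesis using pindex_ext_ge K P by metis
qed

text \<open>If \<open>h e e\<close> is not positive and \<open>e\<close> is outside
  \<open>K\<close>, projecting a positive definite \<open>P\<close> along \<open>e\<close> into
  \<open>K\<close> can only increase the form, so the projection \<open>Q\<close> is positive
  definite. No dimension is lost, because \<open>e\<close> is not in \<open>P\<close>.\<close>

lemma pindex_ext_perp:
  assumes K: "findim K" and e: "\<And>x. x \<in> K \<Longrightarrow> h x e = 0"
  shows "pindex h (ext e K) = (if Re (h e e) > 0 then Suc (pindex h K) else pindex h K)"
proof (cases "Re (h e e) > 0")
  case True
  obtain P where P: "subspace P" "P \<subseteq> K" "posdef h P" "dim P = pindex h K" using pindex_attained[OF K] by metis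
  show ?thesis using pindex_ext_ge[OF K P(2,1,3,4) ext_mem] P e True by auto
next
  case False
  obtain P where P: "subspace P" "P \<subseteq> ext e K" "posdef h P" "dim P = pindex h (ext e K)"
    using pindex_attained[OF findim_ext[OF K]] by metis
  have fP: "findim P" using P findim_subset findim_ext[OF K] by blast
  have sK: "subspace K" using K findim_subspace by blast
  have "dim P \<le> pindex h K"
  proof (cases "e \<in> K")
    case True
    then have "ext e K = K" using sK by (simp add: insert_absorb)
    then show ?thesis using P K pindex_ge by simp
  next
    case eK: False
    define Q where "Q = {k \<in> K. \<exists>c. k + c *s e \<in> P}"
    have sQ: "subspace Q"
    proof (rule subspaceI)
      show "0 \<in> Q" unfolding Q_def using subspace_0[OF sK] subspace_0[OF P(1)]
        by (auto intro: exI[of _ 0])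
    next
      fix x y assume "x \<in> Q" "y \<in> Q"
      then obtain c d where cd: "x \<in> K" "y \<in> K" "x + c *s e \<in> P" "y + d *s e \<in> P"
        unfolding Q_def by auto
      have "(x + y) + (c + d) *s e = (x + c *s e) + (y + d *s e)"
        by (simp add: scale_left_distrib)
      then show "x + y \<in> Q" unfolding Q_def using cd subspace_add[OF sK] subspace_add[OF P(1)]
        by (metis (mono_tags, lifting) mem_Collect_eq)
    next
      fix a x assume "x \<in> Q"
      then obtain c where cd: "x \<in> K" "x + c *s e \<in> P" unfolding Q_def by auto
      have "a *s x + (a * c) *s e = a *s (x + c *s e)" by (simp add: scale_right_distrib)
      then show "a *s x \<in> Q" unfolding Q_def using cd subspace_scale[OF sK] subspace_scale[OF P(1)]
        by (metis (mono_tags, lifting) mem_Collect_eq)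
    qed
    have QK: "Q \<subseteq> K" unfolding Q_def by auto
    have q: "Re (h (k + c *s e) (k + c *s e)) \<le> Re (h k k)" if "k \<in> K" for k c
      unfolding quad_expand[OF h] using e[OF that] False by (simp add: mult_nonneg_nonpos)
    have "posdef h Q" unfolding posdef_def
    proof (intro ballI impI)
      fix k assume k: "k \<in> Q" "k \<noteq> 0"
      then obtain c where c: "k \<in> K" "k + c *s e \<in> P" unfolding Q_def by auto
      have "k + c *s e \<noteq> 0"
      proof
        assume 0: "k + c *s e = 0"
        with k have "c \<noteq> 0" by auto
        have "e = (- (1 / c)) *s k" using 0 \<open>c \<noteq> 0\<close>
          by (metis (no_types, lifting) add.inverse_inverse divide_self_if add_eq_0_iff scale_minus_left scale_minus_right scale_one scale_scale times_divide_eq_left mult_1)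
        then show False using eK c sK subspace_scale by metis
      qed
      then show "Re (h k k) > 0" using P(3) c(2) q[OF c(1), of c] unfolding posdef_def
        by (meson less_le_trans)
    qed
    have "P \<subseteq> ext e Q"
    proof
      fix x assume "x \<in> P"
      then obtain k c where "k \<in> K" "x = k + c *s e" using P ext_iff[OF sK] by blast
      moreover from this have "k \<in> Q" using \<open>x \<in> P\<close> unfolding Q_def by auto
      ultimately show "x \<in> ext e Q" unfolding ext_iff[OF sQ] by blast
    qed
    moreover have "e \<notin> P" using P(3) False subspace_0[OF sK] eK unfolding posdef_def by force
    \<comment> \<open>This strict inclusion offsets the one dimension by which
      \<open>ext e Q\<close> exceeds \<open>Q\<close>.\<close>
    ultimately have "P \<subset> ext e Q" using ext_mem by blast
    have fQ: "findim Q" using QK sQ K findim_subset by blast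
    then have "dim P < dim (ext e Q)" using \<open>P \<subset> ext e Q\<close> P dim_psub findim_ext by blast
    also have "\<dots> = Suc (dim Q)" using dim_ext fQ QK eK by blast
    finally show ?thesis using pindex_ge[OF K sQ QK \<open>posdef h Q\<close>] by simp
  qed
  moreover have "pindex h K \<le> pindex h (ext e K)" using pindex_mono ext_sup findim_ext K sK by blast
  ultimately show ?thesis using False P by simp
qed

end

lemma ext_swap:
  assumes "subspace U" "v \<in> ext e U" "v \<notin> U" shows "ext v U = ext e U"
proof
  show "ext v U \<subseteq> ext e U" using assms ext_sup by (intro ext_least) auto
  obtain c u where c: "u \<in> U" "v = u + c *s e" using assms ext_iff by blast
  then have "c \<noteq> 0" using assms by auto
  have "e = (1/c) *s v - (1/c) *s u" using \<open>c \<noteq> 0\<close> c(2) by (simp add: scale_right_distrib)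
  then have "e \<in> ext v U" using c(1) ext_sup[of U v]
    by (metis ext_mem span_diff span_scale subset_iff)
  then show "ext e U \<subseteq> ext v U" by (intro ext_least ext_sup) auto
qed

text \<open>If \<open>a\<close> escapes only \<open>A\<close> and \<open>b\<close> escapes only
  \<open>B\<close>, their sum escapes both. It provides a vector subject to two genericity
  conditions at once.\<close>

lemma two_subspaces:
  assumes "subspace V" "subspace A" "subspace B" "\<not> V \<subseteq> A" "\<not> V \<subseteq> B"
  obtains x where "x \<in> V" "x \<notin> A" "x \<notin> B"
proof -
  obtain a b where ab: "a \<in> V" "a \<notin> A" "b \<in> V" "b \<notin> B" using assms by auto
  show ?thesis
  proof (cases "a \<in> B \<and> b \<in> A")
    case False then show ?thesis using ab that by blast
  next
    case True
    have "a + b \<in> V" using ab assms subspace_add by blast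
    moreover have "a + b \<notin> A" using True ab assms subspace_diff[of A "a + b" b] by auto
    moreover have "a + b \<notin> B" using True ab assms subspace_diff[of B "a + b" a] by auto
    ultimately show ?thesis using that by blast
  qed
qed

lemma span_Un_ext: "span (A \<union> ext e U) = ext e (span (A \<union> U))"
proof
  have "A \<union> U \<subseteq> ext e (span (A \<union> U))"
    using span_superset[of "A \<union> U"] ext_sup[of "span (A \<union> U)" e] by (rule subset_trans)
  then have "A \<union> ext e U \<subseteq> ext e (span (A \<union> U))"
    using ext_least[OF subspace_span, of U] ext_mem by simp
  then show "span (A \<union> ext e U) \<subseteq> ext e (span (A \<union> U))" by (rule span_minimal) simp
  have "A \<union> U \<subseteq> A \<union> ext e U" "e \<in> A \<union> ext e U" using ext_sup[of U e] ext_mem[of e U] by auto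
  then show "ext e (span (A \<union> U)) \<subseteq> span (A \<union> ext e U)"
    by (intro ext_least span_mono span_base) auto
qed

text \<open>Along a flag from \<open>A \<inter> B\<close> to \<open>B\<close> the sum with
  \<open>A\<close> gains at most one dimension per step.\<close>

lemma dim_Un_le:
  assumes "findim A" "findim B"
  shows "findim (span (A \<union> B))" "dim (span (A \<union> B)) + dim (A \<inter> B) \<le> dim A + dim B"
proof -
  have sA: "subspace A" using assms findim_subspace by blast
  define I where "I = A \<inter> B"
  have I: "subspace I" "I \<subseteq> B" "A \<union> I = A"
    unfolding I_def using assms findim_subspace subspace_inter by blast+
  have "findim (span (A \<union> B)) \<and> dim (span (A \<union> B)) + dim I \<le> dim A + dim B"
    using assms(2) I(1,2)
  proof (induction rule: findim_induct)
    case base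
    have "span (A \<union> I) = A" using I(3) sA span_eq_iff by metis
    then show ?case using assms(1) by (simp only:) simp
  next
    case (step U e)
    note span_Un_ext[of A e U]
    then show ?case
      using step dim_ext_le[of "span (A \<union> U)" e] findim_ext[of "span (A \<union> U)" e] dim_ext[of U e] by simp
  qed
  then show "findim (span (A \<union> B))" "dim (span (A \<union> B)) + dim (A \<inter> B) \<le> dim A + dim B"
    unfolding I_def by auto
qed

section \<open>Sylvester's law, growth along flags and isotropic vectors\<close>

context
  fixes h :: "'v \<Rightarrow> 'v \<Rightarrow> complex"
  assumes h: "hform h"
begin

lemma dim_orth_ge:
  assumes "findim S" "findim T" shows "dim S \<le> dim (S \<inter> orth h T) + dim T"
proof -
  have "{0} \<subseteq> T" using assms findim_subspace subspace_0 by auto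
  with assms(2) subspace_single_0 show ?thesis
  proof (induction rule: findim_induct)
    case base
    have "S \<inter> orth h {0} = S" by (auto simp: orth_def h_zero2[OF h])
    then show ?case by simp
  next
    case (step U e)
    have "findim (S \<inter> orth h U)"
      using assms subspace_inter[OF findim_subspace subspace_orth[OF h]] findim_subset by blast
    from dim_ker_le[OF h this, of e] show ?case
      using step dim_ext[of U e] by (simp add: orth_ext[OF h] Int_assoc)
  qed
qed

text \<open>Sylvester's law for a possibly degenerate form. A vector that pairs with the radical of
  \<open>U\<close> raises both indices and shrinks the radical by one; a vector orthogonal to
  \<open>U\<close> raises one index or, if isotropic, enlarges the radical.\<close>

lemma inertia_radical:
  assumes K: "findim K"
  shows "pindex h K + pindex (neg h) K + dim (K \<inter> orth h K) = dim K"
proof -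
  note n = hform_neg[OF h]
  have "{0} \<subseteq> K" using K findim_subspace subspace_0 by auto
  with K subspace_single_0 show ?thesis
  proof (induction rule: findim_induct)
    case base
    have "{0} \<inter> orth h {0} = {0}" by (auto simp: orth_def h_zero2[OF h])
    then show ?case by (simp add: pindex_zero dim_zero)
  next
    case (step U e)
    note sU = \<open>subspace U\<close>
    show ?case
    proof (cases rule: radical_cases[OF h \<open>findim U\<close>, of e])
      case (1 x)
      have "pindex h (ext e U) = Suc (pindex h U)" using pindex_ext_rad[OF h] step 1 by blast
      moreover have "pindex (neg h) (ext e U) = Suc (pindex (neg h) U)"
        using pindex_ext_rad[OF n \<open>findim U\<close>, of x e] 1 by (simp add: neg_def)
      \<comment> \<open>Pairing with \<open>x\<close> reads off the coefficient of \<open>e\<close>,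
        so no new vector enters the radical, and the old ones must be orthogonal to
        \<open>e\<close>.\<close>
      moreover have "ext e U \<inter> orth h (ext e U) = (U \<inter> orth h U) \<inter> {y. h y e = 0}"
      proof (intro Set.set_eqI iffI)
        fix y assume y: "y \<in> ext e U \<inter> orth h (ext e U)"
        then obtain c u where u: "u \<in> U" "y = u + c *s e" using ext_iff[OF sU] by blast
        have "h y x = 0" using y 1 ext_sup[of U e] by (auto simp: orth_def)
        moreover have "h u x = 0" using u 1 h_sym0[OF h] by (auto simp: orth_def)
        ultimately have "c = 0" using 1 u h_sym0[OF h, of x e] by (simp add: h_simps[OF h])
        then show "y \<in> (U \<inter> orth h U) \<inter> {y. h y e = 0}" using y u by (simp add: orth_ext[OF h])
      next
        fix y assume "y \<in> (U \<inter> orth h U) \<inter> {y. h y e = 0}"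
        then show "y \<in> ext e U \<inter> orth h (ext e U)"
          using ext_sup[of U e] by (auto simp: orth_ext[OF h])
      qed
      moreover have "dim (U \<inter> orth h U) = Suc (dim ((U \<inter> orth h U) \<inter> {y. h y e = 0}))"
        using 1 findim_subset[OF \<open>findim U\<close> subspace_inter[OF sU subspace_orth[OF h, of U]]]
        by (intro dim_ker[OF h]) auto
      ultimately show ?thesis using step dim_ext by simp
    next
      case (2 k)
      define v where "v = e - k"
      have ev: "ext e U = ext v U" unfolding v_def using ext_shift[OF sU] 2 by simp
      have vU: "v \<notin> U" using step 2 subspace_add[OF sU, of "e - k" k] unfolding v_def by auto
      have perp: "h x v = 0" "h v x = 0" if "x \<in> U" for x
        using 2 that h_sym0[OF h] unfolding v_def by auto
      have dot: "pindex h (ext v U) = (if Re (h v v) > 0 then Suc (pindex h U) else pindex h U)"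
         "pindex (neg h) (ext v U) = (if Re (h v v) < 0 then Suc (pindex (neg h) U) else pindex (neg h) U)"
        using pindex_ext_perp[OF h \<open>findim U\<close>, of v] pindex_ext_perp[OF n \<open>findim U\<close>, of v] perp
        by (auto simp: neg_def)
      have mem: "u + c *s v \<in> orth h (ext v U) \<longleftrightarrow> u \<in> orth h U \<and> c * h v v = 0" if "u \<in> U" for u c
        using perp that unfolding orth_ext[OF h] by (auto simp: orth_def h_simps[OF h])
      show ?thesis
      proof (cases "h v v = 0")
        case True
        have sR: "subspace (U \<inter> orth h U)" using subspace_inter sU subspace_orth[OF h] by blast
        have "ext v U \<inter> orth h (ext v U) = ext v (U \<inter> orth h U)"
          unfolding set_eq_iff Int_iff ext_iff[OF sU] ext_iff[OF sR] using mem True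
          by (metis mult_zero_right)
        moreover have "dim (ext v (U \<inter> orth h U)) = Suc (dim (U \<inter> orth h U))"
          using vU findim_subset[OF \<open>findim U\<close> sR] by (intro dim_ext) auto
        ultimately show ?thesis using dot True step ev vU dim_ext[of U v] by simp
      next
        case False
        then have nz: "Re (h v v) \<noteq> 0" using h_self_0[OF h] by simp
        have "ext v U \<inter> orth h (ext v U) = U \<inter> orth h U"
        proof (intro Set.set_eqI iffI)
          fix y assume y: "y \<in> ext v U \<inter> orth h (ext v U)"
          then obtain c u where u: "u \<in> U" "y = u + c *s v" using ext_iff[OF sU] by blast
          then show "y \<in> U \<inter> orth h U" using mem[OF u(1), of c] y False by auto
        next
          fix y assume "y \<in> U \<inter> orth h U"
          then show "y \<in> ext v U \<inter> orth h (ext v U)"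
            using mem[of y 0] ext_sup[of U v] by auto
        qed
        then show ?thesis using dot nz step ev vU dim_ext[of U v] by auto
      qed
    qed
  qed
qed

text \<open>Every step gains one: either through the radical, or because the vector, made orthogonal
  to \<open>U\<close>, lies in \<open>orth h K\<close> and outside \<open>K\<close>, where the form
  is positive. It is also applied where no such vector exists.\<close>

lemma pindex_grow:
  assumes "findim L" "subspace K" "K \<subseteq> L"
    and pos: "\<And>x. x \<in> L \<Longrightarrow> x \<in> orth h K \<Longrightarrow> x \<notin> K \<Longrightarrow> Re (h x x) > 0"
  shows "pindex h K + dim L \<le> pindex h L + dim K"
  using assms(1-3)
proof (induction rule: findim_induct)
  case (step U e)
  show ?case
  proof (cases rule: radical_cases[OF h \<open>findim U\<close>, of e])
    case (1 x)
    then show ?thesis using pindex_ext_rad[OF h \<open>findim U\<close>, of x e] step dim_ext[of U e] by simp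
  next
    case (2 k)
    have k: "k \<in> L" using 2 step by auto
    have "e - k \<notin> U" using step 2 subspace_add[of U "e - k" k] by auto
    moreover have "e - k \<in> L" using step k findim_subspace[OF assms(1)] subspace_diff by blast
    moreover have "e - k \<in> orth h K" using 2 h_sym0[OF h] step by (auto simp: orth_def)
    ultimately have "Re (h (e - k) (e - k)) > 0" using pos step by blast
    then have "pindex h (ext e U) = Suc (pindex h U)"
      using pindex_ext_perp[OF h \<open>findim U\<close>, of "e - k"] 2 ext_shift[of U k e] step by simp
    then show ?thesis using step dim_ext[of U e] by simp
  qed
qed simp

text \<open>A sharpening of the codimension bound: a step that brings in a vector of the radical of
  \<open>E\<close> cannot raise the index, and each step brings in at most one dimension of that
  radical.\<close>

lemma pindex_le_corank:
  assumes "findim E" "subspace K" "K \<subseteq> E"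
  shows "pindex h E + dim K + dim (E \<inter> orth h E) \<le> pindex h K + dim E + dim (K \<inter> orth h E)"
  using assms(1-3)
proof (induction rule: findim_induct[where P = "\<lambda>U. pindex h U + dim K + dim (U \<inter> orth h E)
      \<le> pindex h K + dim U + dim (K \<inter> orth h E)"])
  case (step U e)
  note sU = \<open>subspace U\<close>
  have sI: "subspace (ext e U \<inter> orth h E)" using subspace_inter subspace_orth[OF h] by blast
  have I: "ext e U \<inter> orth h E \<inter> U = U \<inter> orth h E" using ext_sup[of U e] by auto
  have fI: "findim (ext e U \<inter> orth h E)" using findim_subset[OF findim_ext[OF \<open>findim U\<close>] sI] by auto
  have d: "dim (ext e U \<inter> orth h E) \<le> Suc (dim (U \<inter> orth h E))"
    using dim_Int_ext[OF fI sU, of e] I by auto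
  show ?case
  proof (cases "ext e U \<inter> orth h E \<subseteq> U")
    case True
    then have "ext e U \<inter> orth h E = U \<inter> orth h E" using I by blast
    then show ?thesis using step dim_ext[of U e] pindex_ext_le[of U h e] by simp
  next
    case False
    then obtain v where v: "v \<in> ext e U" "v \<in> orth h E" "v \<notin> U" by auto
    have "ext e U \<subseteq> E" using step findim_subspace[OF assms(1)] by (intro ext_least) auto
    then have "h v v = 0" using v by (auto simp: orth_def)
    moreover have "h x v = 0" if "x \<in> U" for x
      using v step that h_sym0[OF h] by (auto simp: orth_def)
    ultimately have "pindex h (ext v U) = pindex h U" using pindex_ext_perp[OF h \<open>findim U\<close>, of v] by simp
    then show ?thesis using ext_swap[OF sU v(1,3)] d step dim_ext[of U e] by simp
  qed
qed simp

text \<open>The degenerate case of Cauchy-Schwarz: a nonzero pairing of the null vector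
  \<open>x\<close> with \<open>y\<close> would make the form negative at some
  \<open>y + c *s x\<close>.\<close>

lemma cauchy_null:
  assumes "subspace V" "\<And>v. v \<in> V \<Longrightarrow> Re (h v v) \<ge> 0" "x \<in> V" "Re (h x x) = 0" "y \<in> V"
  shows "h x y = 0"
proof (rule ccontr)
  assume "h x y \<noteq> 0"
  define z where "z = h y x"
  have z: "z \<noteq> 0" using \<open>h x y \<noteq> 0\<close> h_sym0[OF h] unfolding z_def by simp
  \<comment> \<open>Chosen so that the value at \<open>y + c *s x\<close> is exactly -1.\<close>
  define t where "t = (Re (h y y) + 1) / (2 * (cmod z)\<^sup>2)"
  define c where "c = of_real (- t) * z"
  have "cnj c * z = of_real (- (t * (cmod z)\<^sup>2))"
    unfolding c_def of_real_minus of_real_mult complex_norm_square by simp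
  then have "Re (h (y + c *s x) (y + c *s x)) = Re (h y y) - 2 * (t * (cmod z)\<^sup>2)"
    unfolding quad_expand[OF h] using assms(4) by (simp add: z_def)
  also have "2 * (t * (cmod z)\<^sup>2) = Re (h y y) + 1" unfolding t_def using z by simp
  finally have "Re (h (y + c *s x) (y + c *s x)) < 0" by simp
  moreover have "y + c *s x \<in> V" using assms subspace_add subspace_scale by blast
  ultimately show False using assms(2) by fastforce
qed

text \<open>Along the ray the form is the quadratic \<open>a + 2 * t * b - t^2 * d\<close> with
  \<open>a\<close> and \<open>d\<close> positive, so its roots have opposite signs; \<open>r\<close>
  is the square root of the reduced discriminant and \<open>(b + r) / d\<close> the positive
  root.\<close>

lemma isotropic_on_line:
  assumes "Re (h x x) > 0" "Re (h y y) < 0" "cmod u = 1"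
  shows "\<exists>t>0. Re (h (x + (of_real t * u) *s y) (x + (of_real t * u) *s y)) = 0"
proof -
  define a b d where "a = Re (h x x)" and "b = Re (cnj u * h x y)" and "d = - Re (h y y)"
  have ad: "a > 0" "d > 0" using assms by (simp_all add: a_def d_def)
  define r where "r = sqrt (b\<^sup>2 + a * d)"
  have r2: "r\<^sup>2 = b\<^sup>2 + a * d" unfolding r_def using ad by simp
  have "\<bar>b\<bar> < r" unfolding r_def using ad by (intro real_less_rsqrt) simp
  define t where "t = (b + r) / d"
  have "t > 0" unfolding t_def using ad \<open>\<bar>b\<bar> < r\<close> by simp
  moreover have "a + 2 * t * b - t\<^sup>2 * d = 0"
  proof -
    have "d * (a + 2 * t * b - t\<^sup>2 * d) = a * d + 2 * (d * t) * b - (d * t)\<^sup>2"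
      by (simp add: power2_eq_square algebra_simps)
    also have "d * t = b + r" unfolding t_def using ad by simp
    also have "a * d + 2 * (b + r) * b - (b + r)\<^sup>2 = b\<^sup>2 + a * d - r\<^sup>2"
      by (simp add: power2_eq_square algebra_simps)
    finally show ?thesis using r2 ad by simp
  qed
  moreover have "Re (h (x + (of_real t * u) *s y) (x + (of_real t * u) *s y)) = a + 2 * t * b - t\<^sup>2 * d"
    unfolding quad_expand[OF h] a_def b_def d_def using assms(3)
    by (simp add: norm_mult power_mult_distrib algebra_simps)
  ultimately show ?thesis by auto
qed

text \<open>
  The form vanishes at one point of each ray \<open>x + t u y\<close> (\<open>t > 0\<close>) with \<open>u = 1, -1, \<i>\<close>, and a subspace that
  misses \<open>x\<close> contains at most one of these three points.
\<close>

lemma isotropic_avoid_aux: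
  assumes V: "subspace V" "subspace A" "subspace B"
    and x: "x \<in> V" "x \<notin> A" "x \<notin> B" "Re (h x x) > 0" and y: "y \<in> V" "Re (h y y) < 0"
  shows "\<exists>v\<in>V. v \<notin> A \<and> v \<notin> B \<and> Re (h v v) = 0"
proof -
  have one: "x + c *s y \<notin> S \<or> x + d *s y \<notin> S" if "c \<noteq> d" "subspace S" "x \<notin> S" for c d S
  proof (rule ccontr)
    assume "\<not> ?thesis"
    then have S: "x + c *s y \<in> S" "x + d *s y \<in> S" by auto
    then have "(c - d) *s y \<in> S"
      using subspace_diff[OF that(2) S] by (simp add: scale_left_diff_distrib)
    then have "(1 / (c - d)) *s ((c - d) *s y) \<in> S" using subspace_scale[OF that(2)] by blast
    then have "y \<in> S" using that(1) by simp
    then have "x \<in> S" using S(1) subspace_diff[OF that(2), of "x + c *s y" "c *s y"]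
        subspace_scale[OF that(2)] by simp
    then show False using that(3) by simp
  qed
  have "\<exists>t>0. Re (h (x + (of_real t * u) *s y) (x + (of_real t * u) *s y)) = 0" if "cmod u = 1" for u
    using isotropic_on_line x(4) y(2) that by blast
  from this[of 1] this[of "-1"] this[of \<i>] obtain r s t where rst: "r > 0" "s > 0" "t > 0"
    "Re (h (x + of_real r *s y) (x + of_real r *s y)) = 0"
    "Re (h (x + (- of_real s) *s y) (x + (- of_real s) *s y)) = 0"
    "Re (h (x + (of_real t * \<i>) *s y) (x + (of_real t * \<i>) *s y)) = 0"
    by auto
  have ne: "of_real r \<noteq> (- of_real s :: complex)" "of_real r \<noteq> of_real t * \<i>"
    "- of_real s \<noteq> of_real t * \<i>"
    using rst(1-3) by (auto simp: complex_eq_iff)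
  have inV: "x + c *s y \<in> V" for c using V(1) x(1) y(1) subspace_add subspace_scale by blast
  show ?thesis
    using one[OF ne(1) V(2) x(2)] one[OF ne(2) V(2) x(2)] one[OF ne(3) V(2) x(2)]
      one[OF ne(1) V(3) x(3)] one[OF ne(2) V(3) x(3)] one[OF ne(3) V(3) x(3)] rst(4-6) inV
    by metis
qed

end

text \<open>A vector \<open>x\<close> of \<open>V\<close> outside \<open>A\<close> and
  \<open>B\<close> exists. If it is not isotropic, it is combined with whichever of \<open>y\<close>
  and \<open>z\<close> has the opposite sign; the negative case is the positive one for
  \<open>neg h\<close>.\<close>

lemma isotropic_avoid:
  assumes h: "hform h" and V: "subspace V" "subspace A" "subspace B" "\<not> V \<subseteq> A" "\<not> V \<subseteq> B"
    and y: "y \<in> V" "Re (h y y) < 0" and z: "z \<in> V" "Re (h z z) > 0"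
  shows "\<exists>v\<in>V. v \<notin> A \<and> v \<notin> B \<and> Re (h v v) = 0"
proof -
  obtain x where x: "x \<in> V" "x \<notin> A" "x \<notin> B" using two_subspaces V by metis
  consider "Re (h x x) = 0" | "Re (h x x) > 0" | "Re (neg h x x) > 0"
    unfolding neg_def by fastforce
  then show ?thesis
  proof cases
    case 1 then show ?thesis using x by blast
  next
    case 2 then show ?thesis using isotropic_avoid_aux[OF h V(1-3) x _ y] by blast
  next
    case 3
    have "Re (neg h z z) < 0" using z unfolding neg_def by simp
    from isotropic_avoid_aux[OF hform_neg[OF h] V(1-3) x 3 z(1) this]
    show ?thesis unfolding neg_def by simp
  qed
qed

text \<open>Equality holds because each new vector of \<open>T\<close>, made orthogonal to the
  earlier ones, stays in \<open>T\<close> and is not orthogonal to itself, so every condition is a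
  genuine one. With the standard inner product this becomes the rank formula for matrices.\<close>

lemma dim_orth_posdef:
  assumes h: "hform h" and S: "findim S" and T: "subspace T" "T \<subseteq> S" "posdef h T"
  shows "dim S = dim (S \<inter> orth h T) + dim T"
proof -
  have fT: "findim T" using findim_subset S T by blast
  have "{0} \<subseteq> T" using subspace_0[OF T(1)] by simp
  with fT subspace_single_0
  have "T \<subseteq> T \<longrightarrow> dim S = dim (S \<inter> orth h T) + dim T"
  proof (induction rule: findim_induct[where P = "\<lambda>U. U \<subseteq> T \<longrightarrow> dim S = dim (S \<inter> orth h U) + dim U"])
    case base
    have "S \<inter> orth h {0} = S" by (auto simp: orth_def h_zero2[OF h])
    then show ?case by (simp add: dim_zero)
  next
    case (step U e)
    show ?case
    proof
      have pU: "posdef h U" using step T posdef_subset by blast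
      obtain u where u: "u \<in> U" "\<And>x. x \<in> U \<Longrightarrow> h x (e - u) = 0"
        using posdef_project[OF h \<open>findim U\<close> pU] by metis
      have ne: "e - u \<noteq> 0" using u step by auto
      have eT: "e - u \<in> T" using u step T subspace_diff by blast
      have uo: "e - u \<in> orth h U" using u h_sym0[OF h] by (auto simp: orth_def)
      have "h (e - u) u = 0" using uo u by (auto simp: orth_def)
      then have "h (e - u) e = h (e - u) (e - u)" by (simp add: h_diff2[OF h])
      moreover have "h (e - u) (e - u) \<noteq> 0" using T(3) eT ne unfolding posdef_def by force
      ultimately have nz: "h (e - u) e \<noteq> 0" by simp
      have "findim (S \<inter> orth h U)"
        using findim_subset[OF S subspace_inter[OF findim_subspace[OF S] subspace_orth[OF h]]] by blast
      from dim_ker[OF h this _ nz] uo eT T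
      have "dim (S \<inter> orth h U) = Suc (dim (S \<inter> orth h U \<inter> {x. h x e = 0}))" by blast
      then show "dim S = dim (S \<inter> orth h (ext e U)) + dim (ext e U)"
        using step dim_ext[of U e] by (simp add: orth_ext[OF h] Int_assoc)
    qed
  qed
  then show ?thesis by simp
qed

text \<open>Positive definiteness sees only the values \<open>h x x\<close>, and an injective linear
  \<open>f\<close> matches the subspaces of \<open>S\<close> with those of its image in equal
  dimension.\<close>

lemma pindex_pullback:
  assumes S: "findim S" and add: "\<And>x y. f (x + y) = f x + f y" and sc: "\<And>c x. f (c *s x) = c *s f x"
    and inj: "\<And>x. x \<in> S \<Longrightarrow> f x = 0 \<Longrightarrow> x = 0" and eq: "\<And>x. x \<in> S \<Longrightarrow> h (f x) (f x) = g x x"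
  shows "pindex h (f ` S) = pindex g S"
proof -
  have f0: "f 0 = 0" using sc[of 0 0] by simp
  have dim: "findim (f ` P) \<and> dim (f ` P) = dim P" if P: "subspace P" "P \<subseteq> S" for P
  proof -
    have "{x \<in> P. f x = 0} = {0}" using inj P subspace_0 f0 by auto
    then show ?thesis using rank_nullity[OF findim_subset[OF S P], of f] add sc dim_zero by simp
  qed
  have fS: "findim (f ` S)" using dim[OF findim_subspace[OF S]] by simp
  show ?thesis
  proof (rule antisym)
    obtain P where P: "subspace P" "P \<subseteq> S" "posdef g P" "dim P = pindex g S" using pindex_attained[OF S] by metis
    have "posdef h (f ` P)" using P(2,3) eq f0 unfolding posdef_def by force
    then have "dim (f ` P) \<le> pindex h (f ` S)"
      using dim[OF P(1,2)] fS P by (intro pindex_ge) (auto intro: findim_subspace)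
    then show "pindex g S \<le> pindex h (f ` S)" using dim[OF P(1,2)] P by simp
  next
    obtain P where P: "subspace P" "P \<subseteq> f ` S" "posdef h P" "dim P = pindex h (f ` S)" using pindex_attained[OF fS] by metis
    define T where "T = {x \<in> S. f x \<in> P}"
    have sT: "subspace T" unfolding T_def
      using findim_subspace[OF S] P(1) f0 by (intro subspaceI) (auto simp: add sc subspace_def)
    have TS: "T \<subseteq> S" unfolding T_def by auto
    have fT: "f ` T = P" unfolding T_def using P(2) by auto
    have "posdef g T" unfolding posdef_def
    proof (intro ballI impI)
      fix x assume x: "x \<in> T" "x \<noteq> 0"
      then have "f x \<in> P" "f x \<noteq> 0" "x \<in> S" unfolding T_def using inj by auto
      then show "Re (g x x) > 0" using P(3) eq unfolding posdef_def by metis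
    qed
    then show "pindex h (f ` S) \<le> pindex g S" using pindex_ge[OF S sT TS] dim[OF sT TS] fT P(4) by simp
  qed
qed

lemma pindex_cong: "(\<And>x. x \<in> K \<Longrightarrow> h x x = g x x) \<Longrightarrow> pindex h K = pindex g K"
proof -
  assume "\<And>x. x \<in> K \<Longrightarrow> h x x = g x x"
  then have "posdef h P \<longleftrightarrow> posdef g P" if "P \<subseteq> K" for P using that unfolding posdef_def by (metis subsetD)
  then have "{dim P | P. subspace P \<and> P \<subseteq> K \<and> posdef h P} = {dim P | P. subspace P \<and> P \<subseteq> K \<and> posdef g P}"
    by blast
  then show ?thesis unfolding pindex_def by simp
qed

text \<open>\<open>Z\<close> is isotropic and \<open>K + Z\<close> is its orthogonal in
  \<open>E\<close>. Adding \<open>Z\<close> to \<open>K\<close> adds radical vectors and no index;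
  from there every step up to \<open>E\<close> raises the index, as \<open>orth g L\<close> meets
  \<open>E\<close> only inside \<open>L\<close>. It computes the index of a block form with a zero
  corner.\<close>

lemma pindex_isotropic_extension:
  assumes g: "hform g" and E: "findim E" and Z: "subspace Z" "Z \<subseteq> E" and K: "subspace K" "K \<subseteq> E"
    and L: "span (K \<union> Z) = E \<inter> orth g Z"
  shows "pindex g E + dim (span (K \<union> Z)) = pindex g K + dim E"
proof -
  define L where "L = span (K \<union> Z)"
  have LE: "subspace L" "L \<subseteq> E" "K \<subseteq> L" "Z \<subseteq> L"
  proof -
    show "subspace L" unfolding L_def by simp
    show "L \<subseteq> E" unfolding L_def L by simp
    show "K \<subseteq> L" "Z \<subseteq> L" unfolding L_def using span_superset[of "K \<union> Z"] by auto
  qed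
  have fL: "findim L" using findim_subset[OF E LE(1,2)] .
  have perp: "h0 = 0" if "z \<in> Z" "x \<in> L" "h0 = g x z" for x z h0
    using that L unfolding L_def by (auto simp: orth_def)
  have "pindex g L = pindex g K"
    using fL K(1) LE(3)
  proof (induction rule: findim_induct)
    case (step U e)
    then obtain k z where kz: "k \<in> K" "z \<in> Z" "e = k + z"
      unfolding L_def span_Un using K(1) Z(1) by (auto simp: span_eq_iff[THEN iffD2])
    have k: "k \<in> U" using kz step by auto
    have ek: "e - k = z" using kz by simp
    have "g x z = 0" if "x \<in> U" for x using perp[OF kz(2)] that step by blast
    moreover have "g z z = 0" using perp[OF kz(2)] kz(2) LE by blast
    ultimately have "pindex g (ext (e - k) U) = pindex g U"
      unfolding ek using pindex_ext_perp[OF g \<open>findim U\<close>, of z] by simp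
    then show ?case using ext_shift[OF \<open>subspace U\<close> k] step by simp
  qed simp
  moreover have "pindex g L + dim E \<le> pindex g E + dim L"
  proof (rule pindex_grow[OF g E LE(1,2)])
    fix x assume x: "x \<in> E" "x \<in> orth g L" "x \<notin> L"
    then have "x \<in> orth g Z" using orth_anti[OF g LE(4)] by blast
    then show "Re (g x x) > 0" using x L unfolding L_def by blast
  qed
  moreover have "pindex g E + dim L \<le> pindex g L + dim E" using pindex_le_codim[OF E LE(1,2)] .
  ultimately show ?thesis unfolding L_def by simp
qed

lemma ext_Int_subset:
  assumes "subspace K" "subspace G" "K \<subseteq> G" "e \<notin> G" "x \<in> ext e K" "x \<in> G"
  shows "x \<in> K"
proof -
  obtain c k where k: "k \<in> K" "x = k + c *s e" using assms ext_iff by blast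
  have "c *s e \<in> G" using k assms subspace_diff[of G x k] by auto
  have "c = 0"
  proof (rule ccontr)
    assume "c \<noteq> 0"
    then have "e = (1 / c) *s (c *s e)" by simp
    then show False using subspace_scale[OF assms(2) \<open>c *s e \<in> G\<close>] assms(4) by metis
  qed
  then show ?thesis using k by simp
qed

text \<open>Pairing with \<open>x\<close> isolates the coefficient of \<open>e\<close>.\<close>

lemma ext_orth_coeff:
  assumes h: "hform h" and "subspace K" "x \<in> orth h K" "h x e \<noteq> 0" "y \<in> ext e K" "h x y = 0"
  shows "y \<in> K"
proof -
  obtain c k where k: "k \<in> K" "y = k + c *s e" using assms ext_iff by blast
  then have "c = 0" using assms(3,4,6) by (auto simp: orth_def h_simps[OF h])
  then show ?thesis using k by simp
qed

definition complement :: "'v set \<Rightarrow> 'v set \<Rightarrow> 'v set \<Rightarrow> bool" where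
  "complement E F W \<longleftrightarrow> subspace W \<and> W \<inter> F = {0} \<and> span (W \<union> F) = E"

lemma complement_subset: "complement E F W \<Longrightarrow> W \<subseteq> E"
  unfolding complement_def using span_superset by blast

end

section \<open>Extremal inertia over complements\<close>

locale hermitian_complements = complex_space scale
  for scale :: "complex \<Rightarrow> 'v::ab_group_add \<Rightarrow> 'v" (infixr \<open>*s\<close> 75) +
  fixes h :: "'v \<Rightarrow> 'v \<Rightarrow> complex" and E F :: "'v set"
  assumes h: "hform h" and fE: "findim E" and sF: "subspace F" and FE: "F \<subseteq> E"
begin

lemma sE: "subspace E" using fE findim_subspace by blast

abbreviation G where "G K \<equiv> span (K \<union> F)"

lemma G_ext: "G (ext e K) = ext e (G K)"
  using span_Un_ext[of F e K] by (simp add: Un_commute)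

lemma G_sub: "K \<subseteq> E \<Longrightarrow> G K \<subseteq> E" using FE sE by (intro span_minimal) auto

lemma G_sup: "K \<subseteq> G K" using span_superset by blast

lemma fsubE: "subspace K \<Longrightarrow> K \<subseteq> E \<Longrightarrow> findim K" using fE findim_subset by blast

lemma fG: "K \<subseteq> E \<Longrightarrow> findim (G K)" using G_sub fsubE by auto

lemma ext_E: "K \<subseteq> E \<Longrightarrow> e \<in> E \<Longrightarrow> ext e K \<subseteq> E" using sE by (intro ext_least)

lemma ext_F:
  assumes "subspace K" "K \<inter> F = {0}" "e \<notin> G K" shows "ext e K \<inter> F = {0}"
proof -
  have "x = 0" if "x \<in> ext e K" "x \<in> F" for x
  proof -
    have "x \<in> G K" using that span_superset by blast
    then have "x \<in> K" using ext_Int_subset[OF assms(1) subspace_span G_sup assms(3)] that by blast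
    then show ?thesis using that assms by blast
  qed
  then show ?thesis using subspace_0[OF sF] span_zero by blast
qed

text \<open>Induction on the codimension of \<open>G K\<close>. Choosing \<open>e\<close> outside
  \<open>G K\<close>, and not merely outside \<open>K\<close>, keeps the intersection with
  \<open>F\<close> trivial. Every extremal complement is obtained by finding an invariant
  \<open>Q\<close> that some such \<open>e\<close> preserves.\<close>

lemma complement_exists:
  assumes "subspace K" "K \<subseteq> E" "K \<inter> F = {0}" "Q K"
    and step: "\<And>K. subspace K \<Longrightarrow> K \<subseteq> E \<Longrightarrow> K \<inter> F = {0} \<Longrightarrow> Q K \<Longrightarrow> G K \<noteq> E \<Longrightarrow>
      \<exists>e\<in>E. e \<notin> G K \<and> Q (ext e K)"
  shows "\<exists>W. complement E F W \<and> K \<subseteq> W \<and> Q W"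
  using assms(1-4)
proof (induction "dim E - dim (G K)" arbitrary: K rule: less_induct)
  case less
  show ?case
  proof (cases "G K = E")
    case True then show ?thesis using less.prems unfolding complement_def by blast
  next
    case False
    then obtain e where e: "e \<in> E" "e \<notin> G K" "Q (ext e K)" using step[OF less.prems] by blast
    have sub: "ext e K \<subseteq> E" using ext_E less.prems e by blast
    have "dim (G (ext e K)) = Suc (dim (G K))"
      unfolding G_ext using dim_ext[OF fG] less.prems e by blast
    moreover have "dim (G (ext e K)) \<le> dim E" using fE G_sub[OF sub] dim_mono by blast
    ultimately have "dim E - dim (G (ext e K)) < dim E - dim (G K)" by simp
    from less.hyps[OF this subspace_span sub ext_F[OF less.prems(1,3) e(2)] e(3)]
    show ?thesis using ext_sup[of K e] by blast
  qed
qed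

text \<open>A flag from \<open>K\<close> to \<open>W\<close> uses only vectors outside
  \<open>G U\<close>, since a decomposition \<open>e = u + f\<close> would put \<open>f\<close> into
  \<open>W \<inter> F\<close>. Bounds for all complements thus follow from one-step
  monotonicity.\<close>

lemma complement_chain:
  assumes W: "complement E F W" and K: "subspace K" "K \<subseteq> W"
    and "P K" and step: "\<And>U e. subspace U \<Longrightarrow> K \<subseteq> U \<Longrightarrow> U \<subseteq> E \<Longrightarrow> e \<in> E \<Longrightarrow> e \<notin> G U \<Longrightarrow> P U \<Longrightarrow> P (ext e U)"
  shows "P W"
proof -
  have WE: "W \<subseteq> E" and sW: "subspace W" using W complement_subset complement_def by auto
  have "findim W" using fsubE sW WE by blast
  then show ?thesis using K \<open>P K\<close>
  proof (induction rule: findim_induct)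
    case (step U e)
    have "e \<notin> G U"
    proof
      assume "e \<in> G U"
      then obtain u f where uf: "u \<in> U" "f \<in> F" "e = u + f"
        using step sF unfolding span_Un by (auto simp: span_eq_iff[THEN iffD2])
      then have "f \<in> W" using step sW subspace_diff[of W e u] by auto
      then have "f = 0" using W uf unfolding complement_def by blast
      then show False using uf step by simp
    qed
    then show ?case using assms(5) step WE by blast
  qed
qed

lemma sub_orth: "subspace A \<Longrightarrow> subspace (A \<inter> orth h B)"
  using subspace_inter subspace_orth[OF h] by blast

lemma findim_orth: "subspace A \<Longrightarrow> A \<subseteq> E \<Longrightarrow> findim (A \<inter> orth h B)"
  using fsubE[OF sub_orth] by blast

lemma dim_G_ext: "K \<subseteq> E \<Longrightarrow> e \<notin> G K \<Longrightarrow> dim (G (ext e K)) = Suc (dim (G K))"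
  unfolding G_ext using fG dim_ext by blast

lemma dim_ext_notin_G: "subspace K \<Longrightarrow> K \<subseteq> E \<Longrightarrow> e \<notin> G K \<Longrightarrow> dim (ext e K) = Suc (dim K)"
  using fsubE G_sup dim_ext by blast

text \<open>A vector orthogonal to all of \<open>E\<close> is orthogonal to \<open>x\<close>, which
  forces its coefficient of \<open>e\<close> to vanish.\<close>

lemma ext_orth_E:
  assumes "subspace U" "U \<subseteq> E" "x \<in> E" "x \<in> orth h U" "h x e \<noteq> 0"
  shows "ext e U \<inter> orth h E = U \<inter> orth h E"
proof -
  have "y \<in> U" if y: "y \<in> ext e U" "y \<in> orth h E" for y
  proof -
    have "h x y = 0" using y assms h_sym0[OF h] by (auto simp: orth_def)
    then show ?thesis using ext_orth_coeff[OF h assms(1,4,5)] y by blast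
  qed
  then show ?thesis using ext_sup[of U e] by blast
qed

text \<open>Stated for a pair \<open>U \<subseteq> T\<close> in order to follow
  \<open>K \<inter> orth h (G K)\<close>: its element \<open>x\<close> excludes new vectors, and
  orthogonality to \<open>e\<close> removes old ones.\<close>

lemma ext_radical:
  assumes "subspace U" "x \<in> U" "x \<in> orth h T" "U \<subseteq> T" "h x e \<noteq> 0"
  shows "ext e U \<inter> orth h (ext e T) = U \<inter> orth h T \<inter> {y. h y e = 0}"
proof (intro Set.set_eqI iffI)
  fix y assume y: "y \<in> ext e U \<inter> orth h (ext e T)"
  have "x \<in> ext e T" using assms ext_sup by blast
  then have "h x y = 0" using y h_sym0[OF h] by (auto simp: orth_def)
  moreover have "x \<in> orth h U" using assms orth_anti[OF h] by blast
  ultimately have "y \<in> U" using ext_orth_coeff[OF h assms(1) _ assms(5)] y by blast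
  then show "y \<in> U \<inter> orth h T \<inter> {y. h y e = 0}" using y by (simp add: orth_ext[OF h])
next
  fix y assume "y \<in> U \<inter> orth h T \<inter> {y. h y e = 0}"
  then show "y \<in> ext e U \<inter> orth h (ext e T)" using ext_sup[of U e] by (auto simp: orth_ext[OF h])
qed

section \<open>Bounds valid for every complement\<close>

lemma pindex_complement_le:
  assumes W: "complement E F W" and K: "subspace K" "K \<subseteq> W"
  shows "pindex h W + dim (G K) \<le> pindex h K + dim E"
proof -
  have "pindex h W + dim (G K) \<le> pindex h K + dim (G W)"
  proof (rule complement_chain[OF W K])
    fix U e assume U: "subspace U" "K \<subseteq> U" "U \<subseteq> E" "e \<in> E" "e \<notin> G U"
      and IH: "pindex h U + dim (G K) \<le> pindex h K + dim (G U)"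
    have "dim (G (ext e U)) = Suc (dim (G U))" using dim_G_ext U by blast
    then show "pindex h (ext e U) + dim (G K) \<le> pindex h K + dim (G (ext e U))"
      using IH pindex_ext_le[OF fsubE, of U h e] U by simp
  qed simp
  then show ?thesis using W unfolding complement_def by simp
qed

lemma hermitian_complements_neg: "hermitian_complements (*s) (neg h) E F"
  using hform_neg[OF h] fE sF FE by unfold_locales

text \<open>The one-step estimates behind the lower bounds. A vector of the radical of
  \<open>E\<close> that is new in \<open>ext e K\<close> is also new relative to \<open>G K\<close>,
  which gives the first. For the second, a loss in \<open>K \<inter> orth h (G K)\<close> means that
  one of its vectors pairs with \<open>e\<close>, and then the index grows; a gain in
  \<open>K \<inter> orth h E\<close> is matched in \<open>K \<inter> orth h (G K)\<close>.\<close>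

lemma extension_meets_radical:
  assumes K: "subspace K" "K \<subseteq> E" and e: "e \<in> E" "e \<notin> G K"
  shows "dim (ext e K \<inter> orth h E) + dim (G K \<inter> orth h E) \<le> dim (K \<inter> orth h E) + dim (G (ext e K) \<inter> orth h E)"
    and "pindex h K + dim (K \<inter> orth h (G K)) + dim (ext e K \<inter> orth h E)
      \<le> pindex h (ext e K) + dim (ext e K \<inter> orth h (G (ext e K))) + dim (K \<inter> orth h E)"
proof -
  define K' where "K' = ext e K"
  have sK': "subspace K'" "K' \<subseteq> E" "K \<subseteq> K'" unfolding K'_def using ext_E K e ext_sup by auto
  have fK: "findim K" "findim K'" using K sK' fsubE by auto
  note sI = sub_orth and fI = findim_orth
  have I: "K' \<inter> orth h E \<inter> K = K \<inter> orth h E" using sK' by auto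
  have le: "dim (K' \<inter> orth h E) \<le> Suc (dim (K \<inter> orth h E))"
    using dim_Int_ext[OF fI K(1), of K' "E" e] I sK' K'_def by auto
  have G': "G K \<subseteq> G K'" "subspace (G K')" "G K' \<subseteq> E"
    using sK' G_sub span_mono[of "K \<union> F" "K' \<union> F"] by auto
  have sub: "K' \<inter> orth h E \<subseteq> K \<Longrightarrow> K' \<inter> orth h E = K \<inter> orth h E" using I by auto
  have vG: "v \<notin> G K" if "v \<in> K'" "v \<notin> K" for v
    using ext_Int_subset[OF K(1) subspace_span G_sup e(2)] that unfolding K'_def by blast
  show "dim (ext e K \<inter> orth h E) + dim (G K \<inter> orth h E) \<le> dim (K \<inter> orth h E) + dim (G (ext e K) \<inter> orth h E)"
  proof (cases "K' \<inter> orth h E \<subseteq> K")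
    case True
    have "dim (G K \<inter> orth h E) \<le> dim (G K' \<inter> orth h E)"
      using G' fI sI by (intro dim_mono) auto
    then show ?thesis using sub[OF True] unfolding K'_def by simp
  next
    case False
    then obtain v where v: "v \<in> K'" "v \<in> orth h E" "v \<notin> K" by auto
    have "v \<in> G K'" using v G_sup by blast
    then have "ext v (G K \<inter> orth h E) \<subseteq> G K' \<inter> orth h E"
      using v G' by (intro ext_least sI) auto
    then have "dim (ext v (G K \<inter> orth h E)) \<le> dim (G K' \<inter> orth h E)"
      using G' fI by (intro dim_mono) auto
    moreover have "dim (ext v (G K \<inter> orth h E)) = Suc (dim (G K \<inter> orth h E))"
      using fI[of "G K" E] G_sub[OF K(2)] vG v by (intro dim_ext) auto
    ultimately show ?thesis using le unfolding K'_def by simp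
  qed
  show "pindex h K + dim (K \<inter> orth h (G K)) + dim (ext e K \<inter> orth h E)
      \<le> pindex h (ext e K) + dim (ext e K \<inter> orth h (G (ext e K))) + dim (K \<inter> orth h E)"
  proof (cases "\<exists>x\<in>K \<inter> orth h (G K). h x e \<noteq> 0")
    case True
    then obtain x where x: "x \<in> K" "x \<in> orth h (G K)" "h x e \<noteq> 0" by auto
    have xK: "x \<in> orth h K" using x G_sup orth_anti[OF h] by blast
    have "pindex h (ext e K) = Suc (pindex h K)" using pindex_ext_rad[OF h fK(1) x(1) xK x(3)] .
    moreover have "K' \<inter> orth h E = K \<inter> orth h E"
      unfolding K'_def using ext_orth_E[OF K _ xK x(3)] x(1) K(2) by blast
    moreover have "dim (K \<inter> orth h (G K)) = Suc (dim (K' \<inter> orth h (G K')))"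
      unfolding K'_def G_ext ext_radical[OF K(1) x(1,2) G_sup x(3)]
      using x fI K by (intro dim_ker[OF h]) auto
    ultimately show ?thesis unfolding K'_def by simp
  next
    case False
    then have "K \<inter> orth h (G K) \<subseteq> orth h (G K')" unfolding K'_def G_ext orth_ext[OF h] by blast
    then have inc: "K \<inter> orth h (G K) \<subseteq> K' \<inter> orth h (G K')" using sK' by auto
    have ipm: "pindex h K \<le> pindex h K'" using pindex_mono fK K sK' by blast
    have fI': "findim (K' \<inter> orth h (G K'))" using fI sK' by blast
    show ?thesis
    proof (cases "K' \<inter> orth h E \<subseteq> K")
      case True
      have "dim (K \<inter> orth h (G K)) \<le> dim (K' \<inter> orth h (G K'))"
        using dim_mono[OF fI' sI inc] K by blast
      then show ?thesis using sub[OF True] ipm unfolding K'_def by simp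
    next
      case False
      then obtain v where v: "v \<in> K'" "v \<in> orth h E" "v \<notin> K" by auto
      have "v \<in> orth h (G K')" using v G' orth_anti[OF h] by blast
      then have "ext v (K \<inter> orth h (G K)) \<subseteq> K' \<inter> orth h (G K')"
        using v inc sI[OF sK'(1)] by (intro ext_least) auto
      then have "dim (ext v (K \<inter> orth h (G K))) \<le> dim (K' \<inter> orth h (G K'))"
        using fI' by (intro dim_mono) auto
      moreover have "dim (ext v (K \<inter> orth h (G K))) = Suc (dim (K \<inter> orth h (G K)))"
        using fI[of K "G K"] K v by (intro dim_ext) auto
      ultimately show ?thesis using le ipm unfolding K'_def by simp
    qed
  qed
qed

text \<open>The one-step estimates are summed up to \<open>W\<close>, where \<open>G W = E\<close>.
  In the first bound the correction terms of \<open>W\<close> then cancel; the second also compares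
  \<open>W\<close> with \<open>E\<close> through \<open>pindex_le_corank\<close>, whose radical
  terms cancel against the chain.\<close>

lemma pindex_complement_ge:
  assumes W: "complement E F W" and K: "subspace K" "K \<subseteq> W"
  shows "pindex h K + dim (K \<inter> orth h (G K)) \<le> pindex h W + dim (K \<inter> orth h E)"
    and "pindex h E + dim K + dim (G K \<inter> orth h E) \<le> pindex h W + dim (G K) + dim (K \<inter> orth h E)"
proof -
  have WE: "W \<subseteq> E" "subspace W" "G W = E" using W complement_subset complement_def by auto
  have "pindex h K + dim (K \<inter> orth h (G K)) + dim (W \<inter> orth h E)
      \<le> pindex h W + dim (W \<inter> orth h (G W)) + dim (K \<inter> orth h E)"
    by (rule complement_chain[OF W K, where P = "\<lambda>U. pindex h K + dim (K \<inter> orth h (G K)) + dim (U \<inter> orth h E)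
      \<le> pindex h U + dim (U \<inter> orth h (G U)) + dim (K \<inter> orth h E)"])
       (use extension_meets_radical(2) in fastforce)+
  then show "pindex h K + dim (K \<inter> orth h (G K)) \<le> pindex h W + dim (K \<inter> orth h E)" using WE by simp
  have "dim K + dim (G K \<inter> orth h E) + dim (G W) + dim (W \<inter> orth h E)
     \<le> dim W + dim (G W \<inter> orth h E) + dim (G K) + dim (K \<inter> orth h E)"
  proof (rule complement_chain[OF W K])
    fix U e assume U: "subspace U" "K \<subseteq> U" "U \<subseteq> E" "e \<in> E" "e \<notin> G U"
      and IH: "dim K + dim (G K \<inter> orth h E) + dim (G U) + dim (U \<inter> orth h E)
     \<le> dim U + dim (G U \<inter> orth h E) + dim (G K) + dim (K \<inter> orth h E)"
    have "dim (G (ext e U)) = Suc (dim (G U))" "dim (ext e U) = Suc (dim U)"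
      using dim_G_ext dim_ext_notin_G U by blast+
    then show "dim K + dim (G K \<inter> orth h E) + dim (G (ext e U)) + dim (ext e U \<inter> orth h E)
     \<le> dim (ext e U) + dim (G (ext e U) \<inter> orth h E) + dim (G K) + dim (K \<inter> orth h E)"
      using IH extension_meets_radical(1)[OF U(1,3,4,5)] by simp
  qed simp
  then show "pindex h E + dim K + dim (G K \<inter> orth h E) \<le> pindex h W + dim (G K) + dim (K \<inter> orth h E)"
    using pindex_le_corank[OF h fE WE(2,1)] WE by simp
qed

section \<open>Complements of maximal index and of maximal rank\<close>

text \<open>The invariant is \<open>c + dim (G K) \<le> pindex h K + dim E\<close>. As long as it is
  strict, any vector outside \<open>G K\<close> will do. When it is tight,
  \<open>pindex h K < pindex h E\<close>, so there is a positive vector orthogonal to a maximal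
  positive \<open>P\<close> in \<open>K\<close>, and a small perturbation moves it out of
  \<open>G K\<close> if necessary.\<close>

lemma pindex_complement_max:
  assumes K: "subspace K" "K \<subseteq> E" "K \<inter> F = {0}"
    and c: "c + dim (G K) \<le> pindex h K + dim E" "c \<le> pindex h E"
  shows "\<exists>W. complement E F W \<and> K \<subseteq> W \<and> c \<le> pindex h W"
proof -
  have "\<exists>W. complement E F W \<and> K \<subseteq> W \<and> c + dim (G W) \<le> pindex h W + dim E"
  proof (rule complement_exists[where Q = "\<lambda>K. c + dim (G K) \<le> pindex h K + dim E", OF K c(1)])
    fix K assume K: "subspace K" "K \<subseteq> E" and Q: "c + dim (G K) \<le> pindex h K + dim E" and GE: "G K \<noteq> E"
    have fK: "findim K" using K fsubE by blast
    obtain g where g: "g \<in> E" "g \<notin> G K" using GE G_sub[OF K(2)] by blast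
    have d: "dim (G (ext e K)) = Suc (dim (G K))" if "e \<in> E" "e \<notin> G K" for e
      using dim_G_ext K that by blast
    show "\<exists>e\<in>E. e \<notin> G K \<and> c + dim (G (ext e K)) \<le> pindex h (ext e K) + dim E"
    proof (cases "c + dim (G K) < pindex h K + dim E")
      case True
      have "pindex h K \<le> pindex h (ext g K)" using pindex_mono[OF findim_ext[OF fK]] ext_sup K by blast
      then show ?thesis using True d[OF g] g by (intro bexI[of _ g]) auto
    next
      case False
      have "dim (G K) < dim E" using dim_psub[OF fE] G_sub[OF K(2)] GE by auto
      then have "pindex h K < pindex h E" using False c(2) Q by linarith
      obtain P where P: "subspace P" "P \<subseteq> K" "posdef h P" "dim P = pindex h K" using pindex_attained[OF fK] by metis
      obtain Q where Q: "subspace Q" "Q \<subseteq> E" "posdef h Q" "dim Q = pindex h E" using pindex_attained[OF fE] by metis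
      have fP: "findim P" "findim Q" using P Q K fsubE by auto
      \<comment> \<open>A maximal positive subspace of \<open>E\<close> is larger than
        \<open>P\<close>, so by dimension it contains a nonzero vector orthogonal to
        \<open>P\<close>.\<close>
      have "dim Q \<le> dim (Q \<inter> orth h P) + dim P" using dim_orth_ge[OF h fP(2,1)] .
      then have "dim (Q \<inter> orth h P) \<noteq> 0" using P Q \<open>pindex h K < pindex h E\<close> by simp
      then have "Q \<inter> orth h P \<noteq> {0}" using dim_zero by auto
      then obtain v where v: "v \<in> Q" "v \<in> orth h P" "v \<noteq> 0"
        using subspace_0[OF Q(1)] subspace_0[OF subspace_orth[OF h, of P]] by auto
      then have qv: "Re (h v v) > 0" using Q(3) unfolding posdef_def by blast
      obtain p where p: "p \<in> P" "\<And>x. x \<in> P \<Longrightarrow> h x (g - p) = 0" using posdef_project[OF h fP(1) P(3)] by metis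
      define w where "w = g - p"
      have vP: "h x v = 0" if "x \<in> P" for x using v that h_sym0[OF h] by (auto simp: orth_def)
      have fin: ?thesis if e: "e \<in> E" "e \<notin> G K" "\<And>x. x \<in> P \<Longrightarrow> h x e = 0" "Re (h e e) > 0" for e
        using pindex_ext_ge[OF h fK P(2,1,3,4) ext_mem e(3,4)] d[OF e(1,2)] e
          \<open>c + dim (G K) \<le> pindex h K + dim E\<close> by (intro bexI[of _ e]) auto
      show ?thesis
      proof (cases "v \<in> G K")
        case False then show ?thesis using fin[of v] v Q vP qv by blast
      next
        case True
        define a b r where "a = Re (h v v)" and "b = \<bar>Re (h v w)\<bar>" and "r = \<bar>Re (h w w)\<bar>"
        have pos: "a > 0" "b \<ge> 0" "r \<ge> 0" using qv unfolding a_def b_def r_def by auto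
        \<comment> \<open>This size makes \<open>t * (2 * b + r) < a\<close>. With
          \<open>t \<le> 1\<close> the quadratic term is at most \<open>t * r\<close> in absolute
          value, so the value at the perturbed vector stays positive.\<close>
        define t where "t = a / (a + 2 * b + r)"
        have t: "0 < t" "t \<le> 1" unfolding t_def using pos by (auto simp: field_simps)
        have "t * (2 * b + r) < a"
        proof -
          have "t * (a + 2 * b + r) = a" unfolding t_def using pos by simp
          moreover have "t * a > 0" using t pos by simp
          ultimately show ?thesis by (simp add: algebra_simps)
        qed
        define e where "e = v + of_real t *s w"
        have "Re (h e e) = a + 2 * t * Re (h v w) + t\<^sup>2 * Re (h w w)"
          unfolding e_def quad_expand[OF h] a_def using t by simp
        moreover have "2 * t * Re (h v w) \<ge> - (2 * t * b)" unfolding b_def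
          using t mult_left_mono[of "- \<bar>Re (h v w)\<bar>" "Re (h v w)" "2 * t"] by simp
        moreover have "t\<^sup>2 * Re (h w w) \<ge> - (t * r)"
        proof -
          have "t\<^sup>2 * Re (h w w) \<ge> - (t\<^sup>2 * r)" unfolding r_def
            using mult_left_mono[of "- \<bar>Re (h w w)\<bar>" "Re (h w w)" "t\<^sup>2"] by simp
          moreover have "t\<^sup>2 * r \<le> t * r" using t pos
            by (intro mult_right_mono) (auto simp: power2_eq_square)
          ultimately show ?thesis by linarith
        qed
        ultimately have qe: "Re (h e e) > 0" using \<open>t * (2 * b + r) < a\<close> by (simp add: algebra_simps)
        have "e \<notin> G K"
        proof
          assume "e \<in> G K"
          then have "of_real t *s w \<in> G K" using True span_diff[of e "K \<union> F" v] unfolding e_def by simp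
          then have "of_real (1 / t) *s (of_real t *s w) \<in> G K" using span_scale by blast
          then have "w \<in> G K" using t by simp
          moreover have "p \<in> G K" using p P G_sup by blast
          ultimately have "g \<in> G K" unfolding w_def using span_add[of "g - p" "K \<union> F" p] by simp
          then show False using g by simp
        qed
        moreover have "e \<in> E" unfolding e_def w_def using v Q g p P K sE
          by (intro subspace_add subspace_scale subspace_diff) auto
        moreover have "h x e = 0" if "x \<in> P" for x
          unfolding e_def w_def using p(2)[OF that] vP[OF that] by (simp add: h_add2[OF h] h_scale2[OF h])
        ultimately show ?thesis using fin qe by blast
      qed
    qed
  qed
  then show ?thesis unfolding complement_def by auto
qed

text \<open>The form vanishes on \<open>V\<close>, the orthogonal of \<open>K\<close> in
  \<open>E\<close>: a vector of \<open>V\<close> inside \<open>G K\<close> is shifted by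
  \<open>w\<close> to the outside, where the form is known to vanish. With zero values on
  \<open>V\<close> the form pairs \<open>V\<close> trivially with itself, and
  \<open>E = K + V\<close> by \<open>all\<close>, so \<open>V\<close> lies in the radical of
  \<open>E\<close>.\<close>

lemma null_on_perp:
  assumes K: "subspace K" "K \<subseteq> E" and GE: "G K \<noteq> E"
    and all: "\<And>y. y \<in> E \<Longrightarrow> \<exists>k\<in>K. y - k \<in> orth h K"
    and none: "\<And>e. e \<in> E \<Longrightarrow> e \<notin> G K \<Longrightarrow> e \<in> orth h K \<Longrightarrow> h e e = 0"
    and v: "v \<in> E" "v \<in> orth h K"
  shows "v \<in> orth h E"
proof -
  obtain e0 where e0: "e0 \<in> E" "e0 \<notin> G K" using GE G_sub[OF K(2)] by blast
  obtain k0 where k0: "k0 \<in> K" "e0 - k0 \<in> orth h K" using all e0 by blast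
  define w where "w = e0 - k0"
  have "w + k0 \<notin> G K" unfolding w_def using e0 by simp
  then have w: "w \<in> E" "w \<in> orth h K" "w \<notin> G K"
    using k0 e0 K subspace_diff[OF sE] G_sup[of K] span_add[of w "K \<union> F" k0] unfolding w_def by auto
  define V where "V = E \<inter> orth h K"
  have sV: "subspace V" unfolding V_def using sub_orth sE by blast
  have "w \<in> V" using w V_def by auto
  have q: "Re (h x x) = 0" if x: "x \<in> V" for x
  proof (cases "x \<in> G K")
    case False then show ?thesis using none[of x] x V_def by auto
  next
    case True
    have "Re (h (w + c *s x) (w + c *s x)) = 0" for c
    proof -
      have "w + c *s x \<notin> G K"
        using span_diff[OF _ span_scale[OF True], of "w + c *s x" c] w(3) by auto
      moreover have "w + c *s x \<in> V" using sV \<open>w \<in> V\<close> x subspace_add subspace_scale by blast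
      ultimately show ?thesis using none[of "w + c *s x"] V_def by auto
    qed
    \<comment> \<open>Adding the values at \<open>w + x\<close> and \<open>w - x\<close> removes the
      cross term.\<close>
    from this[of 1] this[of "-1"] show ?thesis
      unfolding quad_expand[OF h] using none[OF w(1,3,2)] by simp
  qed
  have vV: "v \<in> V" using v V_def by auto
  have "h v y = 0" if y: "y \<in> E" for y
  proof -
    obtain k where k: "k \<in> K" "y - k \<in> orth h K" using all y by blast
    have "y - k \<in> V" unfolding V_def using k y K sE subspace_diff by blast
    then have "h v (y - k) = 0" using cauchy_null[OF h sV _ vV] q vV by simp
    moreover have "h v k = 0" using v k by (auto simp: orth_def)
    ultimately show ?thesis by (simp add: h_diff2[OF h])
  qed
  then show ?thesis by (simp add: orth_def)
qed

text \<open>A greedy argument on the sum of both indices. A radical vector of \<open>K\<close>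
  outside the radical of \<open>E\<close> allows a gain of 2; otherwise a vector that is orthogonal
  to \<open>K\<close>, outside \<open>G K\<close> and not isotropic gains 1. If neither exists,
  \<open>E\<close> is the sum of \<open>K\<close> and the radical of \<open>E\<close>, and
  \<open>K\<close> already carries the whole rank of \<open>h\<close> on \<open>E\<close>.\<close>

lemma rank_complement_max:
  assumes K: "subspace K" "K \<subseteq> E" "K \<inter> F = {0}"
    and c: "c + dim (G K) + dim (K \<inter> orth h E) \<le> dim K + dim E"
      "c + 2 * dim (G K) \<le> pindex h K + pindex (neg h) K + 2 * dim E"
      "c \<le> pindex h E + pindex (neg h) E"
  shows "\<exists>W. complement E F W \<and> K \<subseteq> W \<and> c \<le> pindex h W + pindex (neg h) W"
proof -
  \<comment> \<open>The first alternative records that the target is reached, after which any vector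
    outside \<open>G K\<close> may be added. The third bound on \<open>c\<close> speaks of
    \<open>E\<close> alone and needs no tracking.\<close>
  define Q where "Q K \<longleftrightarrow> c \<le> pindex h K + pindex (neg h) K \<or>
    c + dim (G K) + dim (K \<inter> orth h E) \<le> dim K + dim E \<and>
      c + 2 * dim (G K) \<le> pindex h K + pindex (neg h) K + 2 * dim E" for K
  have "Q K" unfolding Q_def using c by simp
  have "\<exists>W. complement E F W \<and> K \<subseteq> W \<and> Q W"
  proof (rule complement_exists[of K Q, OF K \<open>Q K\<close>])
    fix K assume K: "subspace K" "K \<subseteq> E" and Q: "Q K" and GE: "G K \<noteq> E"
    have fK: "findim K" using K fsubE by blast
    obtain g where g: "g \<in> E" "g \<notin> G K" using GE G_sub[OF K(2)] by blast
    have Glt: "dim (G K) < dim E" using dim_psub[OF fE] G_sub[OF K(2)] GE by auto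
    note inert = inertia_radical[OF h fK]
    have mono: "pindex h K + pindex (neg h) K \<le> pindex h (ext e K) + pindex (neg h) (ext e K)" for e
      using pindex_mono[OF findim_ext[OF fK, of e] K(1) ext_sup] by (simp add: add_mono)
    show "\<exists>e\<in>E. e \<notin> G K \<and> Q (ext e K)"
    proof (cases "c \<le> pindex h K + pindex (neg h) K")
      case True
      then show ?thesis using g mono[of g] unfolding Q_def by (intro bexI[of _ g]) auto
    next
      case cK: False
      then have Q1: "c + dim (G K) + dim (K \<inter> orth h E) \<le> dim K + dim E"
        and Q2: "c + 2 * dim (G K) \<le> pindex h K + pindex (neg h) K + 2 * dim E" using Q unfolding Q_def by auto
      show ?thesis
      proof (cases "\<exists>x\<in>K. x \<in> orth h K \<and> x \<notin> orth h E")
        case True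
        then obtain x where x: "x \<in> K" "x \<in> orth h K" "x \<notin> orth h E" by auto
        then have "\<not> E \<subseteq> {y. h y x = 0}" using h_sym0[OF h] by (auto simp: orth_def)
        moreover have "\<not> E \<subseteq> G K" using g by auto
        \<comment> \<open>\<open>e\<close> has to avoid two subspaces that do not contain
          \<open>E\<close>: \<open>G K\<close> and the vectors orthogonal to
          \<open>x\<close>.\<close>
        ultimately obtain e where e: "e \<in> E" "e \<notin> G K" "h e x \<noteq> 0"
          using two_subspaces[OF sE subspace_span subspace_ker[OF h]] by blast
        then have xe: "h x e \<noteq> 0" using h_sym0[OF h] by blast
        have "pindex h (ext e K) = Suc (pindex h K)" using pindex_ext_rad[OF h fK x(1,2) xe] .
        moreover have "pindex (neg h) (ext e K) = Suc (pindex (neg h) K)"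
          using pindex_ext_rad[OF hform_neg[OF h] fK x(1), of e] x xe by (simp add: neg_def)
        moreover have "ext e K \<inter> orth h E = K \<inter> orth h E" using ext_orth_E K x xe by blast
        ultimately have "Q (ext e K)" unfolding Q_def
          using Q1 Q2 dim_G_ext[OF K(2) e(2)] dim_ext_notin_G[OF K e(2)] by simp
        then show ?thesis using e by blast
      next
        case False
        then have rad: "K \<inter> orth h K = K \<inter> orth h E" using orth_anti[OF h K(2)] by blast
        have all: "\<exists>k\<in>K. y - k \<in> orth h K" if "y \<in> E" for y
        proof (cases rule: radical_cases[OF h fK, of y])
          case (1 x) then show ?thesis using rad that by (auto simp: orth_def)
        next
          case (2 k) then show ?thesis using h_sym0[OF h] by (auto simp: orth_def)
        qed
        show ?thesis
        proof (cases "\<exists>e\<in>E. e \<notin> G K \<and> e \<in> orth h K \<and> h e e \<noteq> 0")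
          case True
          then obtain e where e: "e \<in> E" "e \<notin> G K" "e \<in> orth h K" "h e e \<noteq> 0" by auto
          have perp: "h x e = 0" if "x \<in> K" for x using e that h_sym0[OF h] by (auto simp: orth_def)
          have "Re (h e e) \<noteq> 0" using e h_self_0[OF h] by blast
          then have "pindex h (ext e K) + pindex (neg h) (ext e K) = Suc (pindex h K + pindex (neg h) K)"
            using pindex_ext_perp[OF h fK, of e] pindex_ext_perp[OF hform_neg[OF h] fK, of e] perp
            by (auto simp: neg_def)
          moreover have "ext e K \<inter> orth h E = K \<inter> orth h E" using ext_orth_E K e by blast
          \<comment> \<open>In the second inequality one side grows by 2 and the rank only by 1; the
            missing unit comes from the first inequality, Sylvester's law and
            \<open>dim (G K) < dim E\<close>.\<close>
          ultimately have "Q (ext e K)" unfolding Q_def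
            using Q1 Glt inert rad dim_G_ext[OF K(2) e(2)] dim_ext_notin_G[OF K e(2)] by simp
          then show ?thesis using e by blast
        next
          case none: False
          have "dim E + dim (K \<inter> orth h E) \<le> dim K + dim (E \<inter> orth h E)"
            using fE K
          proof (induction rule: findim_induct[where P = "\<lambda>U. dim U + dim (K \<inter> orth h E) \<le> dim K + dim (U \<inter> orth h E)"])
            case (step U e)
            obtain k where k: "k \<in> K" "e - k \<in> orth h K" using all step by blast
            have "e - k \<in> E" using k step K sE subspace_diff by blast
            then have v: "e - k \<in> orth h E" using null_on_perp[OF K GE all _ _ k(2)] none by blast
            have vU: "e - k \<notin> U" using step k subspace_add[of U "e - k" k] by auto
            have "ext (e - k) (U \<inter> orth h E) \<subseteq> ext (e - k) U \<inter> orth h E"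
              using v ext_sup ext_mem by (intro ext_least sub_orth) auto
            moreover have "findim (ext (e - k) U \<inter> orth h E)"
              using step k K \<open>e - k \<in> E\<close> ext_E by (intro findim_orth) auto
            ultimately have "dim (ext (e - k) (U \<inter> orth h E)) \<le> dim (ext (e - k) U \<inter> orth h E)"
              by (intro dim_mono) auto
            moreover have "dim (ext (e - k) (U \<inter> orth h E)) = Suc (dim (U \<inter> orth h E))"
              using findim_orth step vU by (intro dim_ext) auto
            moreover have "ext (e - k) U = ext e U" using ext_shift k step by blast
            ultimately show ?case using step dim_ext[of U e] by simp
          qed simp
          then have "c \<le> pindex h K + pindex (neg h) K"
            using inert rad inertia_radical[OF h fE] c(3) by simp
          then show ?thesis using cK by simp
        qed
      qed
    qed
  qed
  then show ?thesis unfolding Q_def complement_def by auto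
qed

section \<open>Complements minimizing both indices\<close>

lemma dim_span_radical:
  assumes "subspace K" "K \<subseteq> E"
  shows "dim (span (K \<union> (E \<inter> orth h E))) + dim (K \<inter> orth h E) \<le> dim K + dim (E \<inter> orth h E)"
proof -
  have "K \<inter> (E \<inter> orth h E) = K \<inter> orth h E" using assms by auto
  then show ?thesis using dim_Un_le(2)[OF fsubE[OF assms] findim_orth[OF sE, of E]] by simp
qed

text \<open>With a degenerate \<open>h\<close> the double orthogonal of \<open>K\<close> in
  \<open>E\<close> returns the radical of \<open>E\<close> as well: by \<open>project\<close> such
  an \<open>x\<close> differs from an element of \<open>K\<close> by a vector orthogonal to
  \<open>E\<close>.\<close>

lemma orth_perp:
  assumes "subspace K" "K \<subseteq> E" "x \<in> E" "\<And>y. y \<in> E \<Longrightarrow> y \<in> orth h K \<Longrightarrow> h y x = 0"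
  shows "x \<in> span (K \<union> (E \<inter> orth h E))"
proof -
  obtain k where k: "k \<in> K" "\<forall>y\<in>E. h y (x - k) = 0"
    using project[OF h fsubE[OF assms(1,2)] sE, of x] assms(4) by blast
  then have "x - k \<in> E \<inter> orth h E"
    using assms sE subspace_diff h_sym0[OF h] by (auto simp: orth_def)
  then show ?thesis using k span_add[OF span_base span_base, of k "K \<union> (E \<inter> orth h E)" "x - k"] by simp
qed

text \<open>The index grows by the full codimension between \<open>K\<close> plus the radical of
  \<open>E\<close> and \<open>ext e (G K)\<close>. The latter is one dimension larger than
  \<open>G K\<close>, on which the bound \<open>c\<close> is based, and that dimension is the unit
  of slack.\<close>

lemma pindex_slack:
  assumes K: "subspace K" "K \<subseteq> E" and RG: "E \<inter> orth h E \<subseteq> G K"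
    and e: "e \<in> E" "e \<notin> G K"
    and pos: "\<And>x. x \<in> ext e (G K) \<Longrightarrow> x \<in> orth h K \<Longrightarrow> x \<notin> span (K \<union> (E \<inter> orth h E)) \<Longrightarrow> Re (h x x) > 0"
    and c: "pindex h E + dim K + dim (G K \<inter> orth h E) \<le> c + dim (G K) + dim (K \<inter> orth h E)"
  shows "pindex h K + 1 \<le> c"
proof -
  define K1 where "K1 = span (K \<union> (E \<inter> orth h E))"
  define L where "L = ext e (G K)"
  have K1G: "K1 \<subseteq> G K" unfolding K1_def using RG G_sup by (intro span_minimal) auto
  have LE: "L \<subseteq> E" unfolding L_def using ext_E[OF G_sub[OF K(2)] e(1)] .
  then have fL: "findim L" unfolding L_def using fsubE by auto
  have K1L: "K1 \<subseteq> L" using K1G ext_sup unfolding L_def by blast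
  have KK1: "K \<subseteq> K1" unfolding K1_def using span_superset by blast
  have "Re (h x x) > 0" if "x \<in> L" "x \<in> orth h K1" "x \<notin> K1" for x
    using pos that orth_anti[OF h KK1] unfolding K1_def L_def by blast
  then have "pindex h K1 + dim L \<le> pindex h L + dim K1"
    using pindex_grow[OF h fL _ K1L] unfolding K1_def by blast
  moreover have "pindex h L \<le> pindex h E" using pindex_mono[OF fE _ LE] unfolding L_def by simp
  moreover have "pindex h K \<le> pindex h K1"
    using pindex_mono[of K1 K h] K KK1 fsubE[of K1] K1G G_sub[OF K(2)] unfolding K1_def by auto
  moreover have "dim L = Suc (dim (G K))" unfolding L_def using dim_ext fG K e by blast
  moreover have "dim K1 + dim (K \<inter> orth h E) \<le> dim K + dim (E \<inter> orth h E)"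
    unfolding K1_def using dim_span_radical[OF K] .
  moreover have "G K \<inter> orth h E = E \<inter> orth h E" using RG G_sub[OF K(2)] by blast
  ultimately show ?thesis using c by simp
qed

text \<open>Keeps the condition that vectors of \<open>K\<close> orthogonal to \<open>G K\<close>
  are orthogonal to \<open>E\<close>, on which the next enlargement relies.\<close>

lemma ext_perp_orth:
  assumes K: "subspace K" "K \<subseteq> E" and KG: "K \<inter> orth h (G K) \<subseteq> orth h E"
    and e: "\<And>k c. k \<in> K \<Longrightarrow> c \<noteq> 0 \<Longrightarrow> k + c *s e \<notin> orth h (G (ext e K))"
  shows "ext e K \<inter> orth h (G (ext e K)) \<subseteq> orth h E"
proof
  fix y assume y: "y \<in> ext e K \<inter> orth h (G (ext e K))"
  then obtain c k where k: "k \<in> K" "y = k + c *s e" using ext_iff[OF K(1)] by blast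
  then have "c = 0" using e y by blast
  moreover have "y \<in> orth h (G K)" using y unfolding G_ext orth_ext[OF h] by blast
  ultimately show "y \<in> orth h E" using KG k by auto
qed

text \<open>\<open>e\<close> raises the index of \<open>h\<close> by one, which
  \<open>pindex_slack\<close> permits, and leaves the other index alone. No vector with a nonzero
  \<open>e\<close>-component becomes orthogonal to \<open>G (ext e K)\<close>, because its pairing
  with \<open>e\<close> is a nonzero multiple of \<open>h e e\<close>.\<close>

lemma definite_step:
  assumes K: "subspace K" "K \<subseteq> E" and KG: "K \<inter> orth h (G K) \<subseteq> orth h E"
    and RG: "E \<inter> orth h E \<subseteq> G K"
    and e: "e \<in> E" "e \<notin> G K" "e \<in> orth h K" "Re (h e e) > 0"
    and pos: "\<And>x. x \<in> ext e (G K) \<Longrightarrow> x \<in> orth h K \<Longrightarrow> x \<notin> span (K \<union> (E \<inter> orth h E)) \<Longrightarrow> Re (h x x) > 0"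
    and c: "pindex h E + dim K + dim (G K \<inter> orth h E) \<le> c + dim (G K) + dim (K \<inter> orth h E)"
    and c': "pindex (neg h) K \<le> c'"
  shows "pindex h (ext e K) \<le> c \<and> pindex (neg h) (ext e K) \<le> c' \<and>
    ext e K \<inter> orth h (G (ext e K)) \<subseteq> orth h E"
proof -
  have fK: "findim K" using K fsubE by blast
  have perp: "h x e = 0" "h e x = 0" if "x \<in> K" for x using e that h_sym0[OF h] by (auto simp: orth_def)
  have "pindex h (ext e K) \<le> c"
    using pindex_ext_perp[OF h fK perp(1)] e(4) pindex_slack[OF K RG e(1,2) pos c] by simp
  moreover have "pindex (neg h) (ext e K) \<le> c'"
    using pindex_ext_perp[OF hform_neg[OF h] fK, of e] perp e(4) c' by (simp add: neg_def)
  moreover have "ext e K \<inter> orth h (G (ext e K)) \<subseteq> orth h E"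
  proof (rule ext_perp_orth[OF K KG])
    fix k z assume k: "k \<in> K" and z: "z \<noteq> (0 :: complex)"
    show "k + z *s e \<notin> orth h (G (ext e K))"
    proof
      assume "k + z *s e \<in> orth h (G (ext e K))"
      then have "h (k + z *s e) e = 0" unfolding G_ext using ext_mem by (auto simp: orth_def)
      then have "z * h e e = 0" using perp k by (simp add: h_simps[OF h])
      then show False using z e(4) by auto
    qed
  qed
  ultimately show ?thesis by blast
qed

text \<open>By \<open>cauchy_null\<close> a null vector of the orthogonal of \<open>K\<close> in
  \<open>E\<close> is orthogonal to that whole space, hence lies in \<open>K\<close> plus the
  radical of \<open>E\<close>. Everything else there is positive, in particular \<open>e\<close>,
  which is outside \<open>G K\<close>.\<close>

lemma semidefinite_step:
  assumes K: "subspace K" "K \<subseteq> E" and KG: "K \<inter> orth h (G K) \<subseteq> orth h E"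
    and RG: "E \<inter> orth h E \<subseteq> G K"
    and e: "e \<in> E" "e \<notin> G K" "e \<in> orth h K"
    and semi: "\<And>v. v \<in> E \<Longrightarrow> v \<in> orth h K \<Longrightarrow> Re (h v v) \<ge> 0"
    and c: "pindex h E + dim K + dim (G K \<inter> orth h E) \<le> c + dim (G K) + dim (K \<inter> orth h E)"
    and c': "pindex (neg h) K \<le> c'"
  shows "pindex h (ext e K) \<le> c \<and> pindex (neg h) (ext e K) \<le> c' \<and>
    ext e K \<inter> orth h (G (ext e K)) \<subseteq> orth h E"
proof -
  have pos: "Re (h x x) > 0"
    if x: "x \<in> E" "x \<in> orth h K" "x \<notin> span (K \<union> (E \<inter> orth h E))" for x
  proof (rule ccontr)
    assume "\<not> ?thesis"
    then have 0: "Re (h x x) = 0" using semi[OF x(1,2)] by simp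
    have "h y x = 0" if "y \<in> E" "y \<in> orth h K" for y
      using cauchy_null[OF h sub_orth[OF sE], of K x y] semi x that 0 h_sym0[OF h] by auto
    then show False using orth_perp[OF K x(1)] x(3) by blast
  qed
  have "span (K \<union> (E \<inter> orth h E)) \<subseteq> G K" using RG G_sup by (intro span_minimal) auto
  then have "Re (h e e) > 0" using pos e by blast
  moreover have "ext e (G K) \<subseteq> E" using ext_E G_sub K e by blast
  ultimately show ?thesis
    using definite_step[OF K KG RG e _ _ c c'] pos by blast
qed

text \<open>
  An isotropic \<open>e\<close> orthogonal to \<open>K\<close> but outside \<open>G K\<close> and \<open>K + (G K)\<^sup>\<bottom>\<close> changes neither index. If there is
  none, then either the form is semidefinite on \<open>K\<^sup>\<bottom>\<close> or \<open>K\<^sup>\<bottom> \<subseteq> K + (G K)\<^sup>\<bottom>\<close>, and in both cases the bound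
  coming from \<open>E\<close> leaves room for one index to grow (lemma \<open>pindex_slack\<close>).
\<close>

lemma min_step_perp:
  assumes K: "subspace K" "K \<subseteq> E" and GE: "G K \<noteq> E" and KG: "K \<inter> orth h (G K) \<subseteq> orth h E"
    and RG: "E \<inter> orth h E \<subseteq> G K"
    and c: "pindex h K \<le> c" "pindex h E + dim K + dim (G K \<inter> orth h E) \<le> c + dim (G K) + dim (K \<inter> orth h E)"
    and d: "pindex (neg h) K \<le> d" "pindex (neg h) E + dim K + dim (G K \<inter> orth h E) \<le> d + dim (G K) + dim (K \<inter> orth h E)"
  shows "\<exists>e\<in>E. e \<notin> G K \<and> pindex h (ext e K) \<le> c \<and> pindex (neg h) (ext e K) \<le> d \<and>
    ext e K \<inter> orth h (G (ext e K)) \<subseteq> orth h E"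
proof -
  interpret n: hermitian_complements scale "neg h" E F by (rule hermitian_complements_neg)
  have fK: "findim K" using K fsubE by blast
  obtain g where g: "g \<in> E" "g \<notin> G K" using GE G_sub[OF K(2)] by blast
  \<comment> \<open>The correction is taken from \<open>G K\<close>, so the obstruction consists of
    vectors of \<open>K\<close> orthogonal to \<open>G K\<close>, and \<open>KG\<close> makes these
    orthogonal to \<open>g\<close>.\<close>
  have "\<exists>t\<in>G K. \<forall>x\<in>K. h x (g - t) = 0"
  proof (rule project[OF h fG[OF K(2)] K(1)])
    fix x assume "x \<in> K" "x \<in> orth h (G K)"
    then show "h x g = 0" using KG g by (auto simp: orth_def)
  qed
  then obtain t where t: "t \<in> G K" "\<forall>x\<in>K. h x (g - t) = 0" by blast
  define w where "w = g - t"
  have w: "w \<in> E" "w \<in> orth h K" "w \<notin> G K"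
  proof -
    show "w \<in> E" unfolding w_def using g t G_sub K sE subspace_diff by blast
    show "w \<in> orth h K" unfolding w_def using t h_sym0[OF h] by (auto simp: orth_def)
    show "w \<notin> G K" unfolding w_def using g span_add[of "g - t" "K \<union> F" t] t by auto
  qed
  define V where "V = E \<inter> orth h K"
  have sV: "subspace V" unfolding V_def using sub_orth sE by blast
  define S where "S = span (K \<union> orth h (G K))"
  show ?thesis
  proof (cases "\<exists>e\<in>V. e \<notin> G K \<and> e \<notin> S \<and> Re (h e e) = 0")
    case True
    then obtain e where e: "e \<in> E" "e \<in> orth h K" "e \<notin> G K" "e \<notin> S" "Re (h e e) = 0"
      unfolding V_def by auto
    have perp: "h x e = 0" if "x \<in> K" for x using e that h_sym0[OF h] by (auto simp: orth_def)
    have "pindex h (ext e K) = pindex h K" "pindex (neg h) (ext e K) = pindex (neg h) K"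
      using pindex_ext_perp[OF h fK perp] pindex_ext_perp[OF hform_neg[OF h] fK, of e] perp e(5)
      by (simp_all add: neg_def)
    moreover have "ext e K \<inter> orth h (G (ext e K)) \<subseteq> orth h E"
    proof (rule ext_perp_orth[OF K KG])
      fix k z assume k: "k \<in> K" and z: "z \<noteq> (0 :: complex)"
      show "k + z *s e \<notin> orth h (G (ext e K))"
      proof
        assume "k + z *s e \<in> orth h (G (ext e K))"
        then have "k + z *s e \<in> S" unfolding S_def G_ext orth_ext[OF h] by (intro span_base) auto
        moreover have "k \<in> S" unfolding S_def using k by (intro span_base) auto
        ultimately have "z *s e \<in> S" using span_diff[of "k + z *s e" "K \<union> orth h (G K)" k]
          unfolding S_def by simp
        then have "(1 / z) *s (z *s e) \<in> S" unfolding S_def by (rule span_scale)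
        then show False using z e(4) by simp
      qed
    qed
    ultimately show ?thesis using e c d by auto
  next
    case none: False
    show ?thesis
    proof (cases "(\<forall>v\<in>V. Re (h v v) \<ge> 0) \<or> (\<forall>v\<in>V. Re (h v v) \<le> 0)")
      case True
      then show ?thesis
      proof
        assume "\<forall>v\<in>V. Re (h v v) \<ge> 0"
        then show ?thesis using semidefinite_step[OF K KG RG w(1,3,2) _ c(2) d(1)] w unfolding V_def by blast
      next
        assume "\<forall>v\<in>V. Re (h v v) \<le> 0"
        then have "Re (neg h v v) \<ge> 0" if "v \<in> E" "v \<in> orth h K" for v
          using that unfolding V_def neg_def by auto
        then show ?thesis
          using n.semidefinite_step[OF K _ _ w(1,3) _ _ _ , of d c] KG RG w c d by auto
      qed
    next
      case indef: False
      then obtain y z where yz: "y \<in> V" "Re (h y y) < 0" "z \<in> V" "Re (h z z) > 0"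
        by (auto simp: not_le)
      have "\<not> V \<subseteq> G K" using w V_def by blast
      \<comment> \<open>In the indefinite case \<open>isotropic_avoid\<close> yields the excluded
        isotropic vector unless \<open>V\<close> lies in \<open>G K\<close> or in \<open>S\<close>,
        and \<open>w\<close> rules out the former.\<close>
      then have "V \<subseteq> S"
        using isotropic_avoid[OF h sV, of "G K" S] yz none unfolding S_def by auto
      \<comment> \<open>Decompose \<open>v\<close> in \<open>S\<close>: the part in \<open>K\<close>
        pairs trivially with \<open>x\<close> as \<open>x\<close> is orthogonal to \<open>K\<close>,
        the part in \<open>orth h (G K)\<close> as \<open>x\<close> is in
        \<open>G K\<close>.\<close>
      have null: "h x v = 0" if x: "x \<in> V" "x \<in> G K" and v: "v \<in> V" for x v
      proof -
        obtain k u where ku: "v = k + u" "k \<in> K" "u \<in> orth h (G K)"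
          using v \<open>V \<subseteq> S\<close> K(1) subspace_orth[OF h] unfolding S_def span_Un
          by (auto simp: span_eq_iff[THEN iffD2])
        have "h x k = 0" using x ku unfolding V_def by (auto simp: orth_def)
        moreover have "h x u = 0" using x ku h_sym0[OF h] by (auto simp: orth_def)
        ultimately show ?thesis using ku by (simp add: h_add2[OF h])
      qed
      have inK1: "x \<in> span (K \<union> (E \<inter> orth h E))" if "x \<in> V" "x \<in> G K" for x
        using orth_perp[OF K, of x] that null h_sym0[OF h] unfolding V_def by blast
      have z: "z \<in> E" "z \<notin> G K" "z \<in> orth h K" using yz null[of z z] unfolding V_def by auto
      \<comment> \<open>Up to a vector of \<open>V\<close> in \<open>G K\<close>, which pairs
        trivially with \<open>V\<close>, \<open>x\<close> is a multiple of \<open>z\<close>; the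
        factor \<open>b\<close> is nonzero by \<open>inK1\<close>.\<close>
      have "Re (h x x) > 0"
        if x: "x \<in> ext z (G K)" "x \<in> orth h K" "x \<notin> span (K \<union> (E \<inter> orth h E))" for x
      proof -
        obtain u b where u: "u \<in> G K" "x = u + b *s z" using x ext_iff[OF subspace_span] by blast
        have "x \<in> V" unfolding V_def using x z u G_sub[OF K(2)] sE subspace_add subspace_scale by blast
        then have "u \<in> V" using u yz sV subspace_diff[OF sV \<open>x \<in> V\<close>, of "b *s z"] subspace_scale by auto
        then have "h u u = 0" "h u z = 0" using null u yz by auto
        then have "Re (h x x) = (cmod b)\<^sup>2 * Re (h z z)" unfolding u(2) quad_expand[OF h] by simp
        moreover have "b \<noteq> 0" using u x(3) inK1 \<open>x \<in> V\<close> by auto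
        ultimately show ?thesis using yz by simp
      qed
      then show ?thesis
        using definite_step[OF K KG RG z yz(4) _ c(2) d(1)] z by blast
    qed
  qed
qed

text \<open>The four inequalities are carried together, which lets one complement serve both signs.
  Vectors of \<open>K\<close> orthogonal to \<open>G K\<close> but not to \<open>E\<close> are used
  up first, raising both indices against the correction term; then the radical of \<open>E\<close>
  is absorbed into \<open>G K\<close> at no cost; only then does \<open>min_step_perp\<close>
  apply.\<close>

lemma inertia_complement_min:
  assumes K: "subspace K" "K \<subseteq> E" "K \<inter> F = {0}"
    and c: "pindex h K + dim (K \<inter> orth h (G K)) \<le> c + dim (K \<inter> orth h E)"
      "pindex h E + dim K + dim (G K \<inter> orth h E) \<le> c + dim (G K) + dim (K \<inter> orth h E)"
    and d: "pindex (neg h) K + dim (K \<inter> orth h (G K)) \<le> d + dim (K \<inter> orth h E)"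
      "pindex (neg h) E + dim K + dim (G K \<inter> orth h E) \<le> d + dim (G K) + dim (K \<inter> orth h E)"
  shows "\<exists>W. complement E F W \<and> K \<subseteq> W \<and> pindex h W \<le> c \<and> pindex (neg h) W \<le> d"
proof -
  define Q where "Q K \<longleftrightarrow>
    pindex h K + dim (K \<inter> orth h (G K)) \<le> c + dim (K \<inter> orth h E) \<and>
    pindex h E + dim K + dim (G K \<inter> orth h E) \<le> c + dim (G K) + dim (K \<inter> orth h E) \<and>
    pindex (neg h) K + dim (K \<inter> orth h (G K)) \<le> d + dim (K \<inter> orth h E) \<and>
    pindex (neg h) E + dim K + dim (G K \<inter> orth h E) \<le> d + dim (G K) + dim (K \<inter> orth h E)" for K
  have "Q K" unfolding Q_def using c d by simp
  have "\<exists>W. complement E F W \<and> K \<subseteq> W \<and> Q W"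
  proof (rule complement_exists[of K Q, OF K \<open>Q K\<close>])
    fix K assume K: "subspace K" "K \<subseteq> E" and Q: "Q K" and GE: "G K \<noteq> E"
    have fK: "findim K" using K fsubE by blast
    have GsE: "G K \<subseteq> E" using G_sub K by blast
    have KE: "dim (K \<inter> orth h E) \<le> dim (K \<inter> orth h (G K))"
      using dim_mono[OF findim_orth[OF K] sub_orth[OF K(1)]] orth_anti[OF h GsE] by blast
    show "\<exists>e\<in>E. e \<notin> G K \<and> Q (ext e K)"
    proof (cases "K \<inter> orth h (G K) \<subseteq> orth h E")
      case False
      then obtain x where x: "x \<in> K" "x \<in> orth h (G K)" "x \<notin> orth h E" by auto
      then obtain e where e: "e \<in> E" "h x e \<noteq> 0" by (auto simp: orth_def)
      \<comment> \<open>\<open>x\<close> is orthogonal to \<open>G K\<close> but not to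
        \<open>e\<close>, so no separate genericity condition on \<open>e\<close> arises.\<close>
      then have eG: "e \<notin> G K" using x by (auto simp: orth_def)
      have xK: "x \<in> orth h K" using x orth_anti[OF h G_sup] by blast
      have xE: "x \<in> E" using x K by blast
      have "pindex h (ext e K) = Suc (pindex h K)" using pindex_ext_rad[OF h fK x(1) xK e(2)] .
      moreover have "pindex (neg h) (ext e K) = Suc (pindex (neg h) K)"
        using pindex_ext_rad[OF hform_neg[OF h] fK x(1), of e] xK e by (simp add: neg_def)
      moreover have "ext e K \<inter> orth h E = K \<inter> orth h E" using ext_orth_E[OF K xE xK e(2)] .
      moreover have "G (ext e K) \<inter> orth h E = G K \<inter> orth h E"
        unfolding G_ext using ext_orth_E[OF subspace_span GsE xE x(2) e(2)] .
      moreover have "dim (K \<inter> orth h (G K)) = Suc (dim (ext e K \<inter> orth h (G (ext e K))))"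
        unfolding G_ext ext_radical[OF K(1) x(1,2) G_sup e(2)]
        using dim_ker[OF h findim_orth[OF K], of x "G K" e] x e by auto
      ultimately have "Q (ext e K)"
        using Q dim_G_ext[OF K(2) eG] dim_ext_notin_G[OF K eG] unfolding Q_def by simp
      then show ?thesis using e eG by blast
    next
      case KG: True
      then have eqK: "K \<inter> orth h (G K) = K \<inter> orth h E" using orth_anti[OF h GsE] by blast
      have ipc: "pindex h K \<le> c" "pindex (neg h) K \<le> d" using Q unfolding Q_def eqK by auto
      have ext_le: "dim (ext e K \<inter> orth h (G (ext e K))) \<le> dim (ext e K \<inter> orth h E)"
        if "e \<in> E" "ext e K \<inter> orth h (G (ext e K)) \<subseteq> orth h E" for e
        using that ext_E[OF K(2)] by (intro dim_mono findim_orth sub_orth) auto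
      show ?thesis
      proof (cases "E \<inter> orth h E \<subseteq> G K")
        case False
        \<comment> \<open>A radical vector of \<open>E\<close> changes no index, and the growth of
          \<open>dim (K \<inter> orth h E)\<close> pays for that of
          \<open>dim (G K \<inter> orth h E)\<close>.\<close>
        then obtain e where e: "e \<in> E" "e \<in> orth h E" "e \<notin> G K" by auto
        have perp: "h x e = 0" if "x \<in> E" for x using e that h_sym0[OF h] by (auto simp: orth_def)
        have "pindex h (ext e K) = pindex h K" "pindex (neg h) (ext e K) = pindex (neg h) K"
          using pindex_ext_perp[OF h fK, of e] pindex_ext_perp[OF hform_neg[OF h] fK, of e] perp K e(1)
          by (auto simp: neg_def)
        moreover have "ext e K \<inter> orth h (G (ext e K)) \<subseteq> orth h E"
        proof
          fix y assume y: "y \<in> ext e K \<inter> orth h (G (ext e K))"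
          then obtain b k where k: "k \<in> K" "y = k + b *s e" using ext_iff[OF K(1)] by blast
          have "e \<in> orth h (G K)" using e(2) orth_anti[OF h GsE] by blast
          moreover have "y \<in> orth h (G K)" using y unfolding G_ext orth_ext[OF h] by blast
          ultimately have "k \<in> orth h (G K)"
            using k subspace_diff[OF subspace_orth[OF h] _ subspace_scale[OF subspace_orth[OF h]], of y "G K" e b]
            by simp
          then show "y \<in> orth h E"
            using KG k e subspace_orth[OF h] subspace_add subspace_scale by blast
        qed
        moreover have "dim (G (ext e K) \<inter> orth h E) \<le> Suc (dim (G K \<inter> orth h E))"
        proof -
          have "G (ext e K) \<inter> orth h E \<inter> G K = G K \<inter> orth h E" unfolding G_ext using ext_sup[of "G K" e] by blast
          moreover have "findim (G (ext e K) \<inter> orth h E)"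
            using findim_orth G_sub[OF ext_E[OF K(2) e(1)]] by simp
          ultimately show ?thesis
            using dim_Int_ext[of "G (ext e K) \<inter> orth h E" "G K" e] unfolding G_ext by auto
        qed
        moreover have "Suc (dim (K \<inter> orth h E)) \<le> dim (ext e K \<inter> orth h E)"
        proof -
          have "ext e (K \<inter> orth h E) \<subseteq> ext e K \<inter> orth h E"
            using e ext_sup ext_mem by (intro ext_least sub_orth) auto
          then have "dim (ext e (K \<inter> orth h E)) \<le> dim (ext e K \<inter> orth h E)"
            using findim_orth[OF subspace_span ext_E[OF K(2) e(1)]] by (intro dim_mono) auto
          moreover have "e \<notin> K" using e(3) G_sup by blast
          ultimately show ?thesis using dim_ext[OF findim_orth[OF K, of E], of e] by simp
        qed
        ultimately have "Q (ext e K)"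
          using Q ipc ext_le[OF e(1)] dim_G_ext[OF K(2) e(3)] dim_ext_notin_G[OF K e(3)]
          unfolding Q_def by linarith
        then show ?thesis using e by blast
      next
        case RG: True
        obtain e where e: "e \<in> E" "e \<notin> G K" "pindex h (ext e K) \<le> c" "pindex (neg h) (ext e K) \<le> d"
          "ext e K \<inter> orth h (G (ext e K)) \<subseteq> orth h E"
          using min_step_perp[OF K GE KG RG ipc(1) _ ipc(2)] Q unfolding Q_def by blast
        \<comment> \<open>The radical of \<open>E\<close> is already contained in
          \<open>G K\<close>, so neither intersection with it changes.\<close>
        have "G (ext e K) \<inter> orth h E = G K \<inter> orth h E"
          using RG GsE G_sub[OF ext_E[OF K(2) e(1)]] unfolding G_ext using ext_sup[of "G K" e] by blast
        moreover have "ext e K \<inter> orth h E = K \<inter> orth h E"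
          using RG ext_Int_subset[OF K(1) subspace_span G_sup e(2)] ext_E[OF K(2) e(1)] ext_sup[of K e] by blast
        ultimately have "Q (ext e K)"
          using Q e ext_le[OF e(1,5)] dim_G_ext[OF K(2) e(2)] dim_ext_notin_G[OF K e(2)]
          unfolding Q_def by simp
        then show ?thesis using e by blast
      qed
    qed
  qed
  then show ?thesis unfolding Q_def complement_def by auto
qed

end

section \<open>Matrices as forms\<close>

definition fscale :: "complex \<Rightarrow> (nat \<Rightarrow> complex) \<Rightarrow> nat \<Rightarrow> complex" where
  "fscale c f = (\<lambda>i. c * f i)"

lemma fscale_apply: "fscale c f i = c * f i"
  by (simp add: fscale_def)

lemma complex_space_fscale: "complex_space fscale"
  by unfold_locales (auto simp: fscale_apply fun_eq_iff algebra_simps)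

interpretation fn: complex_space fscale by (rule complex_space_fscale)

text \<open>Vectors of varying length are sequences supported on an initial segment, so that they share one type.\<close>

definition fspace :: "nat \<Rightarrow> (nat \<Rightarrow> complex) set" where
  "fspace N = {x. \<forall>i\<ge>N. x i = 0}"

definition dot :: "nat \<Rightarrow> (nat \<Rightarrow> complex) \<Rightarrow> (nat \<Rightarrow> complex) \<Rightarrow> complex" where
  "dot N x y = (\<Sum>i<N. x i * cnj (y i))"

definition mv :: "complex mat \<Rightarrow> (nat \<Rightarrow> complex) \<Rightarrow> nat \<Rightarrow> complex" where
  "mv A x = (\<lambda>i. if i < dim_row A then \<Sum>j<dim_col A. A $$ (i,j) * x j else 0)"

text \<open>The product of the adjoint of \<open>y\<close> with \<open>H x\<close>, linear in the
  first argument as \<open>hform\<close> requires.\<close>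

definition mform :: "complex mat \<Rightarrow> (nat \<Rightarrow> complex) \<Rightarrow> (nat \<Rightarrow> complex) \<Rightarrow> complex" where
  "mform H x y = dot (dim_row H) (mv H x) y"

text \<open>\<open>trunc n\<close> and \<open>shift n\<close> extract the two blocks of a vector of
  C^n \<oplus> C^m, and \<open>join n\<close> puts blocks together.\<close>

definition trunc :: "nat \<Rightarrow> (nat \<Rightarrow> complex) \<Rightarrow> nat \<Rightarrow> complex" where
  "trunc n x = (\<lambda>i. if i < n then x i else 0)"

definition shift :: "nat \<Rightarrow> (nat \<Rightarrow> complex) \<Rightarrow> nat \<Rightarrow> complex" where
  "shift n x = (\<lambda>i. x (n + i))"

definition join :: "nat \<Rightarrow> (nat \<Rightarrow> complex) \<Rightarrow> (nat \<Rightarrow> complex) \<Rightarrow> nat \<Rightarrow> complex" where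
  "join n x y = (\<lambda>i. if i < n then x i else y (i - n))"

lemma subspace_fspace: "fn.subspace (fspace N)"
  by (rule fn.subspaceI) (auto simp: fspace_def fscale_apply)

lemmas fspace_add = fn.subspace_add[OF subspace_fspace]
  and fspace_diff = fn.subspace_diff[OF subspace_fspace]
  and fspace_scale = fn.subspace_scale[OF subspace_fspace]
  and fspace_0 = fn.subspace_0[OF subspace_fspace]

lemma fspace_Suc: "fspace (Suc N) = fn.ext (\<lambda>i. if i = N then 1 else 0) (fspace N)"
  (is "_ = fn.ext ?e _")
proof (intro Set.set_eqI iffI)
  fix x assume x: "x \<in> fspace (Suc N)"
  have "x = trunc N x + fscale (x N) (\<lambda>i. if i = N then 1 else 0)"
    using x by (auto simp: fun_eq_iff trunc_def fspace_def fscale_apply)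
  moreover have "trunc N x \<in> fspace N" by (auto simp: trunc_def fspace_def)
  ultimately show "x \<in> fn.ext (\<lambda>i. if i = N then 1 else 0) (fspace N)"
    unfolding fn.ext_iff[OF subspace_fspace] by blast
next
  fix x assume "x \<in> fn.ext (\<lambda>i. if i = N then 1 else 0) (fspace N)"
  then show "x \<in> fspace (Suc N)"
    unfolding fn.ext_iff[OF subspace_fspace] by (auto simp: fspace_def fscale_apply)
qed

lemma findim_fspace: "fn.findim (fspace N)" and dim_fspace: "fn.dim (fspace N) = N"
proof -
  have "fn.findim (fspace N) \<and> fn.dim (fspace N) = N"
  proof (induction N)
    case 0
    have "fspace 0 = {0}" by (auto simp: fspace_def fun_eq_iff)
    then show ?case using fn.findim_zero fn.dim_zero by simp
  next
    case (Suc N)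
    have "(\<lambda>i. if i = N then 1 else 0) \<notin> fspace N" by (auto simp: fspace_def)
    then show ?case unfolding fspace_Suc using Suc fn.dim_ext fn.findim_ext by simp
  qed
  then show "fn.findim (fspace N)" "fn.dim (fspace N) = N" by auto
qed

lemma trunc_fspace: "trunc n x \<in> fspace n" by (simp add: trunc_def fspace_def)

lemma trunc_id: "x \<in> fspace n \<Longrightarrow> trunc n x = x" by (auto simp: trunc_def fspace_def fun_eq_iff)

lemma fspace_mono: "n \<le> N \<Longrightarrow> fspace n \<subseteq> fspace N" by (auto simp: fspace_def)

lemma mv_fspace: "mv A x \<in> fspace (dim_row A)" by (simp add: mv_def fspace_def)

lemma mv_add: "mv A (x + y) = mv A x + mv A y"
  by (auto simp: mv_def fun_eq_iff algebra_simps sum.distrib)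

lemma mv_scale: "mv A (fscale c x) = fscale c (mv A x)"
  by (auto simp: mv_def fun_eq_iff fscale_apply algebra_simps sum_distrib_left)

lemma mv_cong: "(\<And>j. j < dim_col A \<Longrightarrow> x j = y j) \<Longrightarrow> mv A x = mv A y"
  by (auto simp: mv_def fun_eq_iff)

lemma mv_0: "mv A 0 = 0"
  by (auto simp: mv_def fun_eq_iff)

lemma mv_mult:
  assumes "dim_col A = dim_row B" shows "mv (A * B) x = mv A (mv B x)"
proof
  fix i
  show "mv (A * B) x i = mv A (mv B x) i"
  proof (cases "i < dim_row A")
    case True
    have "(\<Sum>j<dim_col B. (A * B) $$ (i,j) * x j)
        = (\<Sum>j<dim_col B. \<Sum>k<dim_row B. A $$ (i,k) * B $$ (k,j) * x j)"
      using True assms by (auto simp: scalar_prod_def sum_distrib_right atLeast0LessThan intro!: sum.cong)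
    also have "\<dots> = (\<Sum>k<dim_row B. \<Sum>j<dim_col B. A $$ (i,k) * B $$ (k,j) * x j)"
      by (rule sum.swap)
    finally show ?thesis using True assms by (simp add: mv_def sum_distrib_left mult.assoc)
  qed (simp add: mv_def)
qed

lemma mv_add_mat:
  assumes "dim_row A = dim_row B" "dim_col A = dim_col B" shows "mv (A + B) x = mv A x + mv B x"
  using assms by (auto simp: mv_def fun_eq_iff algebra_simps sum.distrib)

lemma dim_adjoint [simp]: "dim_row (mat_adjoint A) = dim_col A" "dim_col (mat_adjoint A) = dim_row A"
  by (auto simp: mat_adjoint_def)

lemma adjoint_carrier [simp]: "A \<in> carrier_mat r c \<Longrightarrow> mat_adjoint A \<in> carrier_mat c r"
  by (intro carrier_matI) simp_all

lemma adjoint_index [simp]: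
  fixes A :: "complex mat"
  shows "i < dim_col A \<Longrightarrow> j < dim_row A \<Longrightarrow> mat_adjoint A $$ (i,j) = cnj (A $$ (j,i))"
  unfolding mat_adjoint_def by (subst mat_of_rows_index) (auto simp: conjugate_complex_def)

lemma adjoint_adjoint: fixes A :: "complex mat" shows "mat_adjoint (mat_adjoint A) = A"
  by (rule eq_matI) auto

lemma adjoint_mult:
  fixes A B :: "complex mat"
  assumes "dim_col A = dim_row B" shows "mat_adjoint (A * B) = mat_adjoint B * mat_adjoint A"
  using assms by (intro eq_matI) (auto simp: scalar_prod_def mult.commute intro!: sum.cong)

lemma adjoint_add:
  fixes A B :: "complex mat"
  assumes "dim_row A = dim_row B" "dim_col A = dim_col B"
  shows "mat_adjoint (A + B) = mat_adjoint A + mat_adjoint B"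
  using assms by (intro eq_matI) auto

lemma adjoint_four_block:
  fixes A B C D :: "complex mat"
  assumes "A \<in> carrier_mat r1 c1" "B \<in> carrier_mat r1 c2" "C \<in> carrier_mat r2 c1" "D \<in> carrier_mat r2 c2"
  shows "mat_adjoint (four_block_mat A B C D)
    = four_block_mat (mat_adjoint A) (mat_adjoint C) (mat_adjoint B) (mat_adjoint D)"
  using assms by (intro eq_matI) auto

lemma adjoint_zero: "mat_adjoint (0\<^sub>m r c) = (0\<^sub>m c r :: complex mat)"
  by (intro eq_matI) auto

lemma dot_sym: "dot N y x = cnj (dot N x y)"
  by (simp add: dot_def mult.commute)

lemma dot_add1: "dot N (x + y) z = dot N x z + dot N y z"
  by (simp add: dot_def algebra_simps sum.distrib)

lemma dot_add2: "dot N z (x + y) = dot N z x + dot N z y"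
  by (simp add: dot_def algebra_simps sum.distrib)

lemma dot_scale1: "dot N (fscale c x) y = c * dot N x y"
  by (simp add: dot_def fscale_apply algebra_simps sum_distrib_left)

lemma dot_cong: "(\<And>i. i < N \<Longrightarrow> x i = x' i) \<Longrightarrow> (\<And>i. i < N \<Longrightarrow> y i = y' i) \<Longrightarrow> dot N x y = dot N x' y'"
  by (simp add: dot_def)

lemma hform_dot: "fn.hform (dot N)"
  by (rule fn.hformI) (rule dot_add1 dot_scale1 dot_sym)+

lemma dot_self: "dot N x x = of_real (\<Sum>i<N. (cmod (x i))\<^sup>2)"
  by (simp add: dot_def complex_norm_square del: of_real_power)

lemma dot_pos: assumes "x \<in> fspace N" "x \<noteq> 0" shows "Re (dot N x x) > 0"
proof -
  obtain i where "x i \<noteq> 0" using assms by (auto simp: fun_eq_iff)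
  then have "i < N" using assms by (auto simp: fspace_def not_le[symmetric])
  have "0 < (cmod (x i))\<^sup>2" using \<open>x i \<noteq> 0\<close> by simp
  also have "\<dots> \<le> (\<Sum>i<N. (cmod (x i))\<^sup>2)" using \<open>i < N\<close> by (intro member_le_sum) auto
  finally show ?thesis unfolding dot_self by simp
qed

lemma dot_adjoint:
  assumes "A \<in> carrier_mat r c" shows "dot r (mv A x) y = dot c x (mv (mat_adjoint A) y)"
proof -
  have "dot r (mv A x) y = (\<Sum>i<r. \<Sum>j<c. A $$ (i,j) * x j * cnj (y i))"
    using assms by (auto simp: dot_def mv_def sum_distrib_right intro!: sum.cong)
  also have "\<dots> = (\<Sum>j<c. \<Sum>i<r. A $$ (i,j) * x j * cnj (y i))" by (rule sum.swap)
  also have "\<dots> = dot c x (mv (mat_adjoint A) y)"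
    using assms by (auto simp: dot_def mv_def sum_distrib_left intro!: sum.cong)
  finally show ?thesis .
qed

lemma hform_mform: assumes "hermitian H" shows "fn.hform (mform H)"
proof (rule fn.hformI)
  have H: "H \<in> carrier_mat (dim_row H) (dim_row H)" "mat_adjoint H = H"
    using assms by (auto simp: hermitian_def)
  show "mform H y x = cnj (mform H x y)" for x y
    unfolding mform_def using dot_adjoint[OF H(1)] H(2) dot_sym by metis
qed (auto simp: mform_def mv_add dot_add1 mv_scale dot_scale1)

lemma posdef_dot: "fn.posdef (dot N) (fspace N)"
  unfolding fn.posdef_def using dot_pos by blast

lemma mv_four_block:
  assumes "A \<in> carrier_mat r1 c1" "B \<in> carrier_mat r1 c2" "C \<in> carrier_mat r2 c1" "D \<in> carrier_mat r2 c2"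
  shows "mv (four_block_mat A B C D) x
    = join r1 (mv A x + mv B (shift c1 x)) (mv C x + mv D (shift c1 x))"
proof
  fix i
  let ?M = "four_block_mat A B C D"
  have split: "(\<Sum>j<c1 + c2. f j) = (\<Sum>j<c1. f j) + (\<Sum>j<c2. f (c1 + j))" for f :: "nat \<Rightarrow> complex"
    by (induction c2) (auto simp: add.assoc)
  have dims: "dim_row ?M = r1 + r2" "dim_col ?M = c1 + c2" using assms by auto
  have "mv ?M x i = (if i < r1 + r2 then (\<Sum>j<c1. ?M $$ (i,j) * x j) + (\<Sum>j<c2. ?M $$ (i,c1+j) * x (c1 + j)) else 0)"
    unfolding mv_def dims split by simp
  also have "\<dots> = join r1 (mv A x + mv B (shift c1 x)) (mv C x + mv D (shift c1 x)) i"
    using assms by (auto simp: join_def mv_def shift_def)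
  finally show "mv ?M x i = join r1 (mv A x + mv B (shift c1 x)) (mv C x + mv D (shift c1 x)) i" .
qed

lemma join_0: "x \<in> fspace n \<Longrightarrow> join n x y = 0 \<longleftrightarrow> x = 0 \<and> y = 0"
proof
  assume x: "x \<in> fspace n" and j: "join n x y = 0"
  have "x i = 0" for i using fun_cong[OF j, of i] x by (cases "i < n") (auto simp: join_def fspace_def)
  moreover have "y i = 0" for i using fun_cong[OF j, of "n + i"] by (auto simp: join_def)
  ultimately show "x = 0 \<and> y = 0" by (auto simp: fun_eq_iff)
qed (auto simp: join_def fun_eq_iff)

lemma dot_join: "dot (n + m) (join n x y) z = dot n x z + dot m y (shift n z)"
proof -
  have split: "(\<Sum>j<n + m. f j) = (\<Sum>j<n. f j) + (\<Sum>j<m. f (n + j))" for f :: "nat \<Rightarrow> complex"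
    by (induction m) (auto simp: add.assoc)
  show ?thesis unfolding dot_def split by (simp add: join_def shift_def)
qed

lemma hcat_carrier: "U \<in> carrier_mat r c \<Longrightarrow> V \<in> carrier_mat r d \<Longrightarrow> hcat U V \<in> carrier_mat r (c + d)"
  by (auto simp: hcat_def)

lemma mv_adjoint_hcat:
  assumes "U \<in> carrier_mat r c" "V \<in> carrier_mat r d"
  shows "mv (mat_adjoint (hcat U V)) x = join c (mv (mat_adjoint U) x) (mv (mat_adjoint V) x)"
  using assms hcat_carrier[OF assms] by (auto simp: fun_eq_iff mv_def join_def hcat_def)

section \<open>Column spaces, left kernels and rank\<close>

definition col_space :: "complex mat \<Rightarrow> (nat \<Rightarrow> complex) set" where
  "col_space A = mv A ` fspace (dim_col A)"

definition adj_ker :: "complex mat \<Rightarrow> (nat \<Rightarrow> complex) set" where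
  "adj_ker A = {u \<in> fspace (dim_row A). mv (mat_adjoint A) u = 0}"

lemma col_space_props:
  "fn.findim (col_space A)" "dim_col A = fn.dim (col_space A) + fn.dim {x \<in> fspace (dim_col A). mv A x = 0}"
  "col_space A \<subseteq> fspace (dim_row A)"
  using fn.rank_nullity[OF findim_fspace[of "dim_col A"], of "mv A"] mv_add mv_scale dim_fspace mv_fspace
  unfolding col_space_def by auto

text \<open>If \<open>u\<close> is orthogonal to the column space, pairing it with the image of
  \<open>mv (mat_adjoint A) u\<close> under \<open>A\<close> gives the squared norm of that vector,
  which is therefore zero.\<close>

lemma adj_ker_orth: "adj_ker A = fspace (dim_row A) \<inter> fn.orth (dot (dim_row A)) (col_space A)"
proof -
  have A: "A \<in> carrier_mat (dim_row A) (dim_col A)" by auto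
  have eq: "dot (dim_row A) u (mv A x) = dot (dim_col A) (mv (mat_adjoint A) u) x" for u x
    using dot_adjoint[OF adjoint_carrier[OF A], of u x] by (simp add: adjoint_adjoint)
  have "mv (mat_adjoint A) u = 0" if "\<forall>x\<in>fspace (dim_col A). dot (dim_row A) u (mv A x) = 0" for u
  proof (rule ccontr)
    assume "mv (mat_adjoint A) u \<noteq> 0"
    moreover have "mv (mat_adjoint A) u \<in> fspace (dim_col A)" using mv_fspace[of "mat_adjoint A"] by simp
    ultimately show False using dot_pos[of "mv (mat_adjoint A) u" "dim_col A"] that eq by fastforce
  qed
  moreover have "dot (dim_row A) u (mv A x) = 0" if "mv (mat_adjoint A) u = 0" for u x
    unfolding eq that by (simp add: dot_def)
  ultimately show ?thesis unfolding adj_ker_def col_space_def by (auto simp: fn.orth_def)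
qed

lemma rank_adj_ker: "dim_row A = fn.dim (adj_ker A) + fn.dim (col_space A)"
  unfolding adj_ker_orth
  using fn.dim_orth_posdef[OF hform_dot findim_fspace fn.findim_subspace[OF col_space_props(1)] col_space_props(3)
      fn.posdef_subset[OF posdef_dot col_space_props(3)]] dim_fspace by simp

definition to_fun :: "complex vec \<Rightarrow> nat \<Rightarrow> complex" where
  "to_fun v = (\<lambda>i. if i < dim_vec v then v $ i else 0)"

lemma sum_fun_apply: "(\<Sum>x\<in>A. f x) i = (\<Sum>x\<in>A. f x i :: complex)"
  by (induction A rule: infinite_finite_induct) auto

lemma inj_to_fun: "inj_on to_fun (carrier_vec r)"
proof (rule inj_onI)
  fix x y assume xy: "x \<in> carrier_vec r" "y \<in> carrier_vec r" "to_fun x = to_fun y"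
  then show "x = y"
    by (intro eq_vecI) (auto simp: to_fun_def dest: fun_cong split: if_splits)
qed

lemma to_fun_lincomb:
  assumes "A \<subseteq> carrier_vec r"
  shows "module.lincomb (module_vec TYPE(complex) r) a A = 0\<^sub>v r
    \<longleftrightarrow> (\<Sum>v\<in>A. fscale (a v) (to_fun v)) = 0"
proof -
  interpret V: vec_space "TYPE(complex)" r .
  have *: "(\<Sum>v\<in>A. fscale (a v) (to_fun v)) i = (if i < r then V.lincomb a A $ i else 0)" for i
    using assms V.lincomb_index[of i A a]
    by (auto simp: sum_fun_apply fscale_apply to_fun_def intro!: sum.cong sum.neutral)
  have d: "V.lincomb a A \<in> carrier_vec r" using V.lincomb_closed[of A a] assms by auto
  show ?thesis
  proof
    assume "V.lincomb a A = 0\<^sub>v r"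
    then show "(\<Sum>v\<in>A. fscale (a v) (to_fun v)) = 0" using * by (auto simp: fun_eq_iff)
  next
    assume 0: "(\<Sum>v\<in>A. fscale (a v) (to_fun v)) = 0"
    have "V.lincomb a A $ i = 0" if "i < r" for i using *[of i] 0 that by simp
    then show "V.lincomb a A = 0\<^sub>v r" using d by (intro eq_vecI) auto
  qed
qed

text \<open>Transfers linear independence between vectors of fixed length and sequences, so that the
  matrix rank can be compared with \<open>fn.dim\<close>.\<close>

lemma independent_to_fun:
  assumes A: "finite A" "A \<subseteq> carrier_vec r"
  shows "module.lin_dep class_ring (module_vec TYPE(complex) r) A \<longleftrightarrow> fn.dependent (to_fun ` A)"
proof -
  interpret V: vec_space "TYPE(complex)" r .
  have inj: "inj_on to_fun A" using inj_to_fun A inj_on_subset by blast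
  show ?thesis
  proof
    assume "V.lin_dep A"
    then obtain a v where a: "V.lincomb a A = 0\<^sub>v r" "v \<in> A" "a v \<noteq> 0"
      using V.finite_lin_dep[OF A(1)] A(2) by (auto simp: class_field_def)
    define u where "u = a \<circ> the_inv_into A to_fun"
    have u: "u (to_fun x) = a x" if "x \<in> A" for x
      unfolding u_def using the_inv_into_f_f[OF inj that] by simp
    have "(\<Sum>x\<in>to_fun ` A. fscale (u x) x) = (\<Sum>x\<in>A. fscale (a x) (to_fun x))"
      unfolding sum.reindex[OF inj] using u by (intro sum.cong) auto
    then have "(\<Sum>x\<in>to_fun ` A. fscale (u x) x) = 0"
      using a(1) to_fun_lincomb[OF A(2)] by simp
    moreover have "to_fun v \<in> to_fun ` A" "u (to_fun v) \<noteq> 0" using a(2,3) u by auto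
    ultimately show "fn.dependent (to_fun ` A)"
      unfolding fn.dependent_finite[OF finite_imageI[OF A(1)], of to_fun] by blast
  next
    assume "fn.dependent (to_fun ` A)"
    then obtain u v where u: "v \<in> A" "u (to_fun v) \<noteq> 0" "(\<Sum>x\<in>to_fun ` A. fscale (u x) x) = 0"
      using fn.dependent_finite[of "to_fun ` A"] A(1) by auto
    then have "(\<Sum>x\<in>A. fscale (u (to_fun x)) (to_fun x)) = 0"
      unfolding sum.reindex[OF inj] by simp
    then have "V.lincomb (\<lambda>x. u (to_fun x)) A = 0\<^sub>v r" using to_fun_lincomb[OF A(2)] by simp
    then show "V.lin_dep A"
      using V.lin_dep_crit[where A = A and S = A and a = "\<lambda>x. u (to_fun x)" and v = v] A u
      by (auto simp: class_field_def)
  qed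
qed

lemma col_space_span: "col_space M = fn.span (to_fun ` set (cols M))"
proof
  have col: "to_fun (col M j) = mv M (\<lambda>i. if i = j then 1 else 0)" if "j < dim_col M" for j
    using that by (auto simp: to_fun_def mv_def fun_eq_iff if_distrib cong: if_cong)
  have "to_fun ` set (cols M) \<subseteq> col_space M"
    unfolding col_space_def using col by (auto simp: cols_def fspace_def)
  then show "fn.span (to_fun ` set (cols M)) \<subseteq> col_space M"
    using fn.span_minimal fn.findim_subspace[OF col_space_props(1)] by blast
  show "col_space M \<subseteq> fn.span (to_fun ` set (cols M))"
  proof
    fix y assume "y \<in> col_space M"
    then obtain x where "y = mv M x" unfolding col_space_def by auto
    then have "y = (\<Sum>j<dim_col M. fscale (x j) (to_fun (col M j)))"
      by (auto simp: fun_eq_iff sum_fun_apply mv_def fscale_apply to_fun_def mult.commute)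
    also have "\<dots> \<in> fn.span (to_fun ` set (cols M))"
    proof (intro fn.span_sum fn.span_scale fn.span_base imageI)
      fix j assume "j \<in> {..<dim_col M}"
      then show "col M j \<in> set (cols M)" by (simp add: cols_def)
    qed
    finally show "y \<in> fn.span (to_fun ` set (cols M))" .
  qed
qed

text \<open>The matrix rank is the size of a maximal independent set \<open>U\<close> of columns.
  Maximality puts every other column into the span of \<open>U\<close>, so the image of
  \<open>U\<close> is a basis of the column space.\<close>

lemma mrank_col_space: "mrank M = fn.dim (col_space M)"
proof -
  define r where "r = dim_row M"
  interpret V: vec_space "TYPE(complex)" r .
  let ?S = "set (cols M)"
  have S: "?S \<subseteq> carrier_vec r" unfolding r_def using cols_dim by blast
  have M: "M \<in> carrier_mat r (dim_col M)" unfolding r_def by auto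
  have "V.lin_indpt {}" using independent_to_fun[of "{}" r] fn.independent_empty by simp
  then obtain U where U: "finite U" "maximal U (\<lambda>T. T \<subseteq> ?S \<and> V.lin_indpt T)"
    using maximal_exists_superset[of ?S "\<lambda>T. T \<subseteq> ?S \<and> V.lin_indpt T" "{}"] by auto
  then have US: "U \<subseteq> ?S" "V.lin_indpt U" unfolding maximal_def by auto
  have Uc: "U \<subseteq> carrier_vec r" using US S by auto
  have ind: "fn.independent (to_fun ` U)" using independent_to_fun[OF U(1) Uc] US(2) by blast
  have "to_fun ` ?S \<subseteq> fn.span (to_fun ` U)"
  proof
    fix y assume "y \<in> to_fun ` ?S"
    then obtain s where s: "s \<in> ?S" "y = to_fun s" by auto
    show "y \<in> fn.span (to_fun ` U)"
    proof (rule ccontr)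
      assume n: "y \<notin> fn.span (to_fun ` U)"
      then have "fn.independent (to_fun ` insert s U)" using fn.independent_insertI ind s by simp
      then have "V.lin_indpt (insert s U)"
        using independent_to_fun[of "insert s U" r] U(1) Uc S s by auto
      then have "insert s U = U" using U(2) US s unfolding maximal_def by blast
      then have "y \<in> to_fun ` U" using s by auto
      then show False using n fn.span_base by blast
    qed
  qed
  moreover have "to_fun ` U \<subseteq> fn.span (to_fun ` ?S)" using US(1) fn.span_superset by blast
  ultimately have "fn.span (to_fun ` ?S) = fn.span (to_fun ` U)" by (simp add: fn.span_eq)
  then have "fn.dim (col_space M) = card (to_fun ` U)"
    unfolding col_space_span using fn.dim_span_eq_card_independent[OF ind] by simp
  also have "\<dots> = card U" using card_image inj_on_subset[OF inj_to_fun Uc] by blast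
  also have "\<dots> = V.rank M" using V.rank_card_indpt[OF M U(2)] by simp
  finally show ?thesis unfolding mrank_def r_def by simp
qed

text \<open>The ranks of the block matrices are computed in this form, by identifying their left
  kernels.\<close>

lemma mrank_adj_ker: "mrank A + fn.dim (adj_ker A) = dim_row A"
  using rank_adj_ker[of A] mrank_col_space[of A] by simp

section \<open>Eigenvalue counts as indices of the form\<close>

lemma order_prod_list_linear: "order c (\<Prod>a\<leftarrow>as. [:- a, 1:]) = count_list as c" for c :: complex
proof (induction as)
  case Nil then show ?case by (simp add: order_0I)
next
  case (Cons a as)
  have nz: "(\<Prod>a\<leftarrow>as. [:- a, 1:]) \<noteq> (0 :: complex poly)"
    by (induction as) (simp_all del: mult_pCons_left)
  have "order c [:- a, 1:] = (if a = c then 1 else 0)"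
    using order_power_n_n[of a 1] by (auto intro: order_0I)
  moreover have "order c ([:- a, 1:] * (\<Prod>a\<leftarrow>as. [:- a, 1:]))
      = order c [:- a, 1:] + order c (\<Prod>a\<leftarrow>as. [:- a, 1:])"
    using nz by (intro order_mult) (simp del: mult_pCons_left)
  ultimately show ?case using Cons by (simp del: mult_pCons_left)
qed

text \<open>In a list of the roots with repetition each \<open>c\<close> occurs as often as its
  order, so summing orders counts positions.\<close>

lemma sum_order_eigenvalues:
  fixes H :: "complex mat"
  assumes H: "H \<in> carrier_mat N N" and cp: "char_poly H = (\<Prod>a\<leftarrow>as. [:- a, 1:])"
  shows "(\<Sum>c\<in>{c. eigenvalue H c \<and> P c}. order c (char_poly H)) = card {i. i < length as \<and> P (as ! i)}"
proof -
  have "poly (\<Prod>a\<leftarrow>as. [:- a, 1:]) c = 0 \<longleftrightarrow> c \<in> set as" for c :: complex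
    by (induction as) auto
  then have "{c. eigenvalue H c \<and> P c} = set (filter P as)"
    using eigenvalue_root_char_poly[OF H] cp by auto
  moreover have "count_list (filter P as) c = count_list as c" if "P c" for c
    using that by (induction as) auto
  ultimately have "(\<Sum>c\<in>{c. eigenvalue H c \<and> P c}. order c (char_poly H))
      = (\<Sum>c\<in>set (filter P as). count_list (filter P as) c)"
    unfolding cp order_prod_list_linear by (intro sum.cong) auto
  also have "\<dots> = length (filter P as)" by (rule sum_count_set) auto
  finally show ?thesis by (simp add: length_filter_conv_card)
qed

text \<open>
  The columns of \<open>P\<close> span an \<open>H\<close>-invariant flag \<open>mv P ` fspace k\<close>. Orthogonalizing the \<open>k\<close>-th column against the
  previous ones turns it into a vector that is orthogonal to the flag also with respect to \<open>H\<close>.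
\<close>

lemma inertia_triangular:
  assumes H: "hermitian H" "dim_row H = N"
    and P: "P \<in> carrier_mat N N" and Q: "Q \<in> carrier_mat N N" and B: "B \<in> carrier_mat N N"
    and ut: "upper_triangular B" and QP: "Q * P = 1\<^sub>m N" and HP: "H * P = P * B"
    and "k \<le> N"
  shows "fn.pindex (mform H) (mv P ` fspace k) = card {i. i < k \<and> Re (B $$ (i,i)) > 0}
    \<and> fn.pindex (fn.neg (mform H)) (mv P ` fspace k) = card {i. i < k \<and> Re (B $$ (i,i)) < 0}
    \<and> (\<forall>i<k. B $$ (i,i) \<in> \<real>)"
  using \<open>k \<le> N\<close>
proof (induction k)
  case 0
  have "fspace 0 = {0}" by (auto simp: fspace_def fun_eq_iff)
  then have "mv P ` fspace 0 = {0}" by (simp add: mv_0)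
  then show ?case using fn.pindex_zero by simp
next
  case (Suc k)
  note hH = hform_mform[OF H(1)]
  define U where "U = mv P ` fspace k"
  define e where "e = (\<lambda>i. if i = k then 1 else 0 :: complex)"
  define w where "w = mv P e"
  define lam where "lam = B $$ (k,k)"
  have k: "k < N" using Suc by simp
  have dimc: "dim_col P = N" "dim_row P = N" "dim_col H = N" using P H by (auto simp: hermitian_def)
  have fU: "fn.findim U" "U \<subseteq> fspace N"
  proof -
    show "fn.findim U" unfolding U_def
      using fn.rank_nullity[OF findim_fspace, of "mv P" k] mv_add mv_scale by blast
    show "U \<subseteq> fspace N" unfolding U_def using mv_fspace[of P] dimc by auto
  qed
  have sU: "fn.subspace U" using fU fn.findim_subspace by blast
  have ext: "mv P ` fspace (Suc k) = fn.ext w U"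
  proof (intro Set.set_eqI iffI)
    fix y assume "y \<in> mv P ` fspace (Suc k)"
    then obtain x where "x \<in> fspace (Suc k)" "y = mv P x" by auto
    then obtain c s where "s \<in> fspace k" "y = mv P (s + fscale c e)"
      unfolding fspace_Suc fn.ext_iff[OF subspace_fspace] e_def by auto
    then show "y \<in> fn.ext w U" unfolding fn.ext_iff[OF sU] unfolding U_def w_def
      by (auto simp: mv_add mv_scale)
  next
    fix y assume "y \<in> fn.ext w U"
    then obtain c s where "s \<in> fspace k" "y = mv P s + fscale c w"
      unfolding fn.ext_iff[OF sU] unfolding U_def by auto
    then have "y = mv P (s + fscale c e)" "s + fscale c e \<in> fspace (Suc k)"
      unfolding w_def fspace_Suc fn.ext_iff[OF subspace_fspace] e_def by (auto simp: mv_add mv_scale)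
    then show "y \<in> mv P ` fspace (Suc k)" by auto
  qed
  have HPx: "mv H (mv P x) = mv P (mv B x)" for x
    using mv_mult[of H P x] mv_mult[of P B x] HP dimc B by auto
  \<comment> \<open>Upper triangularity makes the first \<open>k\<close> coordinates invariant under
    \<open>B\<close>; transported by \<open>P\<close> this is the invariance of \<open>U\<close>
    under \<open>H\<close>.\<close>
  have Bk: "mv B x \<in> fspace k" if "x \<in> fspace k" for x
  proof -
    have "(\<Sum>j<N. B $$ (i,j) * x j) = 0" if "i \<ge> k" "i < N" for i
    proof (intro sum.neutral ballI)
      fix j assume "j \<in> {..<N}"
      show "B $$ (i,j) * x j = 0"
      proof (cases "j < i")
        case True then show ?thesis using upper_triangularD[OF ut True] B that by simp
      next
        case False then show ?thesis using \<open>x \<in> fspace k\<close> that by (simp add: fspace_def)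
      qed
    qed
    then show ?thesis using B by (auto simp: mv_def fspace_def)
  qed
  have HU: "mv H x \<in> U" if "x \<in> U" for x using that HPx Bk unfolding U_def by auto
  \<comment> \<open>\<open>e\<close> is an eigenvector of \<open>B\<close> modulo the first
    \<open>k\<close> coordinates, with the diagonal entry as eigenvalue.\<close>
  have Be: "mv B e - fscale lam e \<in> fspace k"
  proof -
    have "mv B e i = (if i < N then B $$ (i,k) else 0)" for i
      unfolding mv_def e_def using B k by (auto simp: if_distrib cong: if_cong)
    then show ?thesis
      using upper_triangularD[OF ut, of k] B k unfolding fspace_def lam_def e_def
      by (auto simp: fscale_apply)
  qed
  have mv_diff: "mv A (x - y) = mv A x - mv A y" for A x y
    using mv_add[of A "x - y" y] by (simp add: algebra_simps)
  have Hw: "mv H w - fscale lam w \<in> U"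
  proof -
    have "mv H w - fscale lam w = mv P (mv B e - fscale lam e)"
      unfolding w_def HPx mv_diff mv_scale ..
    then show ?thesis unfolding U_def using Be by auto
  qed
  have wU: "w \<notin> U"
  proof
    assume "w \<in> U"
    then obtain x where x: "x \<in> fspace k" "mv P e = mv P x" unfolding w_def U_def by auto
    have one: "mv Q (mv P y) = y" if "y \<in> fspace N" for y
    proof -
      have "mv Q (mv P y) = mv (1\<^sub>m N) y" using mv_mult[of Q P y] QP Q P by auto
      also have "\<dots> = y" using that
        by (auto simp: mv_def fun_eq_iff fspace_def one_mat_def if_distrib[of "\<lambda>a. a * _"] cong: if_cong)
      finally show ?thesis .
    qed
    have "e \<in> fspace N" "x \<in> fspace N" using k x unfolding e_def by (auto simp: fspace_def)
    then have "e = x" using one x(2) by metis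
    then show False using x(1) unfolding e_def fspace_def by auto
  qed
  have pU: "fn.posdef (dot N) U" using fn.posdef_subset[OF posdef_dot fU(2)] .
  obtain u where u: "u \<in> U" "\<And>x. x \<in> U \<Longrightarrow> dot N x (w - u) = 0"
    using fn.posdef_project[OF hform_dot fU(1) pU] by metis
  define f where "f = w - u"
  have fne: "f \<noteq> 0" using wU u unfolding f_def by auto
  have "w \<in> fspace N" unfolding w_def using mv_fspace[of P e] dimc by simp
  moreover have "u \<in> fspace N" using u(1) fU(2) by (rule subsetD[rotated])
  ultimately have fN: "f \<in> fspace N"
    unfolding f_def by (intro fspace_diff)
  have extf: "fn.ext w U = fn.ext f U" unfolding f_def using fn.ext_shift[OF sU u(1)] by simp
  \<comment> \<open>Since \<open>H\<close> maps \<open>U\<close> into itself, orthogonality for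
    \<open>dot\<close> gives orthogonality for the form of \<open>H\<close>.\<close>
  have perp: "mform H x f = 0" if "x \<in> U" for x
    unfolding mform_def H(2) using u(2)[OF HU[OF that]] f_def by simp
  have "mv H f - fscale lam f \<in> U"
  proof -
    have "mv H f - fscale lam f = (mv H w - fscale lam w) - mv H u + fscale lam u"
      unfolding f_def mv_diff by (auto simp: fun_eq_iff fscale_apply algebra_simps)
    also have "\<dots> \<in> U"
      by (intro fn.subspace_add[OF sU] fn.subspace_diff[OF sU] fn.subspace_scale[OF sU] Hw HU u(1))
    finally show ?thesis .
  qed
  then have "dot N (mv H f - fscale lam f) f = 0" unfolding f_def by (rule u(2))
  \<comment> \<open>\<open>H f\<close> equals \<open>lam f\<close> up to an element of
    \<open>U\<close>, to which \<open>f\<close> is orthogonal. As both forms are real on the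
    diagonal and \<open>dot N f f\<close> is positive, \<open>lam\<close> is real and carries the
    sign of the form at \<open>f\<close>.\<close>
  then have hff: "mform H f f = lam * dot N f f"
    unfolding mform_def H(2) using fn.h_diff1[OF hform_dot] dot_scale1 by simp
  have pos: "Re (dot N f f) > 0" and im: "Im (dot N f f) = 0"
    using dot_pos[OF fN fne] fn.h_self_real[OF hform_dot] by auto
  then have re: "Re (mform H f f) = Re lam * Re (dot N f f)" unfolding hff by simp
  have "Im lam * Re (dot N f f) = 0" using fn.h_self_real[OF hH, of f] im unfolding hff by simp
  then have lamR: "lam \<in> \<real>" using pos by (simp add: complex_is_Real_iff)
  have sgn: "Re (mform H f f) > 0 \<longleftrightarrow> Re lam > 0" "Re (mform H f f) < 0 \<longleftrightarrow> Re lam < 0"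
    unfolding re using pos by (auto simp: zero_less_mult_iff mult_less_0_iff)
  have "fn.pindex (mform H) (fn.ext f U) = (if Re lam > 0 then Suc (fn.pindex (mform H) U) else fn.pindex (mform H) U)"
    using fn.pindex_ext_perp[OF hH fU(1) perp] sgn by simp
  moreover have "fn.pindex (fn.neg (mform H)) (fn.ext f U)
      = (if Re lam < 0 then Suc (fn.pindex (fn.neg (mform H)) U) else fn.pindex (fn.neg (mform H)) U)"
    using fn.pindex_ext_perp[OF fn.hform_neg[OF hH] fU(1), of f] perp sgn by (simp add: fn.neg_def)
  moreover have card: "card {i. i < Suc k \<and> R i} = (if R k then Suc (card {i. i < k \<and> R i}) else card {i. i < k \<and> R i})" for R
  proof -
    have "{i. i < Suc k \<and> R i} = (if R k then insert k {i. i < k \<and> R i} else {i. i < k \<and> R i})"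
      by (auto simp: less_Suc_eq)
    then show ?thesis by simp
  qed
  ultimately show ?case
    using Suc lamR unfolding ext extf card U_def[symmetric] lam_def by (auto simp: less_Suc_eq)
qed

text \<open>A Schur decomposition lists the eigenvalues with multiplicity on the diagonal of a
  triangular matrix, and the full flag \<open>k = N\<close> counts them by sign. That the diagonal
  is real matches the reality condition in \<open>ipos\<close> and \<open>ineg\<close>.\<close>

lemma ipos_ineg_form:
  assumes H: "hermitian H"
  shows "ipos H = fn.pindex (mform H) (fspace (dim_row H))" "ineg H = fn.pindex (fn.neg (mform H)) (fspace (dim_row H))"
proof -
  define N where "N = dim_row H"
  have HN: "H \<in> carrier_mat N N" using H by (auto simp: N_def hermitian_def)
  obtain as where as: "char_poly H = (\<Prod>a\<leftarrow>as. [:- a, 1:])" "length as = N"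
    using char_poly_factorized[OF HN] by blast
  obtain B P Q where "schur_decomposition H as = (B, P, Q)" by (cases "schur_decomposition H as")
  from schur_decomposition[OF HN as(1) this]
  have sim: "similar_mat_wit H B P Q" and ut: "upper_triangular B" and diag: "diag_mat B = as" by auto
  note s = similar_mat_witD2[OF HN sim]
  have "H * P = P * B * (Q * P)" using s by (simp add: assoc_mult_mat[of _ N N _ N _ N])
  then have HP: "H * P = P * B" using s by simp
  have nth: "as ! i = B $$ (i,i)" if "i < N" for i
    using that s(5) unfolding diag[symmetric] diag_mat_def by simp
  have "x \<in> mv P ` fspace N" if "x \<in> fspace N" for x
  proof -
    have "mv P (mv Q x) = mv (1\<^sub>m N) x" using mv_mult[of P Q x] s by auto
    also have "\<dots> = x" using that
      by (auto simp: mv_def fun_eq_iff fspace_def one_mat_def if_distrib[of "\<lambda>a. a * _"] cong: if_cong)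
    finally show ?thesis using mv_fspace[of Q x] s(7) by (metis carrier_matD(1) imageI)
  qed
  then have all: "mv P ` fspace N = fspace N" using mv_fspace[of P] s(6) by auto
  note T = inertia_triangular[OF H N_def[symmetric] s(6) s(7) s(5) ut s(2) HP order_refl, unfolded all]
  have "ipos H = card {i. i < length as \<and> (as ! i \<in> \<real> \<and> Re (as ! i) > 0)}"
    unfolding ipos_def using sum_order_eigenvalues[OF HN as(1)] by simp
  also have "{i. i < length as \<and> (as ! i \<in> \<real> \<and> Re (as ! i) > 0)} = {i. i < N \<and> Re (B $$ (i,i)) > 0}"
    using T nth as by auto
  finally show "ipos H = fn.pindex (mform H) (fspace (dim_row H))" using T N_def by simp
  have "ineg H = card {i. i < length as \<and> (as ! i \<in> \<real> \<and> Re (as ! i) < 0)}"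
    unfolding ineg_def using sum_order_eigenvalues[OF HN as(1)] by simp
  also have "{i. i < length as \<and> (as ! i \<in> \<real> \<and> Re (as ! i) < 0)} = {i. i < N \<and> Re (B $$ (i,i)) < 0}"
    using T nth as by auto
  finally show "ineg H = fn.pindex (fn.neg (mform H)) (fspace (dim_row H))" using T N_def by simp
qed

section \<open>Splitting vectors into two blocks\<close>

lemma trunc_add: "trunc n (x + y) = trunc n x + trunc n y" and trunc_scale: "trunc n (fscale c x) = fscale c (trunc n x)"
  by (auto simp: trunc_def fscale_apply fun_eq_iff)

lemma shift_add: "shift n (x + y) = shift n x + shift n y" and shift_scale: "shift n (fscale c x) = fscale c (shift n x)"
  by (auto simp: shift_def fscale_apply fun_eq_iff)

lemma shift_0: "x \<in> fspace n \<Longrightarrow> shift n x = 0"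
  by (auto simp: shift_def fspace_def fun_eq_iff)

lemma shift_fspace: "x \<in> fspace (n + m) \<Longrightarrow> shift n x \<in> fspace m"
  by (auto simp: shift_def fspace_def)

lemma join_fspace: "y \<in> fspace m \<Longrightarrow> join n x y \<in> fspace (n + m)"
  by (auto simp: join_def fspace_def)

lemma join_trunc_shift: "join n (trunc n x) (shift n x) = x"
  by (auto simp: join_def trunc_def shift_def fun_eq_iff)

lemma trunc_join: "x \<in> fspace n \<Longrightarrow> trunc n (join n x y) = x"
  by (auto simp: join_def trunc_def fspace_def fun_eq_iff)

lemma shift_join: "shift n (join n x y) = y"
  by (auto simp: join_def shift_def fun_eq_iff)

lemma join_add: "join n x y + join n x' y' = join n (x + x') (y + y')"
  by (auto simp: join_def fun_eq_iff)

lemma join_scale: "fscale c (join n x y) = join n (fscale c x) (fscale c y)"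
  by (auto simp: join_def fscale_apply fun_eq_iff)

lemma join_id: "x \<in> fspace n \<Longrightarrow> join n x 0 = x"
  by (auto simp: join_def fspace_def fun_eq_iff)

lemma mv_trunc: "mv A (trunc n x) = mv A x" if "dim_col A = n"
  using that by (intro mv_cong) (auto simp: trunc_def)

text \<open>The subspace \<open>F\<close> of the overview; with \<open>p\<close> in place of
  \<open>m\<close> it is also the isotropic subspace belonging to the zero corner of
  \<open>N1\<close>.\<close>

definition tails :: "nat \<Rightarrow> nat \<Rightarrow> (nat \<Rightarrow> complex) set" where
  "tails n m = {x \<in> fspace (n + m). trunc n x = 0}"

lemma subspace_tails: "fn.subspace (tails n m)"
  unfolding tails_def using subspace_fspace[of "n + m"]
  by (intro fn.subspaceI) (auto simp: trunc_add trunc_scale fn.subspace_add fn.subspace_scale fn.subspace_0, auto simp: trunc_def fscale_apply fun_eq_iff)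

lemma tails_sub: "tails n m \<subseteq> fspace (n + m)" by (auto simp: tails_def)

lemma join_tails: "y \<in> fspace m \<Longrightarrow> join n 0 y \<in> tails n m"
  using join_fspace[of y m n 0] by (auto simp: tails_def trunc_def join_def fun_eq_iff)

lemma dim_tails: "fn.dim (tails n m) = m"
proof -
  have "trunc n ` fspace (n + m) = fspace n"
    using trunc_fspace trunc_id fspace_mono[of n "n + m"] by (auto simp: image_iff) (metis le_add1 trunc_id subsetD)
  then show ?thesis
    using fn.rank_nullity[OF findim_fspace[of "n + m"], of "trunc n"] trunc_add trunc_scale dim_fspace
    unfolding tails_def by simp
qed

lemma span_tails:
  assumes K: "fn.subspace K" "K \<subseteq> fspace n"
  shows "fn.span (K \<union> tails n m) = {x \<in> fspace (n + m). trunc n x \<in> K}"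
    and "fn.dim (fn.span (K \<union> tails n m)) = fn.dim K + m"
proof -
  let ?G = "{x \<in> fspace (n + m). trunc n x \<in> K}"
  have sp: "fn.span K = K" "fn.span (tails n m) = tails n m" using K subspace_tails by simp_all
  show G: "fn.span (K \<union> tails n m) = ?G"
  proof (intro Set.set_eqI iffI)
    fix x assume "x \<in> fn.span (K \<union> tails n m)"
    then obtain k t where x: "k \<in> K" "t \<in> tails n m" "x = k + t" unfolding fn.span_Un sp by auto
    have "trunc n x = k" using x K trunc_id by (auto simp: trunc_add tails_def)
    moreover have "x \<in> fspace (n + m)" unfolding x(3)
      using x K fspace_mono[of n "n + m"] tails_sub[of n m] by (intro fspace_add) auto
    ultimately show "x \<in> ?G" using x by simp
  next
    fix x assume x: "x \<in> ?G"
    have "x = trunc n x + join n 0 (shift n x)" by (auto simp: trunc_def join_def shift_def fun_eq_iff)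
    moreover have "join n 0 (shift n x) \<in> tails n m" using x shift_fspace join_tails by blast
    ultimately show "x \<in> fn.span (K \<union> tails n m)" unfolding fn.span_Un sp using x by auto
  qed
  have sG: "fn.findim ?G" using fn.findim_subset[OF findim_fspace[of "n + m"]] G fn.subspace_span by (metis (no_types, lifting) mem_Collect_eq subsetI)
  have "trunc n ` ?G = K"
  proof
    show "K \<subseteq> trunc n ` ?G"
    proof
      fix k assume k: "k \<in> K"
      then have "k \<in> ?G" using K trunc_id fspace_mono[of n "n + m"] by auto
      moreover have "k = trunc n k" using k K trunc_id by auto
      ultimately show "k \<in> trunc n ` ?G" by blast
    qed
  qed auto
  moreover have "{x \<in> ?G. trunc n x = 0} = tails n m"
    unfolding tails_def using fn.subspace_0[OF K(1)] by auto
  ultimately show "fn.dim (fn.span (K \<union> tails n m)) = fn.dim K + m"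
    unfolding G using fn.rank_nullity[OF sG, of "trunc n"] trunc_add trunc_scale dim_tails by simp
qed

text \<open>Pairing with \<open>mv H x\<close> itself forces it to be zero, so the radical of the
  form is the kernel of \<open>H\<close>.\<close>

lemma orth_mform:
  assumes "dim_row H = N" shows "x \<in> fn.orth (mform H) (fspace N) \<longleftrightarrow> mv H x = 0"
proof
  assume x: "x \<in> fn.orth (mform H) (fspace N)"
  have "mv H x \<in> fspace N" using mv_fspace[of H] assms by simp
  then have "dot N (mv H x) (mv H x) = 0" using x assms by (auto simp: fn.orth_def mform_def)
  then show "mv H x = 0" using dot_pos[OF \<open>mv H x \<in> fspace N\<close>] by force
qed (simp add: fn.orth_def mform_def dot_def)

text \<open>For Hermitian \<open>H\<close> the left kernel is the radical, and Sylvester's law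
  becomes rank plus nullity.\<close>

lemma mrank_inertia: assumes "hermitian H" shows "mrank H = ipos H + ineg H"
proof -
  have "adj_ker H = fspace (dim_row H) \<inter> fn.orth (mform H) (fspace (dim_row H))"
    unfolding adj_ker_def using orth_mform[of H "dim_row H"] assms by (auto simp: hermitian_def)
  then show ?thesis
    using fn.inertia_radical[OF hform_mform[OF assms] findim_fspace[of "dim_row H"]] mrank_adj_ker[of H]
      ipos_ineg_form[OF assms] dim_fspace by simp
qed

section \<open>The quadratic matrix function\<close>

lemma Max_values:
  fixes f :: "complex mat \<Rightarrow> nat"
  assumes "\<And>X. X \<in> carrier_mat p m \<Longrightarrow> f X \<le> v" "\<exists>X\<in>carrier_mat p m. v \<le> f X"
  shows "Max {f X | X. X \<in> carrier_mat p m} = v"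
proof (rule Max_eqI)
  show "finite {f X | X. X \<in> carrier_mat p m}"
    by (rule finite_subset[of _ "{..v}"]) (use assms(1) in auto)
  show "v \<in> {f X | X. X \<in> carrier_mat p m}" using assms by (auto intro: antisym)
qed (use assms(1) in auto)

text \<open>The bound \<open>u\<close> makes the set of values finite, as \<open>Min\<close>
  requires.\<close>

lemma Min_values:
  fixes f :: "complex mat \<Rightarrow> nat"
  assumes "\<And>X. X \<in> carrier_mat p m \<Longrightarrow> f X \<le> u" "\<And>X. X \<in> carrier_mat p m \<Longrightarrow> v \<le> f X"
    "\<exists>X\<in>carrier_mat p m. f X \<le> v"
  shows "Min {f X | X. X \<in> carrier_mat p m} = v"
proof (rule Min_eqI)
  show "finite {f X | X. X \<in> carrier_mat p m}"
    by (rule finite_subset[of _ "{..u}"]) (use assms(1) in auto)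
  show "v \<in> {f X | X. X \<in> carrier_mat p m}" using assms(2,3) by (auto intro: antisym)
qed (use assms(2) in auto)

locale quadratic_function =
  fixes A B C D M :: "complex mat" and n p m q :: nat
  assumes A: "A \<in> carrier_mat n p" and B: "B \<in> carrier_mat m q"
    and C: "C \<in> carrier_mat n q" and D: "D \<in> carrier_mat n n" and DH: "hermitian D"
    and M: "M \<in> carrier_mat q q" and MH: "hermitian M"
begin

definition Q where "Q = D + C * M * mat_adjoint C"
definition P where "P = C * M * mat_adjoint B"
definition P' where "P' = B * M * mat_adjoint C"
definition S where "S = B * M * mat_adjoint B"
definition N1 where "N1 = four_block_mat Q A (mat_adjoint A) (0\<^sub>m p p)"
definition N2 where "N2 = four_block_mat Q (hcat P A) (mat_adjoint A) (0\<^sub>m p (m + p))"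
definition N3 where "N3 = four_block_mat Q P P' S"
definition N4 where "N4 = four_block_mat Q (hcat P A) P' (hcat S (0\<^sub>m m p))"
definition R where "R = mrank (hcat (hcat Q P) A)"
definition \<phi> where "\<phi> X = (A * X * B + C) * M * mat_adjoint (A * X * B + C) + D"

abbreviation h where "h \<equiv> mform N3"
definition E where "E = fspace (n + m)"
definition K where "K = adj_ker A"

lemma carrier [simp]: "Q \<in> carrier_mat n n" "P \<in> carrier_mat n m" "P' \<in> carrier_mat m n" "S \<in> carrier_mat m m"
  using A B C D M by (auto simp: Q_def P_def P'_def S_def)

lemma dims: "dim_row A = n" "dim_col A = p" "dim_row B = m" "dim_col B = q" "dim_row C = n" "dim_col C = q"
  "dim_row D = n" "dim_col D = n" "dim_row M = q" "dim_col M = q"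
  "dim_row Q = n" "dim_col Q = n" "dim_row P = n" "dim_col P = m" "dim_row P' = m" "dim_col P' = n"
  "dim_row S = m" "dim_col S = m"
  using A B C D M carrier by (auto simp only: carrier_matD)

lemma MD: "mat_adjoint M = M" "mat_adjoint D = D" using MH DH by (auto simp: hermitian_def)

lemma adj_sandwich:
  assumes "U \<in> carrier_mat r q" "V \<in> carrier_mat s q"
  shows "mat_adjoint (U * M * mat_adjoint V) = V * M * mat_adjoint U"
  using assms M by (simp add: adjoint_mult adjoint_adjoint MD assoc_mult_mat[of V s q M q "mat_adjoint U" r])

lemma adj: "mat_adjoint Q = Q" "mat_adjoint P = P'" "mat_adjoint P' = P" "mat_adjoint S = S"
proof -
  show "mat_adjoint Q = Q" unfolding Q_def using adj_sandwich[OF C C] dims MD by (subst adjoint_add) auto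
qed (unfold P_def P'_def S_def, (rule adj_sandwich B C)+)

lemma hermitian_N3: "hermitian N3" and hermitian_N1: "hermitian N1"
  using A by (simp_all add: hermitian_def N3_def N1_def dims adj adjoint_adjoint adjoint_zero
      adjoint_four_block[of Q n n P m P' m S] adjoint_four_block[of Q n n A p "mat_adjoint A" p "0\<^sub>m p p"])

lemma hermitian_phi: assumes X: "X \<in> carrier_mat p m" shows "hermitian (\<phi> X)" "\<phi> X \<in> carrier_mat n n"
proof -
  have Z: "A * X * B + C \<in> carrier_mat n q" using A X B C by auto
  have Z': "(A * X * B + C) * M * mat_adjoint (A * X * B + C) \<in> carrier_mat n n"
    by (rule mult_carrier_mat[OF mult_carrier_mat[OF Z M] adjoint_carrier[OF Z]])
  then show "\<phi> X \<in> carrier_mat n n" unfolding \<phi>_def using D by auto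
  have "mat_adjoint (\<phi> X) = \<phi> X"
    unfolding \<phi>_def using Z' D adj_sandwich[OF Z Z] MD by (subst adjoint_add) auto
  then show "hermitian (\<phi> X)" using \<open>\<phi> X \<in> carrier_mat n n\<close> by (simp add: hermitian_def)
qed

lemma N_dims: "dim_row N1 = n + p" "dim_row N2 = n + p" "dim_row N3 = n + m" "dim_row N4 = n + m"
  using dims by (simp_all add: N1_def N2_def N3_def N4_def hcat_def)

lemma mv_N3: "mv N3 x = join n (mv Q x + mv P (shift n x)) (mv P' x + mv S (shift n x))"
  unfolding N3_def by (rule mv_four_block[OF carrier])

lemma mv_N1: "mv N1 x = join n (mv Q x + mv A (shift n x)) (mv (mat_adjoint A) x)"
proof -
  have "mv (0\<^sub>m p p) y = 0" for y by (auto simp: mv_def fun_eq_iff)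
  then show ?thesis unfolding N1_def using A
    by (subst mv_four_block[of Q n n A p "mat_adjoint A" p]) simp_all
qed

interpretation hc: hermitian_complements fscale "mform N3" E "tails n m"
  by (intro_locales, unfold_locales)
    (auto simp: hform_mform[OF hermitian_N3] E_def findim_fspace subspace_tails tails_sub[THEN subsetD])

lemma K_iff: "x \<in> K \<longleftrightarrow> x \<in> fspace n \<and> mv (mat_adjoint A) x = 0"
  unfolding K_def adj_ker_def dims by auto

lemma K_orth: "K = fspace n \<inter> fn.orth (dot n) (col_space A)"
  unfolding K_def adj_ker_orth dims ..

lemma subspace_K: "fn.subspace K"
  unfolding K_orth using fn.subspace_inter subspace_fspace fn.subspace_orth[OF hform_dot] by blast

lemma K_sub: "K \<subseteq> fspace n" "K \<subseteq> E" unfolding K_orth E_def using fspace_mono[of n "n + m"] by auto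

lemma K_tails: "K \<inter> tails n m = {0}"
proof -
  have "x = 0" if "x \<in> K" "x \<in> tails n m" for x using that K_sub trunc_id unfolding tails_def by fastforce
  moreover have "0 \<in> K" "0 \<in> tails n m" using fn.subspace_0 subspace_K subspace_tails by auto
  ultimately show ?thesis by blast
qed

lemma G_iff: "hc.G K = {x \<in> E. trunc n x \<in> K}" and dim_G: "fn.dim (hc.G K) = fn.dim K + m"
  using span_tails[OF subspace_K K_sub(1), of m] unfolding E_def by auto

lemma dim_E: "fn.dim E = n + m" unfolding E_def by (rule dim_fspace)

lemma dim_col_space: "fn.dim K + fn.dim (col_space A) = n" using rank_adj_ker[of A] unfolding K_def dims by simp

lemma orth_E: "x \<in> fn.orth h E \<longleftrightarrow> mv N3 x = 0"
  unfolding E_def by (rule orth_mform[OF N_dims(3)])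

section \<open>Ranks and inertias of the block matrices as invariants of the form\<close>

lemma join_zero_iff:
  "join n (mv Q x + mv P y) z = 0 \<longleftrightarrow> mv Q x + mv P y = 0 \<and> z = 0"
  "join n (mv Q x + mv A y) z = 0 \<longleftrightarrow> mv Q x + mv A y = 0 \<and> z = 0"
  by (rule join_0, rule fspace_add, use mv_fspace dims in metis, use mv_fspace dims in metis)+

text \<open>Membership in \<open>K \<inter> orth h E\<close> asks that \<open>Q\<close>,
  \<open>P'\<close> and the adjoint of \<open>A\<close> annihilate \<open>x\<close>, and these are
  the three block rows of the adjoint of \<open>[Q, P, A]\<close>.\<close>

lemma R_eq: "R + fn.dim (K \<inter> fn.orth h E) = n"
proof -
  let ?H = "hcat (hcat Q P) A"
  have HQ: "hcat Q P \<in> carrier_mat n (n + m)" by (rule hcat_carrier) simp_all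
  have H: "?H \<in> carrier_mat n (n + m + p)" using hcat_carrier[OF HQ A] .
  have "mv (mat_adjoint ?H) x = 0 \<longleftrightarrow> mv Q x = 0 \<and> mv P' x = 0 \<and> mv (mat_adjoint A) x = 0" for x
  proof -
    have e: "mv (mat_adjoint ?H) x = join (n + m) (join n (mv Q x) (mv P' x)) (mv (mat_adjoint A) x)"
      unfolding mv_adjoint_hcat[OF HQ A] mv_adjoint_hcat[OF carrier(1,2)] adj ..
    have "mv Q x \<in> fspace n" "mv P' x \<in> fspace m" using mv_fspace dims by metis+
    then show ?thesis unfolding e by (simp add: join_0 join_fspace)
  qed
  moreover have "mv N3 x = 0 \<longleftrightarrow> mv Q x = 0 \<and> mv P' x = 0" if "x \<in> fspace n" for x
    unfolding mv_N3 join_zero_iff using shift_0[OF that] by (simp add: mv_0)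
  ultimately have "adj_ker ?H = K \<inter> fn.orth h E"
    unfolding adj_ker_def using H K_iff orth_E by auto
  then show ?thesis using mrank_adj_ker[of ?H] H unfolding R_def by auto
qed

text \<open>\<open>N4\<close> is \<open>N3\<close> with the block column of \<open>A\<close> and 0
  appended. Its left kernel consists of the vectors in the kernel of \<open>N3\<close> whose first
  block lies in \<open>K\<close>, and the latter condition describes \<open>G K\<close>.\<close>

lemma N4_eq: "mrank N4 + fn.dim (hc.G K \<inter> fn.orth h E) = n + m"
proof -
  have c: "hcat P A \<in> carrier_mat n (m + p)" "hcat S (0\<^sub>m m p) \<in> carrier_mat m (m + p)"
    using A by (auto intro!: hcat_carrier)
  have z: "mv (0\<^sub>m p m) y = 0" for y by (auto simp: mv_def fun_eq_iff)
  have e: "mv (mat_adjoint N4) x = join n (mv Q x + mv P (shift n x)) (join m (mv P' x + mv S (shift n x)) (mv (mat_adjoint A) x))" for x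
    unfolding N4_def adjoint_four_block[OF carrier(1) c(1) carrier(3) c(2)] adj
    by (subst mv_four_block[of Q n n P m _ "m + p"])
      (use c in \<open>simp_all add: mv_adjoint_hcat[OF carrier(2) A] mv_adjoint_hcat[OF carrier(4) zero_carrier_mat] adj adjoint_zero z join_add\<close>)
  have "mv P' x + mv S y \<in> fspace m" for x y
    using mv_fspace[of P'] mv_fspace[of S] dims fspace_add by metis
  then have "mv (mat_adjoint N4) x = 0 \<longleftrightarrow> mv N3 x = 0 \<and> mv (mat_adjoint A) x = 0" for x
    unfolding e mv_N3 join_zero_iff by (auto simp: join_0)
  moreover have "trunc n x \<in> K \<longleftrightarrow> mv (mat_adjoint A) x = 0" for x
    unfolding K_iff using trunc_fspace mv_trunc[of "mat_adjoint A" n] dims by simp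
  ultimately have "adj_ker N4 = hc.G K \<inter> fn.orth h E"
    unfolding adj_ker_def N_dims G_iff orth_E E_def by (auto simp: orth_E[unfolded E_def])
  then show ?thesis using mrank_adj_ker[of N4] N_dims by simp
qed

lemma mform_N3: "h x y = dot n (mv Q x + mv P (shift n x)) y + dot m (mv P' x + mv S (shift n x)) (shift n y)"
  unfolding mform_def N_dims mv_N3 dot_join ..

text \<open>Orthogonality to \<open>tails n m\<close> reads \<open>mv P' x = 0\<close>.
  Orthogonality to \<open>K\<close>, which is the orthogonal of the column space of
  \<open>A\<close>, puts \<open>mv Q x\<close> back into that column space.\<close>

lemma K_orth_G:
  assumes x: "x \<in> K"
  shows "x \<in> fn.orth h (hc.G K) \<longleftrightarrow> mv P' x = 0 \<and> mv Q x \<in> col_space A"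
proof -
  have xn: "x \<in> fspace n" using x K_sub by auto
  have h: "h x y = dot n (mv Q x) y + dot m (mv P' x) (shift n y)" for y
    unfolding mform_N3 using shift_0[OF xn] by (simp add: mv_0)
  have P'm: "mv P' x \<in> fspace m" and Qn: "mv Q x \<in> fspace n" using mv_fspace dims by metis+
  have "(\<forall>y\<in>tails n m. h x y = 0) \<longleftrightarrow> mv P' x = 0"
  proof
    assume a: "\<forall>y\<in>tails n m. h x y = 0"
    have "h x (join n 0 (mv P' x)) = dot m (mv P' x) (mv P' x)"
      unfolding h shift_join by (simp add: dot_def join_def)
    then have "dot m (mv P' x) (mv P' x) = 0" using a join_tails[OF P'm] by auto
    then show "mv P' x = 0" using dot_pos[OF P'm] by force
  next
    assume "mv P' x = 0"
    then have "h x y = dot n (mv Q x) (trunc n y)" for y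
      unfolding h by (simp add: dot_def trunc_def)
    then show "\<forall>y\<in>tails n m. h x y = 0" unfolding tails_def by (simp add: dot_def)
  qed
  moreover have "(\<forall>y\<in>K. h x y = 0) \<longleftrightarrow> mv Q x \<in> col_space A"
  proof -
    have hK: "h x y = dot n (mv Q x) y" if "y \<in> K" for y
    proof -
      have "y \<in> fspace n" using that K_sub by auto
      then show ?thesis unfolding h shift_0[OF \<open>y \<in> fspace n\<close>] by (simp add: dot_def)
    qed
    show ?thesis
    proof
      assume a: "\<forall>y\<in>K. h x y = 0"
      \<comment> \<open>The remainder \<open>mv Q x - t\<close> is orthogonal to all of C^n and
        hence zero.\<close>
      have "\<exists>t\<in>col_space A. \<forall>y\<in>fspace n. dot n y (mv Q x - t) = 0"
      proof (rule fn.project[OF hform_dot col_space_props(1) subspace_fspace])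
        fix y assume "y \<in> fspace n" "y \<in> fn.orth (dot n) (col_space A)"
        then have "dot n (mv Q x) y = 0" using a hK unfolding K_orth by auto
        then show "dot n y (mv Q x) = 0" using fn.h_sym0[OF hform_dot] by blast
      qed
      then obtain t where t: "t \<in> col_space A" "\<forall>y\<in>fspace n. dot n y (mv Q x - t) = 0" by blast
      have "t \<in> fspace n" using t col_space_props(3)[of A] dims by auto
      then have d: "mv Q x - t \<in> fspace n" using Qn fspace_diff by blast
      then have "mv Q x - t = 0" using t(2) dot_pos[OF d] by force
      then show "mv Q x \<in> col_space A" using t by simp
    next
      assume "mv Q x \<in> col_space A"
      then show "\<forall>y\<in>K. h x y = 0"
        using hK fn.h_sym0[OF hform_dot] unfolding K_orth by (auto simp: fn.orth_def)
    qed
  qed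
  moreover have "fn.orth h (hc.G K) = fn.orth h (K \<union> tails n m)"
    by (rule fn.orth_span[OF hform_mform[OF hermitian_N3]])
  ultimately show ?thesis by (auto simp: fn.orth_def)
qed

text \<open>The left kernel \<open>L\<close> consists of blocks \<open>x\<close>, \<open>w\<close>
  with \<open>Q x + A w = 0\<close> and \<open>x\<close> killed by \<open>P'\<close> and the adjoint
  of \<open>A\<close>. Its projection to \<open>x\<close> is \<open>K \<inter> orth h (G K)\<close>
  by \<open>K_orth_G\<close>, and the kernel of this projection is that of \<open>A\<close>, of
  dimension \<open>p\<close> minus the rank of \<open>A\<close>.\<close>

lemma N2_eq: "mrank N2 + fn.dim (K \<inter> fn.orth h (hc.G K)) = n + fn.dim (col_space A)"
proof -
  have c: "hcat P A \<in> carrier_mat n (m + p)" using A by (auto intro!: hcat_carrier)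
  have z: "mv (0\<^sub>m (m + p) p) y = 0" for y by (auto simp: mv_def fun_eq_iff)
  have e: "mv (mat_adjoint N2) x = join n (mv Q x + mv A (shift n x)) (join m (mv P' x) (mv (mat_adjoint A) x))" for x
    unfolding N2_def adjoint_four_block[OF carrier(1) c adjoint_carrier[OF A] zero_carrier_mat] adj adjoint_adjoint
    by (subst mv_four_block[of Q n n A p _ "m + p"])
      (use c A in \<open>simp_all add: mv_adjoint_hcat[OF carrier(2) A] adj adjoint_zero z\<close>)
  have P'm: "mv P' x \<in> fspace m" for x using mv_fspace dims by metis
  define L where "L = adj_ker N2"
  have L_iff: "x \<in> L \<longleftrightarrow> x \<in> fspace (n + p) \<and> mv Q x + mv A (shift n x) = 0 \<and> mv P' x = 0 \<and> mv (mat_adjoint A) x = 0" for x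
    unfolding L_def adj_ker_def N_dims using e join_zero_iff join_0[OF P'm] by auto
  have sL: "fn.subspace L"
    unfolding L_def adj_ker_orth using fn.subspace_inter subspace_fspace fn.subspace_orth[OF hform_dot] by blast
  have fL: "fn.findim L" using fn.findim_subset[OF findim_fspace[of "n + p"] sL] L_iff by blast
  have trunc_mv: "mv Q (trunc n x) = mv Q x" "mv P' (trunc n x) = mv P' x" "mv (mat_adjoint A) (trunc n x) = mv (mat_adjoint A) x" for x
    using mv_trunc dims by simp_all
  have neg: "mv A (fscale (- 1) w) = - mv A w" for w
    unfolding mv_scale by (simp add: fscale_def fun_eq_iff)
  have img: "trunc n ` L = K \<inter> fn.orth h (hc.G K)"
  proof (intro Set.set_eqI iffI)
    fix y assume "y \<in> trunc n ` L"
    then obtain x where x: "x \<in> L" "y = trunc n x" by auto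
    have yK: "y \<in> K" using x L_iff trunc_mv trunc_fspace by (simp add: K_iff)
    have "mv Q y = mv A (fscale (- 1) (shift n x))"
      unfolding neg using x L_iff trunc_mv by (simp add: eq_neg_iff_add_eq_0)
    moreover have "fscale (- 1) (shift n x) \<in> fspace p"
      using x L_iff shift_fspace fspace_scale by blast
    ultimately have "mv Q y \<in> col_space A" unfolding col_space_def dims by blast
    then show "y \<in> K \<inter> fn.orth h (hc.G K)" using K_orth_G[OF yK] yK x L_iff trunc_mv by simp
  next
    fix y assume y: "y \<in> K \<inter> fn.orth h (hc.G K)"
    then obtain w where w: "w \<in> fspace p" "mv Q y = mv A w" "mv P' y = 0"
      using K_orth_G unfolding col_space_def dims by auto
    have yn: "y \<in> fspace n" using y K_sub by auto
    define x where "x = join n y (fscale (- 1) w)"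
    have "x \<in> fspace (n + p)" unfolding x_def
      using w fspace_scale by (intro join_fspace) blast
    moreover have lox: "trunc n x = y" unfolding x_def using trunc_join[OF yn] .
    moreover have "shift n x = fscale (- 1) w" unfolding x_def shift_join ..
    ultimately have "x \<in> L" using L_iff[of x] trunc_mv[of x] w y K_iff neg by simp
    then show "y \<in> trunc n ` L" using lox by blast
  qed
  have "shift n ` {x \<in> L. trunc n x = 0} = {w \<in> fspace p. mv A w = 0}"
  proof (intro Set.set_eqI iffI)
    fix w assume "w \<in> shift n ` {x \<in> L. trunc n x = 0}"
    then obtain x where x: "x \<in> L" "trunc n x = 0" "w = shift n x" by auto
    then have "mv Q x = 0" using trunc_mv(1)[of x] by (simp add: mv_0)
    then show "w \<in> {w \<in> fspace p. mv A w = 0}" using x L_iff shift_fspace by auto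
  next
    fix w assume w: "w \<in> {w \<in> fspace p. mv A w = 0}"
    define x where "x = join n 0 w"
    have lox: "trunc n x = 0" unfolding x_def by (auto simp: trunc_def join_def fun_eq_iff)
    have "mv Q x = 0" "mv P' x = 0" "mv (mat_adjoint A) x = 0"
      using trunc_mv[of x] unfolding lox by (simp_all add: mv_0)
    moreover have "shift n x = w" unfolding x_def shift_join ..
    moreover have "x \<in> fspace (n + p)" unfolding x_def using w join_fspace by blast
    ultimately have "x \<in> L" using L_iff w by simp
    then show "w \<in> shift n ` {x \<in> L. trunc n x = 0}" using lox \<open>shift n x = w\<close> by auto
  qed
  moreover have "{x \<in> {x \<in> L. trunc n x = 0}. shift n x = 0} = {0}"
  proof -
    have "x = 0" if "trunc n x = 0" "shift n x = 0" for x
    proof -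
      have "x = join n 0 0" using that join_trunc_shift by metis
      then show ?thesis by (simp add: join_def fun_eq_iff)
    qed
    moreover have "0 \<in> L" using fn.subspace_0[OF sL] .
    moreover have "trunc n 0 = 0" "shift n 0 = 0" by (simp_all add: trunc_def shift_def fun_eq_iff)
    ultimately show ?thesis by blast
  qed
  moreover have "fn.findim {x \<in> L. trunc n x = 0}"
  proof -
    have "{x \<in> L. trunc n x = 0} = L \<inter> tails n p" unfolding tails_def using L_iff by auto
    then show ?thesis using fn.findim_subset[OF fL] fn.subspace_inter[OF sL subspace_tails] by (metis inf_le1)
  qed
  ultimately have ker: "fn.dim {x \<in> L. trunc n x = 0} = fn.dim {w \<in> fspace p. mv A w = 0}"
    using fn.rank_nullity[of "{x \<in> L. trunc n x = 0}" "shift n"] shift_add shift_scale fn.dim_zero by simp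
  have "fn.dim L = fn.dim (trunc n ` L) + fn.dim {x \<in> L. trunc n x = 0}"
    using fn.rank_nullity[OF fL, of "trunc n"] trunc_add trunc_scale by simp
  then show ?thesis
    using mrank_adj_ker[of N2] col_space_props(2)[of A] unfolding img ker N_dims dims L_def[symmetric] by simp
qed

text \<open>The subspace \<open>tails n p\<close> is isotropic for \<open>N1\<close> because of the
  zero corner, and its orthogonal is \<open>K + tails n p\<close>. On \<open>K\<close> the forms of
  \<open>N1\<close> and \<open>N3\<close> have the same values, both given by \<open>Q\<close>. The
  disjunction treats both signs at once.\<close>

lemma N1_extension:
  assumes "g = mform N1 \<and> g' = mform N3 \<or> g = fn.neg (mform N1) \<and> g' = fn.neg h"
  shows "fn.pindex g (fspace (n + p)) = fn.pindex g' K + fn.dim (col_space A)"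
proof -
  have h1: "mform N1 x y = dot n (mv Q x + mv A (shift n x)) y + dot p (mv (mat_adjoint A) x) (shift n y)" for x y
    unfolding mform_def N_dims mv_N1 dot_join ..
  have hg: "fn.hform g" using assms hform_mform[OF hermitian_N1] fn.hform_neg by auto
  have orth: "fn.orth g T = fn.orth (mform N1) T" for T using assms fn.orth_neg by auto
  have trunc_mv: "mv (mat_adjoint A) (trunc n x) = mv (mat_adjoint A) x" for x using mv_trunc dims by simp
  have "x \<in> fn.orth (mform N1) (tails n p) \<longleftrightarrow> mv (mat_adjoint A) x = 0" for x
  proof
    have Ap: "mv (mat_adjoint A) x \<in> fspace p" using mv_fspace[of "mat_adjoint A"] dims by simp
    assume "x \<in> fn.orth (mform N1) (tails n p)"
    then have "mform N1 x (join n 0 (mv (mat_adjoint A) x)) = 0" using join_tails[OF Ap] by (auto simp: fn.orth_def)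
    then have "dot p (mv (mat_adjoint A) x) (mv (mat_adjoint A) x) = 0"
      unfolding h1 shift_join by (simp add: dot_def join_def)
    then show "mv (mat_adjoint A) x = 0" using dot_pos[OF Ap] by force
  next
    assume 0: "mv (mat_adjoint A) x = 0"
    have "mform N1 x y = dot n (mv Q x + mv A (shift n x)) (trunc n y)" for y
      unfolding h1 0 by (simp add: dot_def trunc_def)
    then show "x \<in> fn.orth (mform N1) (tails n p)" unfolding fn.orth_def tails_def by (simp add: dot_def)
  qed
  then have L: "fn.span (K \<union> tails n p) = fspace (n + p) \<inter> fn.orth g (tails n p)"
    unfolding orth span_tails(1)[OF subspace_K K_sub(1)] using trunc_fspace trunc_mv by (auto simp: K_iff)
  have "K \<subseteq> fspace (n + p)" using K_sub fspace_mono[of n "n + p"] by auto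
  from fn.pindex_isotropic_extension[OF hg findim_fspace subspace_tails tails_sub subspace_K this L]
  have "fn.pindex g (fspace (n + p)) + (fn.dim K + p) = fn.pindex g K + (n + p)"
    unfolding span_tails(2)[OF subspace_K K_sub(1)] dim_fspace .
  moreover have "fn.pindex g K = fn.pindex g' K"
  proof (rule fn.pindex_cong)
    fix x assume "x \<in> K"
    then have "shift n x = 0" using shift_0 K_sub by blast
    then have "mform N1 x x = h x x" unfolding h1 mform_N3 by (simp add: mv_0 dot_def)
    then show "g x x = g' x x" using assms by (auto simp: fn.neg_def)
  qed
  ultimately show ?thesis using dim_col_space by simp
qed

lemma N1_inertia: "ipos N1 = fn.pindex h K + fn.dim (col_space A)" "ineg N1 = fn.pindex (fn.neg h) K + fn.dim (col_space A)"
  using ipos_ineg_form[OF hermitian_N1] N1_extension unfolding N_dims by auto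

lemma N3_inertia: "ipos N3 = fn.pindex h E" "ineg N3 = fn.pindex (fn.neg h) E"
  using ipos_ineg_form[OF hermitian_N3] unfolding N_dims E_def by auto

section \<open>Graphs and complements\<close>

definition graph where "graph X x = join n x (mv (mat_adjoint X) (mv (mat_adjoint A) x))"

lemma graph_linear: "graph X (x + y) = graph X x + graph X y" "graph X (fscale c x) = fscale c (graph X x)"
  by (simp_all add: graph_def mv_add mv_scale join_add join_scale)

lemma graph_0: "x \<in> fspace n \<Longrightarrow> graph X x = 0 \<Longrightarrow> x = 0"
  unfolding graph_def using join_0 by blast

text \<open>The adjoint of \<open>Z\<close>, applied to \<open>x\<close>, is \<open>w x\<close>.
  Both sides reduce to the form of \<open>D\<close> at \<open>x\<close>, \<open>y\<close> plus the
  form of \<open>M\<close> at \<open>w x\<close>, \<open>w y\<close>.\<close>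

lemma graph_form:
  assumes X: "X \<in> carrier_mat p m"
  shows "h (graph X x) (graph X y) = mform (\<phi> X) x y"
proof -
  define Z where "Z = A * X * B + C"
  have Z: "Z \<in> carrier_mat n q" unfolding Z_def using A X B C by auto
  define v where "v x = mv (mat_adjoint X) (mv (mat_adjoint A) x)" for x
  define w where "w x = mv (mat_adjoint C) x + mv (mat_adjoint B) (v x)" for x
  have dX: "dim_row X = p" "dim_col X = m" using X by auto
  have "mat_adjoint Z = mat_adjoint B * (mat_adjoint X * mat_adjoint A) + mat_adjoint C"
    unfolding Z_def using dims dX by (simp add: adjoint_add adjoint_mult)
  then have ZX: "mv (mat_adjoint Z) x = w x" for x
    unfolding w_def v_def using dims dX by (simp add: mv_add_mat mv_mult add.commute)
  have cong: "mv U (graph X x) = mv U x" if "dim_col U = n" for U x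
    using that by (intro mv_cong) (simp add: graph_def join_def)
  have shift: "shift n (graph X x) = v x" for x unfolding graph_def v_def shift_join ..
  have "mv Q (graph X x) + mv P (v x) = mv D x + mv C (mv M (w x))"
    unfolding cong[OF dims(12)] unfolding Q_def P_def w_def using dims
    by (simp add: mv_add_mat mv_mult mv_add add.assoc)
  moreover have "mv P' (graph X x) + mv S (v x) = mv B (mv M (w x))"
    unfolding cong[OF dims(16)] unfolding S_def P'_def w_def using dims
    by (simp add: mv_mult mv_add)
  ultimately have "h (graph X x) (graph X y) = dot n (mv D x + mv C (mv M (w x))) (graph X y) + dot m (mv B (mv M (w x))) (v y)"
    unfolding mform_N3 shift by simp
  also have "dot n u (graph X y) = dot n u y" for u by (rule dot_cong) (simp_all add: graph_def join_def)
  also have "dot n (mv D x + mv C (mv M (w x))) y + dot m (mv B (mv M (w x))) (v y)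
      = dot n (mv D x) y + dot q (mv M (w x)) (w y)"
    unfolding dot_add1 dot_adjoint[OF C] dot_adjoint[OF B] w_def[of y] dot_add2 by simp
  also have "dot q (mv M (w x)) (w y) = dot n (mv (Z * M * mat_adjoint Z) x) y"
    using Z M by (simp add: mv_mult dot_adjoint[OF Z] ZX)
  also have "dot n (mv D x) y + dot n (mv (Z * M * mat_adjoint Z) x) y = mform (\<phi> X) x y"
    using Z M D unfolding mform_def \<phi>_def Z_def[symmetric] by (simp add: mv_add_mat dot_add1 add.commute)
  finally show ?thesis .
qed

lemma pindex_phi:
  assumes X: "X \<in> carrier_mat p m"
  shows "ipos (\<phi> X) = fn.pindex h (graph X ` fspace n)" "ineg (\<phi> X) = fn.pindex (fn.neg h) (graph X ` fspace n)"
proof -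
  have d: "dim_row (\<phi> X) = n" using hermitian_phi(2)[OF X] by simp
  show "ipos (\<phi> X) = fn.pindex h (graph X ` fspace n)"
    unfolding ipos_ineg_form[OF hermitian_phi(1)[OF X]] d
    using fn.pindex_pullback[where f = "graph X" and h = "mform N3" and g = "mform (\<phi> X)",
        OF findim_fspace[of n] graph_linear graph_0] graph_form[OF X]
    by simp
  show "ineg (\<phi> X) = fn.pindex (fn.neg h) (graph X ` fspace n)"
    unfolding ipos_ineg_form[OF hermitian_phi(1)[OF X]] d
    using fn.pindex_pullback[where f = "graph X" and h = "fn.neg h" and g = "fn.neg (mform (\<phi> X))",
        OF findim_fspace[of n] graph_linear graph_0] graph_form[OF X]
    by (simp add: fn.neg_def)
qed

lemma graph_complement:
  assumes X: "X \<in> carrier_mat p m"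
  shows "fn.complement E (tails n m) (graph X ` fspace n)" "K \<subseteq> graph X ` fspace n"
proof -
  have v: "mv (mat_adjoint X) y \<in> fspace m" for y using mv_fspace[of "mat_adjoint X"] X by simp
  have sW: "fn.subspace (graph X ` fspace n)"
    using fn.rank_nullity[where f = "graph X", OF findim_fspace[of n] graph_linear] fn.findim_subspace by blast
  have WE: "graph X ` fspace n \<subseteq> E" unfolding E_def graph_def using v join_fspace by blast
  have "x = 0" if "x \<in> fspace n" "graph X x \<in> tails n m" for x
    using that trunc_join[of x n] unfolding tails_def graph_def by auto
  moreover have "graph X 0 = 0" by (simp add: graph_def mv_0) (auto simp: join_def fun_eq_iff)
  ultimately have int: "graph X ` fspace n \<inter> tails n m = {0}"
    using fn.subspace_0[OF sW] fn.subspace_0[OF subspace_tails] by auto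
  have "x \<in> fn.span (graph X ` fspace n \<union> tails n m)" if x: "x \<in> E" for x
  proof -
    define y where "y = shift n x - mv (mat_adjoint X) (mv (mat_adjoint A) (trunc n x))"
    have y: "y \<in> fspace m" unfolding y_def using x v shift_fspace unfolding E_def
      by (intro fspace_diff) auto
    have "x = graph X (trunc n x) + join n 0 y"
      unfolding graph_def y_def join_add by (simp add: join_trunc_shift)
    moreover have "graph X (trunc n x) \<in> graph X ` fspace n" using trunc_fspace by blast
    ultimately show ?thesis using join_tails[OF y] fn.span_add[OF fn.span_base fn.span_base] by (metis UnI1 UnI2)
  qed
  moreover have "fn.span (graph X ` fspace n \<union> tails n m) \<subseteq> E"
    using WE tails_sub[of n m] unfolding E_def by (intro fn.span_minimal subspace_fspace) auto
  ultimately show "fn.complement E (tails n m) (graph X ` fspace n)"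
    unfolding fn.complement_def using sW int by blast
  show "K \<subseteq> graph X ` fspace n"
  proof
    fix x assume "x \<in> K"
    then have "x \<in> fspace n" "graph X x = x" unfolding graph_def K_iff using join_id by (auto simp: mv_0)
    then show "x \<in> graph X ` fspace n" by (metis imageI)
  qed
qed

text \<open>\<open>W\<close> is the graph of a map \<open>f\<close>, and uniqueness of the second
  block makes \<open>f\<close> linear. As \<open>f\<close> vanishes on \<open>K\<close>, the
  orthogonal of the column space of \<open>A\<close>, each coordinate of \<open>f\<close> is
  represented by some \<open>mv A c\<close>; these vectors \<open>c\<close> are the columns of
  \<open>X\<close>.\<close>

lemma complement_graph:
  assumes W: "fn.complement E (tails n m) W" "K \<subseteq> W"
  shows "\<exists>X\<in>carrier_mat p m. W = graph X ` fspace n"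
proof -
  have sW: "fn.subspace W" and int: "W \<inter> tails n m = {0}" and sp: "fn.span (W \<union> tails n m) = E"
    using W unfolding fn.complement_def by auto
  have WE: "W \<subseteq> E" using fn.complement_subset W by blast
  have uniq: "y = z" if "join n x y \<in> W" "join n x z \<in> W" "y \<in> fspace m" "z \<in> fspace m" for x y z
  proof -
    have "join n 0 (y - z) = join n x y - join n x z" by (auto simp: join_def fun_eq_iff)
    then have "join n 0 (y - z) \<in> W" using that sW fn.subspace_diff by metis
    moreover have "join n 0 (y - z) \<in> tails n m"
      using that fspace_diff join_tails by blast
    ultimately have "join n 0 (y - z) = 0" using int by blast
    then have "shift n (join n 0 (y - z)) = 0" by (auto simp: shift_def)
    then show "y = z" unfolding shift_join by simp
  qed
  have "\<exists>y. y \<in> fspace m \<and> join n x y \<in> W" if x: "x \<in> fspace n" for x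
  proof -
    have "x \<in> fn.span (W \<union> tails n m)" unfolding sp E_def using x fspace_mono[of n "n + m"] by auto
    moreover have "fn.span W = W" "fn.span (tails n m) = tails n m" using sW subspace_tails by simp_all
    ultimately obtain w t where wt: "w \<in> W" "t \<in> tails n m" "x = w + t" unfolding fn.span_Un by auto
    have "trunc n w = x" using wt trunc_id[OF x] trunc_add[of n w t] unfolding tails_def by simp
    then have "join n x (shift n w) = w" using join_trunc_shift by metis
    then show ?thesis using wt WE shift_fspace unfolding E_def by (intro exI[of _ "shift n w"]) auto
  qed
  then obtain f where f: "\<And>x. x \<in> fspace n \<Longrightarrow> f x \<in> fspace m" "\<And>x. x \<in> fspace n \<Longrightarrow> join n x (f x) \<in> W"
    by metis
  have f_add: "f (x + y) = f x + f y" if "x \<in> fspace n" "y \<in> fspace n" for x y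
  proof (rule uniq)
    have xy: "x + y \<in> fspace n" using that fspace_add by blast
    show "join n (x + y) (f (x + y)) \<in> W" "f (x + y) \<in> fspace m" using f xy by auto
    show "f x + f y \<in> fspace m" using f that fspace_add by blast
    show "join n (x + y) (f x + f y) \<in> W"
      unfolding join_add[symmetric] using f that fn.subspace_add[OF sW] by blast
  qed
  have f_scale: "f (fscale c x) = fscale c (f x)" if "x \<in> fspace n" for x c
  proof (rule uniq)
    have xy: "fscale c x \<in> fspace n" using that fspace_scale by blast
    show "join n (fscale c x) (f (fscale c x)) \<in> W" "f (fscale c x) \<in> fspace m" using f xy by auto
    show "fscale c (f x) \<in> fspace m" using f that fspace_scale by blast
    show "join n (fscale c x) (fscale c (f x)) \<in> W"
      unfolding join_scale[symmetric] using f that fn.subspace_scale[OF sW] by blast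
  qed
  have f_K: "f x = 0" if x: "x \<in> K" for x
  proof (rule uniq)
    have xn: "x \<in> fspace n" using x K_sub by auto
    show "join n x (f x) \<in> W" "f x \<in> fspace m" using f xn by auto
    show "join n x 0 \<in> W" unfolding join_id[OF xn] using x W by auto
    show "0 \<in> fspace m" by (simp add: fspace_def)
  qed
  have "\<exists>c. c \<in> fspace p \<and> (\<forall>x\<in>fspace n. f x i = dot n x (mv A c))" for i
  proof -
    have "\<exists>t\<in>col_space A. \<forall>x\<in>fspace n. f x i = dot n x t"
    proof (rule fn.representer[OF hform_dot col_space_props(1) subspace_fspace])
      show "f (x + y) i = f x i + f y i" if "x \<in> fspace n" "y \<in> fspace n" for x y using f_add that by simp
      show "f (fscale c x) i = c * f x i" if "x \<in> fspace n" for c x using f_scale that by (simp add: fscale_apply)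
      show "f x i = 0" if "x \<in> fspace n" "x \<in> fn.orth (dot n) (col_space A)" for x
        using f_K[of x] that unfolding K_orth by simp
    qed
    then show ?thesis unfolding col_space_def dims by auto
  qed
  then obtain c where c: "\<And>i. c i \<in> fspace p" "\<And>i x. x \<in> fspace n \<Longrightarrow> f x i = dot n x (mv A (c i))" by metis
  define X where "X = mat p m (\<lambda>(k,i). c i k)"
  have X: "X \<in> carrier_mat p m" unfolding X_def by simp
  have fX: "f x = mv (mat_adjoint X) (mv (mat_adjoint A) x)" if x: "x \<in> fspace n" for x
  proof
    fix i
    show "f x i = mv (mat_adjoint X) (mv (mat_adjoint A) x) i"
    proof (cases "i < m")
      case True
      have "f x i = dot p (mv (mat_adjoint A) x) (c i)"
        using c(2)[OF x] dot_adjoint[OF adjoint_carrier[OF A], of x "c i"] by (simp add: adjoint_adjoint)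
      also have "\<dots> = mv (mat_adjoint X) (mv (mat_adjoint A) x) i"
        using True unfolding mv_def[of "mat_adjoint X"] by (simp add: X_def dot_def mult.commute)
      finally show ?thesis .
    next
      case False
      then show ?thesis using f(1)[OF x] X by (simp add: fspace_def mv_def)
    qed
  qed
  have "W = graph X ` fspace n"
  proof (intro Set.set_eqI iffI)
    fix w assume w: "w \<in> W"
    have lw: "trunc n w \<in> fspace n" by (rule trunc_fspace)
    have "shift n w = f (trunc n w)"
    proof (rule uniq)
      show "join n (trunc n w) (shift n w) \<in> W" unfolding join_trunc_shift by (rule w)
      show "shift n w \<in> fspace m" using w WE shift_fspace unfolding E_def by blast
    qed (use f lw in auto)
    then have "w = graph X (trunc n w)" unfolding graph_def fX[OF lw, symmetric] using join_trunc_shift by metis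
    then show "w \<in> graph X ` fspace n" using lw by blast
  next
    fix w assume "w \<in> graph X ` fspace n"
    then obtain x where x: "x \<in> fspace n" "w = graph X x" by auto
    then show "w \<in> W" unfolding graph_def using f(2) fX by simp
  qed
  then show ?thesis using X by blast
qed

interpretation hn: hermitian_complements fscale "fn.neg h" E "tails n m"
  by (rule hc.hermitian_complements_neg)

section \<open>Bounds and attainment for the quadratic matrix function\<close>

text \<open>Since \<open>dim E - dim (G K)\<close> is the rank of \<open>A\<close>, the bounds over
  complements become these once the ranks and inertias of the block matrices are substituted. The
  last one is Sylvester's law on \<open>W\<close>, of dimension \<open>n\<close>, whose radical
  contains \<open>K \<inter> orth h E\<close>.\<close>

lemma inertia_bounds:
  assumes X: "X \<in> carrier_mat p m"
  shows "ipos (\<phi> X) \<le> ipos N1" "ipos (\<phi> X) \<le> ipos N3"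
    and "ineg (\<phi> X) \<le> ineg N1" "ineg (\<phi> X) \<le> ineg N3"
    and "R + ipos N1 \<le> ipos (\<phi> X) + mrank N2" "R + ipos N3 \<le> ipos (\<phi> X) + mrank N4"
    and "R + ineg N1 \<le> ineg (\<phi> X) + mrank N2" "R + ineg N3 \<le> ineg (\<phi> X) + mrank N4"
    and "ipos (\<phi> X) + ineg (\<phi> X) \<le> R"
proof -
  define W where "W = graph X ` fspace n"
  note W = graph_complement[OF X, folded W_def]
  note pindex = pindex_phi[OF X, folded W_def]
  note d = dim_G dim_E dim_col_space
  have sW: "fn.subspace W" "W \<subseteq> E"
    using W(1) fn.complement_subset[OF W(1)] by (simp_all add: fn.complement_def)
  show "ipos (\<phi> X) \<le> ipos N1" "ineg (\<phi> X) \<le> ineg N1"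
    using hc.pindex_complement_le[OF W(1) subspace_K W(2)] hn.pindex_complement_le[OF W(1) subspace_K W(2)] d
    unfolding pindex N1_inertia by simp_all
  show "ipos (\<phi> X) \<le> ipos N3" "ineg (\<phi> X) \<le> ineg N3"
    unfolding pindex N3_inertia using fn.pindex_mono[OF hc.fE sW] by simp_all
  show "R + ipos N1 \<le> ipos (\<phi> X) + mrank N2" "R + ineg N1 \<le> ineg (\<phi> X) + mrank N2"
    using hc.pindex_complement_ge(1)[OF W(1) subspace_K W(2)] hn.pindex_complement_ge(1)[OF W(1) subspace_K W(2)]
      R_eq N2_eq d unfolding pindex N1_inertia by simp_all
  show "R + ipos N3 \<le> ipos (\<phi> X) + mrank N4" "R + ineg N3 \<le> ineg (\<phi> X) + mrank N4"
    using hc.pindex_complement_ge(2)[OF W(1) subspace_K W(2)] hn.pindex_complement_ge(2)[OF W(1) subspace_K W(2)]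
      R_eq N4_eq d unfolding pindex N3_inertia by simp_all
  have "{x \<in> fspace n. graph X x = 0} = {0}"
    using graph_0 graph_linear(2)[of X 0 0] fspace_0 by auto
  then have "fn.dim W = n"
    using fn.rank_nullity[where f = "graph X", OF findim_fspace[of n] graph_linear] dim_fspace fn.dim_zero
    unfolding W_def by simp
  moreover have fW: "fn.findim W" using fn.findim_subset[OF hc.fE sW] .
  moreover have "fn.dim (K \<inter> fn.orth h E) \<le> fn.dim (W \<inter> fn.orth h W)"
    using W(2) fn.orth_anti[OF hc.h sW(2)] hc.findim_orth[OF sW] hc.sub_orth[OF subspace_K]
    by (intro fn.dim_mono) auto
  ultimately show "ipos (\<phi> X) + ineg (\<phi> X) \<le> R"
    using fn.inertia_radical[OF hc.h fW] R_eq unfolding pindex by simp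
qed

lemma complement_phi:
  assumes "fn.complement E (tails n m) W" "K \<subseteq> W"
  obtains X where "X \<in> carrier_mat p m" "ipos (\<phi> X) = fn.pindex h W" "ineg (\<phi> X) = fn.pindex (fn.neg h) W"
  using complement_graph[OF assms] pindex_phi by blast

lemma ipos_max: "\<exists>X\<in>carrier_mat p m. min (ipos N1) (ipos N3) \<le> ipos (\<phi> X)"
proof -
  have "\<exists>W. fn.complement E (tails n m) W \<and> K \<subseteq> W \<and> min (ipos N1) (ipos N3) \<le> fn.pindex h W"
    using dim_G dim_E dim_col_space
    by (intro hc.pindex_complement_max subspace_K K_sub K_tails) (simp_all add: N1_inertia N3_inertia)
  then show ?thesis using complement_phi by metis
qed

lemma ineg_max: "\<exists>X\<in>carrier_mat p m. min (ineg N1) (ineg N3) \<le> ineg (\<phi> X)"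
proof -
  have "\<exists>W. fn.complement E (tails n m) W \<and> K \<subseteq> W \<and> min (ineg N1) (ineg N3) \<le> fn.pindex (fn.neg h) W"
    using dim_G dim_E dim_col_space
    by (intro hn.pindex_complement_max subspace_K K_sub K_tails) (simp_all add: N1_inertia N3_inertia)
  then show ?thesis using complement_phi by metis
qed

lemma rank_max: "\<exists>X\<in>carrier_mat p m. min R (min (mrank N1) (mrank N3)) \<le> mrank (\<phi> X)"
proof -
  have "\<exists>W. fn.complement E (tails n m) W \<and> K \<subseteq> W \<and>
      min R (min (mrank N1) (mrank N3)) \<le> fn.pindex h W + fn.pindex (fn.neg h) W"
    using dim_G dim_E dim_col_space R_eq
    by (intro hc.rank_complement_max subspace_K K_sub K_tails)
      (simp_all add: mrank_inertia hermitian_N1 hermitian_N3 N1_inertia N3_inertia)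
  then show ?thesis using complement_phi mrank_inertia hermitian_phi(1) by metis
qed

lemma inertia_min:
  fixes c d :: nat
  assumes "R + ipos N1 \<le> c + mrank N2" "R + ipos N3 \<le> c + mrank N4"
    and "R + ineg N1 \<le> d + mrank N2" "R + ineg N3 \<le> d + mrank N4"
  shows "\<exists>X\<in>carrier_mat p m. ipos (\<phi> X) \<le> c \<and> ineg (\<phi> X) \<le> d"
proof -
  have "\<exists>W. fn.complement E (tails n m) W \<and> K \<subseteq> W \<and> fn.pindex h W \<le> c \<and> fn.pindex (fn.neg h) W \<le> d"
    using assms dim_G dim_E dim_col_space R_eq N2_eq N4_eq
    by (intro hc.inertia_complement_min subspace_K K_sub K_tails) (simp_all add: N1_inertia N3_inertia)
  then show ?thesis using complement_phi by metis
qed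

text \<open>Ensures that \<open>R + ipos N1 - mrank N2\<close> is not truncated on the naturals. As
  this term enters a maximum, truncation of the other term to 0 does no harm.\<close>

lemma R_N2: "mrank N2 \<le> R + ipos N1" "mrank N2 \<le> R + ineg N1"
proof -
  have "fn.dim (K \<inter> fn.orth h E) \<le> fn.dim (K \<inter> fn.orth h (hc.G K))"
    using fn.orth_anti[OF hc.h hc.G_sub[OF K_sub(2)]] hc.findim_orth[OF subspace_K K_sub(2)]
      hc.sub_orth[OF subspace_K] by (intro fn.dim_mono) auto
  then show "mrank N2 \<le> R + ipos N1" "mrank N2 \<le> R + ineg N1"
    using R_eq N2_eq unfolding N1_inertia by simp_all
qed

end

theorem theorem4p1:
  fixes A B C D M :: "complex mat" and n p m q :: nat
  assumes A: "A \<in> carrier_mat n p" and B: "B \<in> carrier_mat m q"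
    and C: "C \<in> carrier_mat n q" and D: "D \<in> carrier_mat n n" and DH: "hermitian D"
    and M: "M \<in> carrier_mat q q" and MH: "hermitian M"
  defines "\<phi> \<equiv> (\<lambda>X. (A * X * B + C) * M * mat_adjoint (A * X * B + C) + D)"
    and "N1 \<equiv> four_block_mat (D + C * M * mat_adjoint C) A (mat_adjoint A) (0\<^sub>m p p)"
    and "N2 \<equiv> four_block_mat (D + C * M * mat_adjoint C) (hcat (C * M * mat_adjoint B) A)
                (mat_adjoint A) (0\<^sub>m p (m + p))"
    and "N3 \<equiv> four_block_mat (D + C * M * mat_adjoint C) (C * M * mat_adjoint B)
                (B * M * mat_adjoint C) (B * M * mat_adjoint B)"
    and "N4 \<equiv> four_block_mat (D + C * M * mat_adjoint C) (hcat (C * M * mat_adjoint B) A)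
                (B * M * mat_adjoint C) (hcat (B * M * mat_adjoint B) (0\<^sub>m m p))"
    and "R \<equiv> mrank (hcat (hcat (D + C * M * mat_adjoint C) (C * M * mat_adjoint B)) A)"
  shows "(Max {mrank (\<phi> X) | X. X \<in> carrier_mat p m} = min R (min (mrank N1) (mrank N3))
    \<and> int (Min {mrank (\<phi> X) | X. X \<in> carrier_mat p m}) = 2 * int R + max (max (int (mrank N1) - 2 * int (mrank N2))
                        (int (mrank N3) - 2 * int (mrank N4)))
                   (max (int (ipos N1) + int (ineg N3) - int (mrank N2) - int (mrank N4))
                        (int (ineg N1) + int (ipos N3) - int (mrank N2) - int (mrank N4)))
    \<and> Max {ipos (\<phi> X) | X. X \<in> carrier_mat p m} = min (ipos N1) (ipos N3)
    \<and> Max {ineg (\<phi> X) | X. X \<in> carrier_mat p m} = min (ineg N1) (ineg N3)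
    \<and> int (Min {ipos (\<phi> X) | X. X \<in> carrier_mat p m})
           = int R + max (int (ipos N1) - int (mrank N2)) (int (ipos N3) - int (mrank N4))
    \<and> int (Min {ineg (\<phi> X) | X. X \<in> carrier_mat p m})
           = int R + max (int (ineg N1) - int (mrank N2)) (int (ineg N3) - int (mrank N4)))"
proof -
  interpret quad: quadratic_function A B C D M n p m q
    using A B C D DH M MH by unfold_locales
  have eqs: "\<phi> = quad.\<phi>" "N1 = quad.N1" "N2 = quad.N2" "N3 = quad.N3" "N4 = quad.N4" "R = quad.R"
    by (simp_all add: fun_eq_iff \<phi>_def N1_def N2_def N3_def N4_def R_def quad.\<phi>_def quad.N1_def
        quad.N2_def quad.N3_def quad.N4_def quad.R_def quad.Q_def quad.P_def quad.P'_def quad.S_def)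
  note b = quad.inertia_bounds[folded eqs]
  have rank: "mrank (\<phi> X) = ipos (\<phi> X) + ineg (\<phi> X)" if "X \<in> carrier_mat p m" for X
    using mrank_inertia quad.hermitian_phi(1)[OF that] unfolding eqs .
  note rN = mrank_inertia[OF quad.hermitian_N1, folded eqs] mrank_inertia[OF quad.hermitian_N3, folded eqs]
  define c where "c = max (R + ipos N1 - mrank N2) (R + ipos N3 - mrank N4)"
  define d where "d = max (R + ineg N1 - mrank N2) (R + ineg N3 - mrank N4)"
  have c: "int c = int R + max (int (ipos N1) - int (mrank N2)) (int (ipos N3) - int (mrank N4))"
    unfolding c_def using quad.R_N2[folded eqs] by linarith
  have d: "int d = int R + max (int (ineg N1) - int (mrank N2)) (int (ineg N3) - int (mrank N4))"
    unfolding d_def using quad.R_N2[folded eqs] by linarith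
  have lower: "c \<le> ipos (\<phi> X)" "d \<le> ineg (\<phi> X)" if "X \<in> carrier_mat p m" for X
    unfolding c_def d_def using b(5-8)[OF that] by auto
  have att: "\<exists>X\<in>carrier_mat p m. ipos (\<phi> X) \<le> c \<and> ineg (\<phi> X) \<le> d"
    by (rule quad.inertia_min[folded eqs]) (auto simp: c_def d_def)
  have maxr: "Max {mrank (\<phi> X) | X. X \<in> carrier_mat p m} = min R (min (mrank N1) (mrank N3))"
    using b(1-4,9) rank rN quad.rank_max[folded eqs] by (intro Max_values) (auto intro: add_mono)
  have maxp: "Max {ipos (\<phi> X) | X. X \<in> carrier_mat p m} = min (ipos N1) (ipos N3)"
    using b quad.ipos_max[folded eqs] by (intro Max_values) auto
  have maxn: "Max {ineg (\<phi> X) | X. X \<in> carrier_mat p m} = min (ineg N1) (ineg N3)"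
    using b quad.ineg_max[folded eqs] by (intro Max_values) auto
  have minp: "Min {ipos (\<phi> X) | X. X \<in> carrier_mat p m} = c"
    using b(1) lower att by (intro Min_values[where u = "ipos N1"]) blast+
  have minn: "Min {ineg (\<phi> X) | X. X \<in> carrier_mat p m} = d"
    using b(3) lower att by (intro Min_values[where u = "ineg N1"]) blast+
  have minr: "Min {mrank (\<phi> X) | X. X \<in> carrier_mat p m} = c + d"
  proof (rule Min_values[where u = R])
    show "mrank (\<phi> X) \<le> R" if "X \<in> carrier_mat p m" for X using b(9)[OF that] rank[OF that] by simp
    show "c + d \<le> mrank (\<phi> X)" if "X \<in> carrier_mat p m" for X
      unfolding rank[OF that] using lower[OF that] by (rule add_mono)
    show "\<exists>X\<in>carrier_mat p m. mrank (\<phi> X) \<le> c + d" using att rank add_mono by metis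
  qed
  have "int (c + d) = 2 * int R + max (max (int (mrank N1) - 2 * int (mrank N2))
                        (int (mrank N3) - 2 * int (mrank N4)))
                   (max (int (ipos N1) + int (ineg N3) - int (mrank N2) - int (mrank N4))
                        (int (ineg N1) + int (ipos N3) - int (mrank N2) - int (mrank N4)))"
    unfolding rN of_nat_add c d by linarith
  with maxr maxp maxn c d show ?thesis
    unfolding minp minn minr by (intro conjI)
qed

end
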